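(* Let $d\ge 1$, $p\in(0,p_c(d))$ and let $\ell\in\mathbb{R}^d$ be a unit vector. For any $\lambda\ge 0$ and any $\beta\ge 0$, $$\frac{Y_t}{t}\xrightarrow[t\to+\infty]{} v(\lambda,\beta)\qquad P\text{-a.s.},$$ where $$v(\lambda,\beta)=\big(\mathbb{E}\, e^{\beta C_0}\big)^{-1} d(\lambda),\qquad d(\lambda)=\frac{1}{\sum_{k=1}^d\cosh(\lambda\ell_k)}\big(\sinh(\lambda\ell_k)\big)_{1\le k\le d}\in\mathbb{R}^d .$$ In particular, $v(\lambda,\beta)=0$ if $\beta>\xi$ or $\lambda=0$, whereas $v(\lambda,\beta)\cdot\ell>0$ if $\beta<\xi$ and $\lambda\ne 0$.
   Context: Environment. For $x,y\in\mathbb{Z}^d$ write $x\sim y$ if $\|x-y\|_1=1$. Let $\Omega=\{0,1\}^{\mathbb{Z}^d}$ with the product $\sigma$-field and $\mathbb{P}=\mathcal{B}(p)^{\otimes\mathbb{Z}^d}$, where $\mathcal{B}(p)$ is the Bernoulli law with parameter $p$; $\mathbb{E}$ is the expectation under $\mathbb{P}$. For $\omega\in\Omega$, a site $x$ is open if $\omega_x=1$ and closed otherwise. The cluster of an open site $x$ is the set consisting of $x$ and all $y$ connected to $x$ by a nearest-neighbour path all of whose vertices are open; the cluster of a closed site is empty. $C_x=C_x(\omega)$ is the cardinality of the cluster of $x$. $p_c=p_c(d)$ is the critical parameter of this site percolation ($p_c(1)=1$). It is known that for each $p<p_c$ there is $\xi=\xi(p)>0$ with $\lim_{n\to\infty}\frac1n\ln\mathbb{P}(C_x\ge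 n)=-\xi$ for all $x$; this defines $\xi$. Walk. Write $\ell=(\ell_k)_{1\le k\le d}$. For every $\omega$, $P_\omega$ (the quenched law) is the law of the continuous-time Markov chain $Y=(Y_t)_{t\ge0}$ on $\mathbb{Z}^d$, with right-continuous paths, started at $0$, with generator $$Lf(x)=K\sum_{e\sim 0}e^{\lambda\ell\cdot e-\beta C_x}\,[f(x+e)-f(x)],\qquad K=\Big(\sum_{e\sim0}e^{\lambda\ell\cdot e}\Big)^{-1}.$$ The annealed law is $P=\mathbb{P}\times P_\omega$, i.e. the joint law of $(\omega,Y)$ where $\omega$ has law $\mathbb{P}$ and, given $\omega$, $Y$ has law $P_\omega$. Convention: $(\mathbb{E}e^{\beta C_0})^{-1}=0$ if $\mathbb{E}e^{\beta C_0}=\infty$. *)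

theory Defs
  imports "HOL-Probability.Probability"
begin

section \<open>Site percolation\<close>

type_synonym 'd site = "int ^ 'd"

definition real_site :: "'d::finite site \<Rightarrow> real ^ 'd" where
  "real_site x = (\<chi> i. real_of_int (x $ i))"

definition adj :: "'d::finite site \<Rightarrow> 'd site \<Rightarrow> bool" where
  "adj x y \<longleftrightarrow> (\<Sum>i\<in>UNIV. \<bar>x $ i - y $ i\<bar>) = 1"

text \<open>An environment \<open>\<omega> :: 'd site \<Rightarrow> bool\<close> maps open sites to \<open>True\<close>.\<close>

definition env :: "real \<Rightarrow> ('d::finite site \<Rightarrow> bool) measure" where
  "env p = PiM UNIV (\<lambda>_. measure_pmf (bernoulli_pmf p))"

definition cluster :: "('d::finite site \<Rightarrow> bool) \<Rightarrow> 'd site \<Rightarrow> 'd site set" where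
  "cluster \<omega> x = {y. \<omega> x \<and> (\<lambda>u v. adj u v \<and> \<omega> u \<and> \<omega> v)\<^sup>*\<^sup>* x y}"

definition cluster_size :: "('d::finite site \<Rightarrow> bool) \<Rightarrow> 'd site \<Rightarrow> enat" where
  "cluster_size \<omega> x = (if finite (cluster \<omega> x) then enat (card (cluster \<omega> x)) else \<infinity>)"

text \<open>The dimension enters the critical parameter through the type argument.\<close>

definition critical_parameter :: "'d::finite itself \<Rightarrow> real" where
  "critical_parameter _ =
     Inf {p \<in> {0..1}. \<P>(\<omega> in env p. cluster_size \<omega> (0 :: 'd site) = \<infinity>) > 0}"

text \<open>
  Whenever the limit below exists it determines \<open>\<xi>\<close>, so this relation is the graph of the
  partial function \<open>p \<mapsto> \<xi>(p)\<close>.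
\<close>

definition decay_rate :: "'d::finite itself \<Rightarrow> real \<Rightarrow> real \<Rightarrow> bool" where
  "decay_rate _ p \<xi> \<longleftrightarrow>
     (\<forall>x :: 'd site.
        (\<lambda>n. ln \<P>(\<omega> in env p. enat n \<le> cluster_size \<omega> x) / real n) \<longlonglongrightarrow> - \<xi>)"


section \<open>Continuous-time Markov chains\<close>

text \<open>
  Right-continuous paths on \<open>[0,\<infinity>)\<close>, with the trace of the product \<open>\<sigma>\<close>-algebra. The state space
  is meant to be countable and discrete, which is the case for \<open>int ^ 'd\<close>. As elements of a
  product space, paths are \<open>undefined\<close> at negative times.
\<close>

definition path_space :: "(real \<Rightarrow> 's::topological_space) measure" where
  "path_space = restrict_space (PiM {0..} (\<lambda>_. count_space UNIV))
     {Y. \<forall>t\<ge>0. continuous (at_right t) Y}"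

definition transition_semigroup :: "(real \<Rightarrow> 's \<Rightarrow> 's pmf) \<Rightarrow> bool" where
  "transition_semigroup T \<longleftrightarrow>
     (\<forall>x. T 0 x = return_pmf x) \<and>
     (\<forall>s\<ge>0. \<forall>t\<ge>0. \<forall>x. T (s + t) x = bind_pmf (T s x) (T t))"

text \<open>
  The generator of a semigroup on the Banach space of bounded functions, in the case where its
  domain is the whole space. This covers bounded jump rates, hence the walk defined below.
\<close>

definition has_generator ::
    "(real \<Rightarrow> 's \<Rightarrow> 's pmf) \<Rightarrow> (('s \<Rightarrow> real) \<Rightarrow> 's \<Rightarrow> real) \<Rightarrow> bool" where
  "has_generator T L \<longleftrightarrow>
     (\<forall>f. bounded (range f) \<longrightarrow>
        uniform_limit UNIV (\<lambda>t x. (measure_pmf.expectation (T t x) f - f x) / t) (L f) (at_right 0))"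

definition markov_chain_law ::
    "(('s::topological_space \<Rightarrow> real) \<Rightarrow> 's \<Rightarrow> real) \<Rightarrow> 's \<Rightarrow> (real \<Rightarrow> 's) measure \<Rightarrow> bool" where
  "markov_chain_law L x0 Q \<longleftrightarrow>
     prob_space Q \<and> sets Q = sets path_space \<and> (AE Y in Q. Y 0 = x0) \<and>
     (\<exists>T. transition_semigroup T \<and> has_generator T L \<and>
        (\<forall>(n::nat) (s :: nat \<Rightarrow> real) (x :: nat \<Rightarrow> 's) t y.
           0 \<le> s 0 \<and> mono_on {..n} s \<and> s n \<le> t \<longrightarrow>
           \<P>(Y in Q. (\<forall>i\<le>n. Y (s i) = x i) \<and> Y t = y) =
           \<P>(Y in Q. \<forall>i\<le>n. Y (s i) = x i) * pmf (T (t - s n) (x n)) y))"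


section \<open>The walk\<close>

fun exp_ereal :: "ereal \<Rightarrow> ennreal" where
  "exp_ereal (ereal r) = ennreal (exp r)"
| "exp_ereal PInfty = \<infinity>"
| "exp_ereal MInfty = 0"

definition norm_const :: "real ^ 'd::finite \<Rightarrow> real \<Rightarrow> real" where
  "norm_const l lam = inverse (\<Sum>e\<in>{e. adj e 0}. exp (lam * (l \<bullet> real_site e)))"

text \<open>
  On the null event of an infinite cluster, the rate is read with \<open>exp (-\<infinity>) = 0\<close> and
  \<open>0 * \<infinity> = 0\<close>.
\<close>

definition walk_generator ::
    "real ^ 'd::finite \<Rightarrow> real \<Rightarrow> real \<Rightarrow> ('d site \<Rightarrow> bool) \<Rightarrow> ('d site \<Rightarrow> real) \<Rightarrow> 'd site \<Rightarrow> real" where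
  "walk_generator l lam \<beta> \<omega> f x =
     norm_const l lam *
     (\<Sum>e\<in>{e. adj e 0}.
        enn2real (exp_ereal (ereal (lam * (l \<bullet> real_site e))
                             - ereal \<beta> * ereal_of_enat (cluster_size \<omega> x)))
        * (f (x + e) - f x))"

definition quenched_law ::
    "real ^ 'd::finite \<Rightarrow> real \<Rightarrow> real \<Rightarrow> ('d site \<Rightarrow> bool) \<Rightarrow> (real \<Rightarrow> 'd site) measure \<Rightarrow> bool" where
  "quenched_law l lam \<beta> \<omega> Q \<longleftrightarrow> markov_chain_law (walk_generator l lam \<beta> \<omega>) 0 Q"

text \<open>
  The joint law of \<open>(\<omega>, Y)\<close>. For quenched laws \<open>Q\<close>, measurability of the kernel \<open>Q\<close> is automatic:
  the generator is bounded, so \<open>Q \<omega>\<close> is uniquely determined by it, and its finite-dimensional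
  distributions are measurable in \<open>\<omega>\<close>.
\<close>

definition annealed_law ::
    "real \<Rightarrow> (('d::finite site \<Rightarrow> bool) \<Rightarrow> (real \<Rightarrow> 'd site) measure) \<Rightarrow>
     (('d site \<Rightarrow> bool) \<times> (real \<Rightarrow> 'd site)) measure" where
  "annealed_law p Q =
     env p \<bind> (\<lambda>\<omega>. distr (Q \<omega>) (env p \<Otimes>\<^sub>M path_space) (\<lambda>Y. (\<omega>, Y)))"

definition drift :: "real ^ 'd::finite \<Rightarrow> real \<Rightarrow> real ^ 'd" where
  "drift l lam = (1 / (\<Sum>k\<in>UNIV. cosh (lam * l $ k))) *\<^sub>R (\<chi> k. sinh (lam * l $ k))"

text \<open>In \<open>ennreal\<close>, \<open>inverse \<infinity> = 0\<close>.\<close>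

definition speed :: "real \<Rightarrow> real ^ 'd::finite \<Rightarrow> real \<Rightarrow> real \<Rightarrow> real ^ 'd" where
  "speed p l lam \<beta> =
     enn2real (inverse
       (\<integral>\<^sup>+\<omega>. exp_ereal (ereal \<beta> * ereal_of_enat (cluster_size \<omega> (0 :: 'd site))) \<partial>env p))
     *\<^sub>R drift l lam"

end

(*
  Started from 0, the walk is a time change: its successive steps are i.i.d. with mean drift l lam,
  independent of the environment, and the holding time at x is exp (beta C_x) times an independent
  standard exponential variable. The environment seen from the walk at its jump times, together
  with the future steps and clocks, is a measure-preserving system. When the drift is nonzero the
  steps escape to infinity, so the mixing of the product measure under translations gives the
  convergence in mean of the averaged holding times, and Garsia's maximal inequality upgrades it to
  almost sure convergence: the n-th jump time is asymptotic to n E exp (beta C_0) (truncation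
  handles an infinite expectation), hence the speed. When the drift is zero, it suffices that the
  number of jumps up to time t is O(t), since holding times dominate the exponential clocks.

  An arbitrary quenched law is identified with the law of this construction on finite-dimensional
  events: conditioning on the first jump gives, for both, the same fixed-point equation, which has
  only one bounded solution. Right-continuity reduces the limit to rational times.

  The alternative between beta > xi and beta < xi is whether E exp (beta C_0) is infinite or not.
*)
theory Submission
  imports Defs
begin

section \<open>A pointwise ergodic theorem\<close>

text \<open>The factor exp(-\<beta> C_x) is the same in all directions and K normalises the rest,
  which is why the steps do not feel the environment. Ergodicity of the system is never proved: for
  products of a function of the environment and a function of the next step and clock, decay of
  correlations suffices. It comes from mixing along the displacement, hence only if the displacement
  leaves every finite set; this may fail without drift, and that case must do with a crude bound on
  the number of jumps.

  A quenched law is known only through its generator and lives on right-continuous paths, whereas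
  the constructed path is controlled only for streams whose clocks have infinite sum. The two laws
  are therefore compared on the full product space of paths, where the limit has to be an event on
  countably many times.

  Holding times have mean at least 1, so jump rates are at most 1. This rules out explosion, bounds
  the generator and makes the first-jump equation a contraction on bounded time intervals. Sites of
  infinite waiting time, with rate 0, are carried along by computing arrival times in
  \<open>ennreal\<close>.\<close>

lemma cesaro_null:
  fixes r :: "nat \<Rightarrow> real"
  assumes "r \<longlonglongrightarrow> 0"
  shows "(\<lambda>n. (\<Sum>k<n. r k) / real n) \<longlonglongrightarrow> 0"
proof (rule LIMSEQ_I)
  fix e :: real assume e: "0 < e"
  obtain N where N: "\<And>k. k \<ge> N \<Longrightarrow> \<bar>r k\<bar> < e / 2"
    using LIMSEQ_D[OF assms, of "e/2"] e by auto
  define A where "A = (\<Sum>k<N. \<bar>r k\<bar>)"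
  obtain K :: nat where K: "2 * (A + 1) / e < real K" using reals_Archimedean2 by blast
  have "norm ((\<Sum>k<n. r k) / real n - 0) < e" if n: "n \<ge> max N K" for n
  proof -
    have "A \<ge> 0" unfolding A_def by (simp add: sum_nonneg)
    then have "0 \<le> 2 * (A + 1) / e" using e by simp
    then have n0: "real n > 0" and nK: "2 * (A + 1) / e < real n" using n K by linarith+
    have "\<bar>\<Sum>k<n. r k\<bar> \<le> (\<Sum>k<n. \<bar>r k\<bar>)" by (rule sum_abs)
    also have "\<dots> = A + (\<Sum>k\<in>{N..<n}. \<bar>r k\<bar>)"
      using n unfolding A_def by (simp add: lessThan_atLeast0 sum.atLeastLessThan_concat)
    also have "(\<Sum>k\<in>{N..<n}. \<bar>r k\<bar>) \<le> real (card {N..<n}) * (e / 2)"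
      by (rule sum_bounded_above) (use N in \<open>auto intro: less_imp_le\<close>)
    also have "\<dots> \<le> real n * (e / 2)" using e by (intro mult_right_mono) auto
    also have "A + real n * (e / 2) < real n * e" using nK e by (simp add: field_simps)
    finally show ?thesis using n0 by (simp add: field_simps)
  qed
  then show "\<exists>no. \<forall>n\<ge>no. norm ((\<Sum>k<n. r k) / real n - 0) < e" by blast
qed

section \<open>Measure-preserving maps, maximal inequality and convergence of Birkhoff
  averages\<close>

locale measure_preserving = prob_space M for M :: "'a measure" +
  fixes T :: "'a \<Rightarrow> 'a"
  assumes T_measurable [measurable]: "T \<in> M \<rightarrow>\<^sub>M M" and distr_T: "distr M M T = M"
begin

lemma integral_T:
  fixes f :: "'a \<Rightarrow> real"
  assumes [measurable]: "f \<in> borel_measurable M"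
  shows "(\<integral>x. f (T x) \<partial>M) = (\<integral>x. f x \<partial>M)"
  using integral_distr[of T M M f] by (simp add: distr_T)

lemma integrable_T:
  fixes f :: "'a \<Rightarrow> real"
  assumes "integrable M f"
  shows "integrable M (\<lambda>x. f (T x))"
  using integrable_distr[of T M M f] assms by (simp add: distr_T)

lemma funpow_T_measurable [measurable]: "T ^^ n \<in> M \<rightarrow>\<^sub>M M"
  by (induction n) (auto intro: measurable_comp[OF _ T_measurable])

lemma integral_funpow_T:
  fixes f :: "'a \<Rightarrow> real"
  assumes [measurable]: "f \<in> borel_measurable M"
  shows "(\<integral>x. f ((T ^^ n) x) \<partial>M) = (\<integral>x. f x \<partial>M)"
proof (induction n)
  case (Suc n)
  have "(\<integral>x. f ((T ^^ n) (T x)) \<partial>M) = (\<integral>x. f ((T ^^ n) x) \<partial>M)"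
    by (rule integral_T) measurable
  then show ?case by (simp add: funpow_swap1 Suc)
qed simp

lemma integrable_funpow_T:
  fixes f :: "'a \<Rightarrow> real"
  assumes [simp]: "integrable M f"
  shows "integrable M (\<lambda>x. f ((T ^^ n) x))"
proof (induction n)
  case (Suc n)
  show ?case using integrable_T[OF Suc] by (simp add: funpow_swap1)
qed simp

definition birkhoff_sum :: "('a \<Rightarrow> real) \<Rightarrow> nat \<Rightarrow> 'a \<Rightarrow> real" where
  "birkhoff_sum f n x = (\<Sum>k<n. f ((T ^^ k) x))"

lemma birkhoff_sum_measurable [measurable]:
  assumes [measurable]: "f \<in> borel_measurable M"
  shows "birkhoff_sum f n \<in> borel_measurable M"
  unfolding birkhoff_sum_def[abs_def] by measurable

lemma integrable_birkhoff_sum: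
  assumes "integrable M f"
  shows "integrable M (birkhoff_sum f n)"
  unfolding birkhoff_sum_def[abs_def] using integrable_funpow_T[OF assms] by (rule Bochner_Integration.integrable_sum)

lemma birkhoff_sum_Suc: "birkhoff_sum f (Suc n) x = f x + birkhoff_sum f n (T x)"
  unfolding birkhoff_sum_def by (simp add: sum.lessThan_Suc_shift funpow_swap1 del: sum.lessThan_Suc)

text \<open>\<open>max_sum f n\<close> is the maximum of the Birkhoff sums of lengths \<open>1, \<dots>, n + 1\<close>.\<close>

fun max_sum :: "('a \<Rightarrow> real) \<Rightarrow> nat \<Rightarrow> 'a \<Rightarrow> real" where
  "max_sum f 0 x = f x"
| "max_sum f (Suc n) x = f x + max 0 (max_sum f n (T x))"

lemma birkhoff_sum_le_max_sum: "k \<le> n \<Longrightarrow> birkhoff_sum f (Suc k) x \<le> max_sum f n x"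
proof (induction n arbitrary: k x)
  case 0
  then show ?case by (simp add: birkhoff_sum_def)
next
  case (Suc n)
  show ?case
  proof (cases k)
    case 0
    then show ?thesis by (simp add: birkhoff_sum_def)
  next
    case (Suc j)
    then show ?thesis using Suc.IH[of j "T x"] Suc.prems by (simp add: birkhoff_sum_Suc[of f "Suc j"])
  qed
qed

lemma max_sum_mono: "max_sum f n x \<le> max_sum f (Suc n) x"
proof (induction n arbitrary: x)
  case (Suc n)
  show ?case using Suc[of "T x"] by (simp add: max_def)
qed simp

lemma max_sum_measurable [measurable]:
  assumes [measurable]: "f \<in> borel_measurable M"
  shows "max_sum f n \<in> borel_measurable M"
proof (induction n)
  case (Suc n)
  note [measurable] = Suc
  show ?case by simp
qed (simp cong: measurable_cong)

lemma integrable_max_sum: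
  assumes "integrable M f"
  shows "integrable M (max_sum f n)"
proof (induction n)
  case 0
  then show ?case using assms by simp
next
  case (Suc n)
  show ?case using integrable_T[OF Suc] assms by simp
qed

text \<open>Garsia's argument. The maxima satisfy
  \<open>m (Suc n) = f + m n \<circ> T + (m n \<circ> T)^-\<close>, with the negative part last. On
  an invariant set \<open>m n\<close> and \<open>m n \<circ> T\<close> have the same integral, so
  that \<open>m n \<le> m (Suc n)\<close> leaves the integral of \<open>f\<close> plus that of the
  negative part. The latter tends to 0, since on \<open>D\<close> some Birkhoff sum is
  positive.\<close>

lemma maximal_ergodic:
  assumes f: "integrable M f" and D [measurable]: "D \<in> sets M"
    and inv: "\<And>x. x \<in> space M \<Longrightarrow> T x \<in> D \<longleftrightarrow> x \<in> D"
    and pos: "\<And>x. x \<in> D \<Longrightarrow> \<exists>n. 0 < birkhoff_sum f n x"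
  shows "0 \<le> (\<integral>x. indicator D x * f x \<partial>M)"
proof -
  have [measurable]: "f \<in> borel_measurable M" using f by simp
  define m where "m = max_sum f"
  have m_meas [measurable]: "m n \<in> borel_measurable M" for n unfolding m_def by measurable
  have m_int: "integrable M (m n)" for n unfolding m_def by (rule integrable_max_sum[OF f])
  have ind_int: "integrable M (\<lambda>x. indicator D x * h x)" if "integrable M h" for h :: "'a \<Rightarrow> real"
    using integrable_mult_indicator[OF D that] by simp
  let ?neg = "\<lambda>n x. max 0 (- m n (T x))"
  have neg_int: "integrable M (\<lambda>x. ?neg n x)" for n
    using integrable_T[OF m_int[of n]] by simp
  have step: "0 \<le> (\<integral>x. indicator D x * f x \<partial>M) + (\<integral>x. indicator D x * ?neg n x \<partial>M)" for n
  proof -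
    have "(\<integral>x. indicator D x * m n x \<partial>M) = (\<integral>x. indicator D (T x) * m n (T x) \<partial>M)"
      by (rule integral_T[symmetric]) measurable
    also have "\<dots> = (\<integral>x. indicator D x * m n (T x) \<partial>M)"
      by (rule Bochner_Integration.integral_cong) (auto simp: inv indicator_def)
    finally have eq: "(\<integral>x. indicator D x * m n x \<partial>M) = (\<integral>x. indicator D x * m n (T x) \<partial>M)" .
    have "(\<integral>x. indicator D x * m n x \<partial>M) \<le> (\<integral>x. indicator D x * m (Suc n) x \<partial>M)"
      by (intro integral_mono ind_int m_int mult_left_mono) (auto simp: m_def max_sum_mono simp del: max_sum.simps)
    also have "(\<lambda>x. indicator D x * m (Suc n) x) =
        (\<lambda>x. indicator D x * f x + (indicator D x * ?neg n x + indicator D x * m n (T x)))"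
      by (auto simp: fun_eq_iff m_def indicator_def max_def)
    also have "(\<integral>x. indicator D x * f x + (indicator D x * ?neg n x + indicator D x * m n (T x)) \<partial>M) =
        (\<integral>x. indicator D x * f x \<partial>M) + ((\<integral>x. indicator D x * ?neg n x \<partial>M) + (\<integral>x. indicator D x * m n (T x) \<partial>M))"
      by (simp add: ind_int f neg_int integrable_T m_int Bochner_Integration.integral_add)
    finally show ?thesis using eq by simp
  qed
  have "(\<lambda>n. \<integral>x. indicator D x * ?neg n x \<partial>M) \<longlonglongrightarrow> (\<integral>x. 0 \<partial>M)"
  proof (rule integral_dominated_convergence[where w="\<lambda>x. \<bar>f (T x)\<bar>"])
    show "integrable M (\<lambda>x. \<bar>f (T x)\<bar>)" using integrable_T[OF f] by simp
    \<comment> \<open>The maxima dominate \<open>m 0 = f\<close>, so their negative parts are at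
      most \<open>\<bar>f\<bar>\<close>, uniformly in \<open>n\<close>.\<close>
    have mono: "incseq (\<lambda>n. m n y)" for y unfolding m_def by (intro incseq_SucI max_sum_mono)
    show "AE x in M. norm (indicator D x * ?neg n x) \<le> \<bar>f (T x)\<bar>" for n
    proof (rule AE_I2)
      fix x
      have "m 0 (T x) \<le> m n (T x)" using mono by (auto simp: incseq_def)
      then show "norm (indicator D x * ?neg n x) \<le> \<bar>f (T x)\<bar>" by (auto simp: m_def indicator_def)
    qed
    show "AE x in M. (\<lambda>n. indicator D x * ?neg n x) \<longlonglongrightarrow> 0"
    proof (rule AE_I2)
      fix x assume x: "x \<in> space M"
      show "(\<lambda>n. indicator D x * ?neg n x) \<longlonglongrightarrow> 0"
      proof (cases "x \<in> D")
        case True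
        then have "T x \<in> D" using inv[OF x] by simp
        from pos[OF this] obtain j where j: "0 < birkhoff_sum f j (T x)" by auto
        then obtain i where i: "j = Suc i" by (cases j) (auto simp: birkhoff_sum_def)
        have "0 < m n (T x)" if "n \<ge> i" for n
          using birkhoff_sum_le_max_sum[OF that, of f "T x"] j i by (simp add: m_def)
        then have "?neg n x = 0" if "n \<ge> i" for n using that by (simp add: less_imp_le)
        then have "eventually (\<lambda>n. indicator D x * ?neg n x = 0) sequentially"
          unfolding eventually_sequentially by (intro exI[of _ i]) simp
        then show ?thesis by (rule tendsto_eventually)
      qed simp
    qed
  qed measurable
  then have "(\<lambda>n. (\<integral>x. indicator D x * f x \<partial>M) + (\<integral>x. indicator D x * ?neg n x \<partial>M))
      \<longlonglongrightarrow> (\<integral>x. indicator D x * f x \<partial>M) + 0"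
    by (intro tendsto_add tendsto_const) simp
  then show ?thesis using step by (intro LIMSEQ_le_const[where a=0]) auto
qed

text \<open>Convergence in L1 to a constant, asked of one function at a time; it takes the place of
  ergodicity of \<open>T\<close>.\<close>

definition mean_ergodic :: "('a \<Rightarrow> real) \<Rightarrow> bool" where
  "mean_ergodic f \<longleftrightarrow> (\<lambda>n. \<integral>x. \<bar>birkhoff_sum f n x / real n - (\<integral>x. f x \<partial>M)\<bar> \<partial>M) \<longlonglongrightarrow> 0"

text \<open>
  The set where the Birkhoff sums of \<open>f - c - e\<close> are unbounded above is invariant. Convergence in
  mean makes the integral of \<open>f - c - e\<close> over it equal to \<open>- e\<close> times its measure, while the
  maximal inequality makes it nonnegative.
\<close>

lemma birkhoff_upper:
  assumes f: "integrable M f" and mean: "mean_ergodic f" and e: "0 < e"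
  shows "AE x in M. \<exists>K::nat. \<forall>n. birkhoff_sum f n x \<le> real K + ((\<integral>x. f x \<partial>M) + e) * real n"
proof -
  define c where "c = (\<integral>x. f x \<partial>M)"
  define h where "h x = f x - (c + e)" for x
  have [measurable]: "f \<in> borel_measurable M" using f by simp
  have h_int: "integrable M h" unfolding h_def using f by simp
  then have [measurable]: "h \<in> borel_measurable M" by simp
  have bh: "birkhoff_sum h n x = birkhoff_sum f n x - (c + e) * real n" for n x
    by (simp add: birkhoff_sum_def h_def sum_subtractf algebra_simps)
  define D where "D = {x \<in> space M. \<forall>K::nat. \<exists>n. birkhoff_sum h n x > real K}"
  have D [measurable]: "D \<in> sets M" unfolding D_def by measurable
  have ind_int: "integrable M (\<lambda>x. indicator D x * h x)" if "integrable M h" for h :: "'a \<Rightarrow> real"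
    using integrable_mult_indicator[OF D that] by simp
  have inv: "T x \<in> D \<longleftrightarrow> x \<in> D" if x: "x \<in> space M" for x
  proof
    have Tx: "T x \<in> space M" using x by (rule measurable_space[OF T_measurable])
    \<comment> \<open>Passing from \<open>x\<close> to \<open>T x\<close> changes a Birkhoff sum by
      the single term \<open>h x\<close>; \<open>k\<close> absorbs it, so unboundedness is preserved
      both ways.\<close>
    obtain k where k: "\<bar>h x\<bar> \<le> real k" using real_arch_simple by blast
    show "x \<in> D" if a: "T x \<in> D"
    proof -
      have "\<exists>n. birkhoff_sum h n x > real K" for K
      proof -
        have "\<exists>n. birkhoff_sum h n (T x) > real (K + k)" using a unfolding D_def by blast
        then obtain n where "birkhoff_sum h n (T x) > real (K + k)" ..
        then show ?thesis using k by (intro exI[of _ "Suc n"]) (auto simp: birkhoff_sum_Suc)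
      qed
      then show ?thesis using x by (auto simp: D_def)
    qed
    show "T x \<in> D" if a: "x \<in> D"
    proof -
      have "\<exists>n. birkhoff_sum h n (T x) > real K" for K
      proof -
        have "\<exists>n. birkhoff_sum h n x > real (K + k)" using a unfolding D_def by blast
        then obtain n where n: "birkhoff_sum h n x > real (K + k)" ..
        then obtain j where "n = Suc j" by (cases n) (auto simp: birkhoff_sum_def)
        then show ?thesis using k n by (intro exI[of _ j]) (auto simp: birkhoff_sum_Suc)
      qed
      then show ?thesis using Tx by (auto simp: D_def)
    qed
  qed
  have nonneg: "0 \<le> (\<integral>x. indicator D x * h x \<partial>M)"
  proof (rule maximal_ergodic[OF h_int D inv])
    show "\<exists>n. 0 < birkhoff_sum h n x" if "x \<in> D" for x
      using that unfolding D_def by (auto dest!: spec[of _ 0])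
  qed
  have invk: "(T ^^ k) x \<in> D \<longleftrightarrow> x \<in> D" if "x \<in> space M" for x k
  proof (induction k)
    case (Suc k)
    have "(T ^^ k) x \<in> space M" using that by (rule measurable_space[OF funpow_T_measurable])
    then show ?case using inv Suc by simp
  qed simp
  \<comment> \<open>All iterates of \<open>h\<close> have the same integral over the invariant set,
    so \<open>h\<close> may be replaced there by its average over \<open>n\<close> steps, which
    convergence in mean controls.\<close>
  have bound: "(\<integral>x. indicator D x * h x \<partial>M) \<le> (\<integral>x. \<bar>birkhoff_sum f n x / real n - c\<bar> \<partial>M) - e * measure M D"
    if n: "n > 0" for n
  proof -
    have "(\<integral>x. indicator D x * h ((T ^^ k) x) \<partial>M) = (\<integral>x. indicator D x * h x \<partial>M)" for k
    proof -
      have "(\<integral>x. indicator D x * h ((T ^^ k) x) \<partial>M) = (\<integral>x. indicator D ((T ^^ k) x) * h ((T ^^ k) x) \<partial>M)"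
        by (rule Bochner_Integration.integral_cong) (auto simp: invk indicator_def)
      also have "\<dots> = (\<integral>x. indicator D x * h x \<partial>M)" by (rule integral_funpow_T) measurable
      finally show ?thesis .
    qed
    then have "(\<integral>x. (\<Sum>k<n. indicator D x * h ((T ^^ k) x)) \<partial>M) = real n * (\<integral>x. indicator D x * h x \<partial>M)"
      by (subst Bochner_Integration.integral_sum) (auto intro: ind_int[OF integrable_funpow_T[OF h_int]])
    moreover have "(\<lambda>x. \<Sum>k<n. indicator D x * h ((T ^^ k) x)) = (\<lambda>x. real n * (indicator D x * (birkhoff_sum f n x / real n - c) - e * indicator D x))"
      using n by (auto simp: fun_eq_iff sum_distrib_left[symmetric] birkhoff_sum_def[of h, symmetric] bh field_simps)
    ultimately have "(\<integral>x. indicator D x * h x \<partial>M) = (\<integral>x. indicator D x * (birkhoff_sum f n x / real n - c) - e * indicator D x \<partial>M)"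
      using n by simp
    also have "\<dots> = (\<integral>x. indicator D x * (birkhoff_sum f n x / real n - c) \<partial>M) - e * measure M D"
      by (subst Bochner_Integration.integral_diff)
         (auto intro!: ind_int integrable_birkhoff_sum f simp: emeasure_eq_measure)
    also have "(\<integral>x. indicator D x * (birkhoff_sum f n x / real n - c) \<partial>M) \<le> (\<integral>x. \<bar>birkhoff_sum f n x / real n - c\<bar> \<partial>M)"
      using integrable_birkhoff_sum[OF f, of n]
      by (intro integral_mono ind_int) (auto simp: indicator_def intro: abs_ge_self)
    finally show ?thesis by simp
  qed
  have "(\<lambda>n. (\<integral>x. \<bar>birkhoff_sum f n x / real n - c\<bar> \<partial>M) - e * measure M D) \<longlonglongrightarrow> 0 - e * measure M D"
    using mean unfolding mean_ergodic_def c_def by (intro tendsto_diff tendsto_const)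
  then have "0 \<le> 0 - e * measure M D"
    using bound nonneg by (intro LIMSEQ_le_const[where a=0]) (auto intro!: exI[of _ 1] intro: order_trans)
  then have "measure M D = 0" using e by (simp add: mult_le_0_iff measure_le_0_iff)
  then have "AE x in M. x \<notin> D" using prob_eq_0[OF D] by simp
  then show ?thesis
    by (rule AE_mp) (auto intro!: AE_I2 simp: D_def bh c_def not_less algebra_simps)
qed

lemma mean_ergodic_uminus: "mean_ergodic f \<Longrightarrow> mean_ergodic (\<lambda>x. - f x)"
proof -
  have "\<bar>birkhoff_sum (\<lambda>x. - f x) n x / real n - (\<integral>x. - f x \<partial>M)\<bar> = \<bar>birkhoff_sum f n x / real n - (\<integral>x. f x \<partial>M)\<bar>" for n x
    by (simp add: birkhoff_sum_def sum_negf)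
  then show "mean_ergodic f \<Longrightarrow> mean_ergodic (\<lambda>x. - f x)" by (simp add: mean_ergodic_def)
qed

text \<open>The one-sided bound is applied to \<open>f\<close> and to \<open>- f\<close> with
  \<open>e = 1 / (j + 1)\<close> for all \<open>j\<close> at once; division by \<open>n\<close>
  removes the additive constants \<open>K1\<close> and \<open>K2\<close>.\<close>

theorem birkhoff_AE:
  assumes f: "integrable M f" and mean: "mean_ergodic f"
  shows "AE x in M. (\<lambda>n. birkhoff_sum f n x / real n) \<longlonglongrightarrow> (\<integral>x. f x \<partial>M)"
proof -
  define c where "c = (\<integral>x. f x \<partial>M)"
  have neg: "birkhoff_sum (\<lambda>x. - f x) n x = - birkhoff_sum f n x" for n x
    by (simp add: birkhoff_sum_def sum_negf)
  have "AE x in M. \<forall>j::nat. \<exists>K::nat. \<forall>n. birkhoff_sum f n x \<le> real K + (c + 1 / real (Suc j)) * real n"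
    unfolding AE_all_countable c_def by (intro allI birkhoff_upper f mean) simp
  moreover have "AE x in M. \<forall>j::nat. \<exists>K::nat. \<forall>n. - birkhoff_sum f n x \<le> real K + (- c + 1 / real (Suc j)) * real n"
    unfolding AE_all_countable c_def
  proof
    fix j :: nat
    show "AE x in M. \<exists>K::nat. \<forall>n. - birkhoff_sum f n x \<le> real K + (- (\<integral>x. f x \<partial>M) + 1 / real (Suc j)) * real n"
      using birkhoff_upper[of "\<lambda>x. - f x" "1 / real (Suc j)"] f mean_ergodic_uminus[OF mean] by (simp add: neg)
  qed
  ultimately show ?thesis
  proof eventually_elim
    case (elim x)
    show ?case
    proof (rule LIMSEQ_I, unfold c_def[symmetric])
      fix r :: real assume r: "0 < r"
      then obtain j where j: "1 / real (Suc j) < r / 2" using nat_approx_posE[of "r/2"] by auto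
      obtain K1 K2 :: nat where
        K1: "\<And>n. birkhoff_sum f n x \<le> real K1 + (c + 1 / real (Suc j)) * real n" and
        K2: "\<And>n. - birkhoff_sum f n x \<le> real K2 + (- c + 1 / real (Suc j)) * real n"
        using elim by blast
      obtain N :: nat where N: "2 * (real K1 + real K2 + 1) / r < real N" using reals_Archimedean2 by blast
      have "norm (birkhoff_sum f n x / real n - c) < r" if n: "n \<ge> N" for n
      proof -
        have "0 \<le> 2 * (real K1 + real K2 + 1) / r" using r by simp
        then have "real n > 0" and nN: "2 * (real K1 + real K2 + 1) / r < real n" using N n by linarith+
        then have a: "real K1 + real K2 + 1 < r / 2 * real n" using r by (simp add: field_simps)
        have b: "1 / real (Suc j) * real n \<le> r / 2 * real n" by (intro mult_right_mono) (use j in auto)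
        have "birkhoff_sum f n x - c * real n < r * real n" "- (r * real n) < birkhoff_sum f n x - c * real n"
        proof -
          have e: "r / 2 * real n = r * real n / 2" by simp
          show "birkhoff_sum f n x - c * real n < r * real n" "- (r * real n) < birkhoff_sum f n x - c * real n"
            using K1[of n] K2[of n] a b unfolding distrib_right e by linarith+
        qed
        then have "birkhoff_sum f n x / real n - c < r" "- r < birkhoff_sum f n x / real n - c"
          using \<open>real n > 0\<close> by (auto simp: field_simps)
        then show ?thesis by auto
      qed
      then show "\<exists>no. \<forall>n\<ge>no. norm (birkhoff_sum f n x / real n - c) < r" by blast
    qed
  qed
qed

text \<open>A second moment argument: by invariance the covariance of two iterates depends only on
  their lag, so the variance of the \<open>n\<close>-th average is at most twice the Cesaro mean of
  the absolute covariances. These tend to 0, and the L2 norm bounds the L1 norm.\<close>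

lemma mean_ergodic_bounded:
  assumes [measurable]: "f \<in> borel_measurable M" and bnd: "\<And>x. x \<in> space M \<Longrightarrow> \<bar>f x\<bar> \<le> B"
    and corr: "(\<lambda>n. \<integral>x. f x * f ((T ^^ n) x) \<partial>M) \<longlonglongrightarrow> (\<integral>x. f x \<partial>M)\<^sup>2"
  shows "mean_ergodic f"
proof -
  define c where "c = (\<integral>x. f x \<partial>M)"
  define h where "h x = f x - c" for x
  have [measurable]: "h \<in> borel_measurable M" unfolding h_def by measurable
  have f_int: "integrable M f"
    by (rule integrable_const_bound[where B=B]) (use bnd in auto)
  have h_bnd: "\<bar>h x\<bar> \<le> B + \<bar>c\<bar>" if "x \<in> space M" for x using bnd[OF that] unfolding h_def by auto
  have h_bnd_k: "\<bar>h ((T ^^ k) x)\<bar> \<le> B + \<bar>c\<bar>" if "x \<in> space M" for x k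
    using that by (intro h_bnd measurable_space[OF funpow_T_measurable])
  have f_bnd_k: "\<bar>f ((T ^^ k) x)\<bar> \<le> B" if "x \<in> space M" for x k
    using that by (intro bnd measurable_space[OF funpow_T_measurable])
  have hh_int: "integrable M (\<lambda>x. h ((T ^^ i) x) * h ((T ^^ j) x))" for i j
    by (rule integrable_const_bound[where B="(B + \<bar>c\<bar>) * (B + \<bar>c\<bar>)"])
       (use h_bnd_k in \<open>auto simp: abs_mult intro!: mult_mono AE_I2 intro: order_trans[OF abs_ge_zero]\<close>)
  have ff_int: "integrable M (\<lambda>x. f x * f ((T ^^ j) x))" for j
    by (rule integrable_const_bound[where B="B * B"])
       (use f_bnd_k bnd in \<open>auto simp: abs_mult intro!: mult_mono AE_I2 intro: order_trans[OF abs_ge_zero]\<close>)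
  define r where "r n = \<bar>\<integral>x. h x * h ((T ^^ n) x) \<partial>M\<bar>" for n
  have "(\<integral>x. h x * h ((T ^^ n) x) \<partial>M) = (\<integral>x. f x * f ((T ^^ n) x) \<partial>M) - c\<^sup>2" for n
  proof -
    have "(\<integral>x. h x * h ((T ^^ n) x) \<partial>M) =
      (\<integral>x. (f x * f ((T ^^ n) x) - c * f x) - (c * f ((T ^^ n) x) - c * c) \<partial>M)"
      by (simp add: h_def algebra_simps)
    also have "\<dots> = ((\<integral>x. f x * f ((T ^^ n) x) \<partial>M) - c * c) - (c * (\<integral>x. f ((T ^^ n) x) \<partial>M) - c * c)"
      using f_int ff_int integrable_funpow_T[OF f_int]
      by (simp add: Bochner_Integration.integral_diff c_def[symmetric] prob_space)
    also have "(\<integral>x. f ((T ^^ n) x) \<partial>M) = c" unfolding c_def by (rule integral_funpow_T) measurable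
    finally show ?thesis by (simp add: power2_eq_square)
  qed
  then have r0: "r \<longlonglongrightarrow> 0"
    unfolding r_def using tendsto_diff[OF corr tendsto_const[of "c\<^sup>2"]] by (simp add: tendsto_rabs_zero c_def)
  have r_nn: "r n \<ge> 0" for n by (simp add: r_def)
  have cov: "(\<integral>x. h ((T ^^ i) x) * h ((T ^^ j) x) \<partial>M) \<le> r (j - i)" if "i \<le> j" for i j
  proof -
    have "(T ^^ j) x = (T ^^ (j - i)) ((T ^^ i) x)" for x
      using that by (metis funpow_add comp_apply le_add_diff_inverse2)
    then have "(\<integral>x. h ((T ^^ i) x) * h ((T ^^ j) x) \<partial>M) = (\<integral>x. h x * h ((T ^^ (j - i)) x) \<partial>M)"
      using integral_funpow_T[of "\<lambda>x. h x * h ((T ^^ (j - i)) x)" i] by simp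
    then show ?thesis by (simp add: r_def)
  qed
  define S where "S n = birkhoff_sum h n" for n
  have S_meas [measurable]: "S n \<in> borel_measurable M" for n unfolding S_def by measurable
  have S2: "(\<integral>x. (S n x)\<^sup>2 \<partial>M) \<le> 2 * real n * (\<Sum>k<n. r k)" for n
  proof -
    have "(\<integral>x. (S n x)\<^sup>2 \<partial>M) = (\<Sum>i<n. \<Sum>j<n. \<integral>x. h ((T ^^ i) x) * h ((T ^^ j) x) \<partial>M)"
      by (simp add: S_def birkhoff_sum_def power2_eq_square sum_product hh_int Bochner_Integration.integral_sum)
    also have "\<dots> \<le> (\<Sum>i<n. 2 * (\<Sum>k<n. r k))"
    proof (rule sum_mono)
      fix i assume i: "i \<in> {..<n}"
      \<comment> \<open>Row \<open>i\<close> of the covariance matrix is cut at the diagonal: lags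
        \<open>0\<close> to \<open>i\<close> on one side, \<open>1\<close> to
        \<open>n - i - 1\<close> on the other, each part bounded by the sum of all
        \<open>r k\<close> with \<open>k < n\<close>.\<close>
      have "(\<Sum>j<n. \<integral>x. h ((T ^^ i) x) * h ((T ^^ j) x) \<partial>M) \<le> (\<Sum>j<n. r (i - j) * of_bool (j \<le> i) + r (j - i) * of_bool (i < j))"
      proof (rule sum_mono)
        fix j
        show "(\<integral>x. h ((T ^^ i) x) * h ((T ^^ j) x) \<partial>M) \<le> r (i - j) * of_bool (j \<le> i) + r (j - i) * of_bool (i < j)"
          using cov[of i j] cov[of j i] by (cases "j \<le> i") (auto simp: mult.commute)
      qed
      also have "\<dots> = (\<Sum>j\<in>{..i}. r (i - j)) + (\<Sum>j\<in>{i<..<n}. r (j - i))"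
      proof -
        have a: "{..<n} \<inter> {j. j \<le> i} = {..i}" and b: "{..<n} \<inter> {j. i < j} = {i<..<n}" using i by auto
        show ?thesis by (simp add: sum.distrib of_bool_def if_distrib[of "\<lambda>z. _ * z"] sum.If_cases a b)
      qed
      also have "(\<Sum>j\<in>{..i}. r (i - j)) = (\<Sum>k\<in>{..i}. r k)"
        by (rule sum.reindex_bij_witness[where i="\<lambda>k. i - k" and j="\<lambda>k. i - k"]) auto
      also have "\<dots> \<le> (\<Sum>k<n. r k)" using i r_nn by (intro sum_mono2) auto
      also have "(\<Sum>j\<in>{i<..<n}. r (j - i)) = (\<Sum>k\<in>{0<..<n-i}. r k)"
        by (rule sum.reindex_bij_witness[where i="\<lambda>k. i + k" and j="\<lambda>k. k - i"]) auto
      also have "\<dots> \<le> (\<Sum>k<n. r k)" using r_nn by (intro sum_mono2) auto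
      finally show "(\<Sum>j<n. \<integral>x. h ((T ^^ i) x) * h ((T ^^ j) x) \<partial>M) \<le> 2 * (\<Sum>k<n. r k)" by simp
    qed
    finally show ?thesis by simp
  qed
  define b where "b n = 2 * ((\<Sum>k<n. r k) / real n)" for n
  have b0: "(\<lambda>n. sqrt (b n)) \<longlonglongrightarrow> 0"
    unfolding b_def using tendsto_real_sqrt[OF tendsto_mult_right_zero[OF cesaro_null[OF r0]]] by simp
  have est: "(\<integral>x. \<bar>birkhoff_sum f n x / real n - c\<bar> \<partial>M) \<le> sqrt (b n)" if n: "n > 0" for n
  proof -
    have eq: "birkhoff_sum f n x / real n - c = S n x / real n" for x
      using n by (simp add: S_def birkhoff_sum_def h_def sum_subtractf field_simps)
    let ?X = "\<lambda>x. \<bar>S n x / real n\<bar>"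
    have S_int: "integrable M (S n)" unfolding S_def by (intro integrable_birkhoff_sum) (simp add: h_def[abs_def] f_int)
    have X_int: "integrable M ?X" using S_int by simp
    have "integrable M (\<lambda>x. (S n x)\<^sup>2)"
      by (simp add: S_def birkhoff_sum_def power2_eq_square sum_product hh_int)
    then have X2_int: "integrable M (\<lambda>x. (?X x)\<^sup>2)" by (simp add: power_divide)
    have "(\<integral>x. ?X x \<partial>M)\<^sup>2 \<le> (\<integral>x. (?X x)\<^sup>2 \<partial>M)"
      using variance_eq[OF X_int X2_int] variance_positive[of ?X] by linarith
    also have "\<dots> = (\<integral>x. (S n x)\<^sup>2 \<partial>M) / (real n)\<^sup>2" by (simp add: power_divide)
    also have "\<dots> \<le> 2 * real n * (\<Sum>k<n. r k) / (real n)\<^sup>2" by (intro divide_right_mono S2) simp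
    also have "\<dots> = b n" using n by (simp add: b_def power2_eq_square)
    finally show ?thesis unfolding eq by (rule real_le_rsqrt)
  qed
  show ?thesis unfolding mean_ergodic_def c_def[symmetric]
    by (rule tendsto_sandwich[OF _ _ tendsto_const b0])
       (use est in \<open>auto intro!: always_eventually simp: eventually_sequentially intro: exI[of _ 1]\<close>)
qed

text \<open>Averaging along \<open>T\<close> does not increase the L1 norm, so the property is
  closed in L1. Three errors of \<open>r / 4\<close> are added: the average of \<open>f - h\<close>,
  the average of \<open>h\<close>, and the difference of the means.\<close>

lemma mean_ergodic_approx:
  assumes f: "integrable M f"
    and approx: "\<And>e. 0 < e \<Longrightarrow> \<exists>h. integrable M h \<and> mean_ergodic h \<and> (\<integral>x. \<bar>f x - h x\<bar> \<partial>M) \<le> e"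
  shows "mean_ergodic f"
  unfolding mean_ergodic_def
proof (rule LIMSEQ_I)
  fix r :: real assume r: "0 < r"
  obtain h where h: "integrable M h" and mean: "mean_ergodic h" and fh: "(\<integral>x. \<bar>f x - h x\<bar> \<partial>M) \<le> r / 4"
    using approx[of "r/4"] r by auto
  have [measurable]: "f \<in> borel_measurable M" "h \<in> borel_measurable M" using f h by simp_all
  obtain N where N: "\<And>n. n \<ge> N \<Longrightarrow> \<bar>\<integral>x. \<bar>birkhoff_sum h n x / real n - (\<integral>x. h x \<partial>M)\<bar> \<partial>M\<bar> < r / 4"
    using LIMSEQ_D[OF mean[unfolded mean_ergodic_def], of "r/4"] r by auto
  have "norm ((\<integral>x. \<bar>birkhoff_sum f n x / real n - (\<integral>x. f x \<partial>M)\<bar> \<partial>M) - 0) < r" if n: "n \<ge> N + 1" for n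
  proof -
    have n0: "real n > 0" using n by simp
    let ?d = "\<lambda>x. \<bar>f x - h x\<bar>"
    have d_int: "integrable M ?d" using f h by simp
    let ?c = "(\<integral>x. f x \<partial>M)" and ?c' = "(\<integral>x. h x \<partial>M)"
    have "\<bar>?c - ?c'\<bar> = \<bar>\<integral>x. f x - h x \<partial>M\<bar>" using f h by simp
    also have "\<dots> \<le> (\<integral>x. ?d x \<partial>M)" by (rule integral_abs_bound)
    finally have cc: "\<bar>?c - ?c'\<bar> \<le> r / 4" using fh by simp
    have b_int [simp]: "integrable M (birkhoff_sum f n)" "integrable M (birkhoff_sum h n)" "integrable M (birkhoff_sum ?d n)"
      using f h d_int by (auto intro: integrable_birkhoff_sum)
    have pw: "\<bar>birkhoff_sum f n x / real n - ?c\<bar> \<le>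
        birkhoff_sum ?d n x / real n + (\<bar>birkhoff_sum h n x / real n - ?c'\<bar> + r / 4)" for x
    proof -
      have "\<bar>birkhoff_sum f n x - birkhoff_sum h n x\<bar> \<le> birkhoff_sum ?d n x"
        unfolding birkhoff_sum_def sum_subtractf[symmetric] by (rule sum_abs)
      then have "\<bar>birkhoff_sum f n x / real n - birkhoff_sum h n x / real n\<bar> \<le> birkhoff_sum ?d n x / real n"
        using n0 by (simp add: diff_divide_distrib[symmetric] divide_right_mono)
      then show ?thesis using cc by linarith
    qed
    have "(\<integral>x. birkhoff_sum ?d n x \<partial>M) = (\<Sum>k<n. \<integral>x. ?d x \<partial>M)"
      unfolding birkhoff_sum_def using integrable_funpow_T[OF d_int] integral_funpow_T[of ?d]
      by (subst Bochner_Integration.integral_sum) auto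
    then have d_eq: "(\<integral>x. birkhoff_sum ?d n x \<partial>M) = real n * (\<integral>x. ?d x \<partial>M)" by simp
    have "(\<integral>x. \<bar>birkhoff_sum f n x / real n - ?c\<bar> \<partial>M) \<le>
        (\<integral>x. birkhoff_sum ?d n x / real n + (\<bar>birkhoff_sum h n x / real n - ?c'\<bar> + r / 4) \<partial>M)"
      by (rule integral_mono[OF _ _ pw]) simp_all
    also have "\<dots> = (\<integral>x. birkhoff_sum ?d n x \<partial>M) / real n + ((\<integral>x. \<bar>birkhoff_sum h n x / real n - ?c'\<bar> \<partial>M) + r / 4)"
      by (subst Bochner_Integration.integral_add)
         (simp_all add: prob_space Bochner_Integration.integral_add)
    also have "\<dots> \<le> r / 4 + ((\<integral>x. \<bar>birkhoff_sum h n x / real n - ?c'\<bar> \<partial>M) + r / 4)"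
      using fh n0 by (simp add: d_eq)
    also have "\<dots> < r" using N[of n] n r by simp
    finally show ?thesis by simp
  qed
  then show "\<exists>no. \<forall>n\<ge>no. norm ((\<integral>x. \<bar>birkhoff_sum f n x / real n - (\<integral>x. f x \<partial>M)\<bar> \<partial>M) - 0) < r" by blast
qed

end

section \<open>Mixing of the environment under translations\<close>

text \<open>Weak convergence of uniformly bounded functions to a constant need only be tested on a
  generating \<pi>-system: the good \<open>f\<close> contain its indicators, are closed under
  disjoint unions and complements, and, since the \<open>h n\<close> share the bound
  \<open>B\<close>, are closed under dominated limits.\<close>

lemma integral_mult_tendsto_of_generator:
  fixes M :: "'a measure" and h :: "nat \<Rightarrow> 'a \<Rightarrow> real"
  assumes "prob_space M"
    and G: "sets M = sigma_sets (space M) G" "Int_stable G" "G \<subseteq> Pow (space M)"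
    and h [measurable]: "\<And>n. h n \<in> borel_measurable M"
    and bnd: "\<And>n x. x \<in> space M \<Longrightarrow> \<bar>h n x\<bar> \<le> B"
    and gen: "\<And>A. A \<in> G \<Longrightarrow> (\<lambda>n. \<integral>x. indicator A x * h n x \<partial>M) \<longlonglongrightarrow> c * measure M A"
    and total: "(\<lambda>n. \<integral>x. h n x \<partial>M) \<longlonglongrightarrow> c"
    and f: "integrable M f"
  shows "(\<lambda>n. \<integral>x. f x * h n x \<partial>M) \<longlonglongrightarrow> c * (\<integral>x. f x \<partial>M)"
proof -
  interpret prob_space M by fact
  define P where "P f \<longleftrightarrow> (\<lambda>n. \<integral>x. f x * h n x \<partial>M) \<longlonglongrightarrow> c * (\<integral>x. f x \<partial>M)" for f :: "'a \<Rightarrow> real"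
  obtain x0 where "x0 \<in> space M" using not_empty by blast
  then have B0: "B \<ge> 0" using bnd[of x0 0] by simp
  have fh_int: "integrable M (\<lambda>x. f x * h n x)" if "integrable M f" for f :: "'a \<Rightarrow> real" and n
  proof (rule Bochner_Integration.integrable_bound[where f="\<lambda>x. B * f x"])
    have [measurable]: "f \<in> borel_measurable M" using that by simp
    show "(\<lambda>x. f x * h n x) \<in> borel_measurable M" by measurable
    show "AE x in M. norm (f x * h n x) \<le> norm (B * f x)"
      using bnd B0 by (auto intro!: AE_I2 simp: abs_mult mult.commute[of "\<bar>f _\<bar>"] mult_right_mono)
    show "integrable M (\<lambda>x. B * f x)" using that by simp
  qed
  \<comment> \<open>Replacing \<open>f\<close> by \<open>s i\<close> costs at most \<open>B\<close>
    times their L1 distance in the integral and \<open>\<bar>c\<bar>\<close> times it in the limit,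
    whatever \<open>n\<close>.\<close>
  have P_lim: "P f" if s: "\<And>i. integrable M (s i)" "\<And>i. P (s i)" and f: "f \<in> borel_measurable M"
    and conv: "\<And>x. x \<in> space M \<Longrightarrow> (\<lambda>i. s i x) \<longlonglongrightarrow> f x"
    and dom: "\<And>i x. x \<in> space M \<Longrightarrow> \<bar>s i x\<bar> \<le> w x" and w: "integrable M w" for f s w
  proof -
    note [measurable] = f
    have [measurable]: "s i \<in> borel_measurable M" for i using s(1)[of i] by simp
    have f_int: "integrable M f"
      by (rule integrable_dominated_convergence[of f M s w]) (use conv dom w in \<open>auto intro!: AE_I2\<close>)
    have "(\<lambda>i. \<integral>x. \<bar>s i x - f x\<bar> \<partial>M) \<longlonglongrightarrow> (\<integral>x. 0 \<partial>M)"
    proof (rule integral_dominated_convergence[where w="\<lambda>x. w x + \<bar>f x\<bar>"])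
      show "AE x in M. (\<lambda>i. \<bar>s i x - f x\<bar>) \<longlonglongrightarrow> 0"
        using conv by (intro AE_I2 tendsto_rabs_zero) (auto simp: LIM_zero_iff)
      show "AE x in M. norm \<bar>s i x - f x\<bar> \<le> w x + \<bar>f x\<bar>" for i
        using dom[of _ i] by (intro AE_I2) (fastforce intro: order_trans[OF abs_triangle_ineq4])
    qed (use w f_int in auto)
    then have to0: "(\<lambda>i. \<integral>x. \<bar>s i x - f x\<bar> \<partial>M) \<longlonglongrightarrow> 0" by simp
    show ?thesis unfolding P_def
    proof (rule LIMSEQ_I)
      fix r :: real assume r: "0 < r"
      \<comment> \<open>Chosen so that \<open>(B + \<bar>c\<bar>) * e < r / 2\<close>; the
        \<open>1\<close> keeps the denominator positive.\<close>
      define e where "e = r / (2 * (B + \<bar>c\<bar> + 1))"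
      have e0: "e > 0" using r B0 unfolding e_def by (simp add: add_nonneg_pos)
      obtain i where "\<bar>\<integral>x. \<bar>s i x - f x\<bar> \<partial>M\<bar> < e" using LIMSEQ_D[OF to0 e0] by auto
      then have i: "(\<integral>x. \<bar>s i x - f x\<bar> \<partial>M) \<le> e" by simp
      obtain N where N: "\<And>n. n \<ge> N \<Longrightarrow> \<bar>(\<integral>x. s i x * h n x \<partial>M) - c * (\<integral>x. s i x \<partial>M)\<bar> < r / 2"
        using LIMSEQ_D[OF s(2)[of i, unfolded P_def], of "r/2"] r by auto
      have "norm ((\<integral>x. f x * h n x \<partial>M) - c * (\<integral>x. f x \<partial>M)) < r" if n: "n \<ge> N" for n
      proof -
        have "\<bar>(\<integral>x. s i x * h n x \<partial>M) - (\<integral>x. f x * h n x \<partial>M)\<bar> = \<bar>\<integral>x. (s i x - f x) * h n x \<partial>M\<bar>"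
          using fh_int[OF s(1)] fh_int[OF f_int] by (simp add: left_diff_distrib)
        also have "\<dots> \<le> (\<integral>x. \<bar>(s i x - f x) * h n x\<bar> \<partial>M)" by (rule integral_abs_bound)
        also have "\<dots> \<le> (\<integral>x. B * \<bar>s i x - f x\<bar> \<partial>M)"
          by (intro integral_mono integrable_abs fh_int)
             (use s(1)[of i] f_int bnd in \<open>auto simp: abs_mult mult.commute[of "\<bar>_ - _\<bar>"] mult_right_mono\<close>)
        also have "\<dots> \<le> B * e" using i B0 by (simp add: mult_left_mono)
        finally have 1: "\<bar>(\<integral>x. s i x * h n x \<partial>M) - (\<integral>x. f x * h n x \<partial>M)\<bar> \<le> B * e" .
        have "\<bar>(\<integral>x. s i x \<partial>M) - (\<integral>x. f x \<partial>M)\<bar> = \<bar>\<integral>x. s i x - f x \<partial>M\<bar>" using s(1) f_int by simp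
        also have "\<dots> \<le> (\<integral>x. \<bar>s i x - f x\<bar> \<partial>M)" by (rule integral_abs_bound)
        finally have "\<bar>(\<integral>x. s i x \<partial>M) - (\<integral>x. f x \<partial>M)\<bar> \<le> e" using i by simp
        then have "\<bar>c\<bar> * \<bar>(\<integral>x. s i x \<partial>M) - (\<integral>x. f x \<partial>M)\<bar> \<le> \<bar>c\<bar> * e" by (rule mult_left_mono) simp
        then have 2: "\<bar>c * (\<integral>x. s i x \<partial>M) - c * (\<integral>x. f x \<partial>M)\<bar> \<le> \<bar>c\<bar> * e"
          by (simp add: abs_mult right_diff_distrib[symmetric])
        have "B * e + \<bar>c\<bar> * e < (B + \<bar>c\<bar> + 1) * e" using e0 by (simp add: algebra_simps)
        also have "\<dots> = r / 2" unfolding e_def using B0 by (simp add: field_simps add_nonneg_eq_0_iff)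
        finally show ?thesis using 1 2 N[OF n] unfolding real_norm_def by linarith
      qed
      then show "\<exists>no. \<forall>n\<ge>no. norm ((\<integral>x. f x * h n x \<partial>M) - c * (\<integral>x. f x \<partial>M)) < r" by blast
    qed
  qed
  have P_add: "P (\<lambda>x. f x + g x)" if "integrable M f" "P f" "integrable M g" "P g" for f g
  proof -
    have "(\<lambda>n. (\<integral>x. f x * h n x \<partial>M) + (\<integral>x. g x * h n x \<partial>M)) \<longlonglongrightarrow> c * (\<integral>x. f x \<partial>M) + c * (\<integral>x. g x \<partial>M)"
      using that unfolding P_def by (intro tendsto_add)
    then show ?thesis unfolding P_def using that(1,3) fh_int by (simp add: distrib_right distrib_left)
  qed
  have scale: "P (\<lambda>x. k * f x)" if "P f" for k f
  proof -
    have "(\<lambda>n. k * (\<integral>x. f x * h n x \<partial>M)) \<longlonglongrightarrow> k * (c * (\<integral>x. f x \<partial>M))"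
      using that unfolding P_def by (intro tendsto_mult tendsto_const)
    then show ?thesis unfolding P_def by (simp add: mult.assoc mult.left_commute)
  qed
  have one: "P (\<lambda>x. 1)" using total unfolding P_def by (simp add: prob_space)
  have sets: "P (indicator A)" if "A \<in> sets M" for A
    using G(2,3) that unfolding G(1)
  proof (induction rule: sigma_sets_induct_disjoint)
    case (basic A)
    then have "A \<in> sets M" using G(1) by auto
    then show ?case using gen[OF basic] unfolding P_def by simp
  next
    case empty
    show ?case by (simp add: P_def)
  next
    case (compl A)
    then have A: "A \<in> sets M" using G(1) by simp
    have "P (\<lambda>x. 1 + (- 1) * indicator A x)"
      using A by (intro P_add scale compl one) (auto simp: emeasure_eq_measure)
    then have "P (\<lambda>x. 1 - indicator A x)" by simp
    moreover have "(\<integral>x. (1 - indicator A x) * h n x \<partial>M) = (\<integral>x. indicator (space M - A) x * h n x \<partial>M)" for n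
      by (rule Bochner_Integration.integral_cong) (auto simp: indicator_def)
    moreover have "(\<integral>x. 1 - indicat_real A x \<partial>M) = (\<integral>x. indicator (space M - A) x \<partial>M)"
      by (rule Bochner_Integration.integral_cong) (auto simp: indicator_def)
    ultimately show ?case unfolding P_def by (simp only:)
  next
    case (union A)
    then have A: "A i \<in> sets M" for i using G(1) by auto
    let ?s = "\<lambda>i x. indicator (\<Union>j<i. A j) x :: real"
    have Ps: "P (?s i)" for i
    proof (induction i)
      case 0
      show ?case by (simp add: P_def)
    next
      case (Suc i)
      have "?s (Suc i) = (\<lambda>x. ?s i x + indicator (A i) x)"
      proof
        fix x
        have "x \<notin> A j" if "x \<in> A i" "j < i" for j
        proof -
          have "A i \<inter> A j = {}" using union(1) that(2) by (simp add: disjoint_family_on_def)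
          then show ?thesis using that(1) by blast
        qed
        then show "?s (Suc i) x = ?s i x + indicator (A i) x"
          by (auto simp: indicator_def less_Suc_eq)
      qed
      then show ?case using A Suc union(3)
        by (auto intro!: P_add simp: emeasure_eq_measure)
    qed
    show ?case
    proof (rule P_lim[of ?s _ "\<lambda>_. 1"])
      show "(\<lambda>i. ?s i x) \<longlonglongrightarrow> indicator (\<Union>i. A i) x" for x
      proof (cases "x \<in> (\<Union>i. A i)")
        case True
        then obtain j where "x \<in> A j" by auto
        then have "eventually (\<lambda>i. ?s i x = indicator (\<Union>i. A i) x) sequentially"
          unfolding eventually_sequentially by (intro exI[of _ "Suc j"]) (auto simp: indicator_def)
        then show ?thesis by (rule tendsto_eventually)
      qed (auto simp: indicator_def)
      show "integrable M (?s i)" for i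
      proof (rule integrable_real_indicator)
        show "(\<Union>j<i. A j) \<in> sets M" using A by auto
      qed (simp add: emeasure_eq_measure)
      show "indicator (\<Union>i. A i) \<in> borel_measurable M" using A by (intro borel_measurable_indicator) auto
      show "P (?s i)" for i by (rule Ps)
    qed (auto simp: indicator_def)
  qed
  have "P f" using f
  proof (induction rule: integrable_induct)
    case (base A k)
    then show ?case using scale[OF sets, of A k] by (simp add: mult.commute)
  next
    case (add f g)
    then show ?case by (intro P_add)
  next
    case (lim f s)
    show ?case
      by (rule P_lim[of s f "\<lambda>x. 2 * norm (f x)"]) (use lim in auto)
  qed
  then show ?thesis by (simp add: P_def)
qed

text \<open>The environment seen from \<open>y\<close>: the old site \<open>y\<close> becomes the
  new origin.\<close>

definition translate :: "'d::finite site \<Rightarrow> ('d site \<Rightarrow> bool) \<Rightarrow> 'd site \<Rightarrow> bool" where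
  "translate y \<omega> = (\<lambda>z. \<omega> (z + y))"

lemma translate_0 [simp]: "translate 0 \<omega> = \<omega>"
  by (simp add: translate_def)

lemma translate_translate: "translate x (translate y \<omega>) = translate (x + y) \<omega>"
  by (simp add: translate_def add.assoc)

lemma space_env [simp]: "space (env p) = UNIV"
  by (simp add: env_def space_PiM)

interpretation env: product_prob_space "\<lambda>_. measure_pmf (bernoulli_pmf p)" "UNIV :: 'd::finite site set" for p
  by unfold_locales

lemma prob_space_env: "prob_space (env p)"
  unfolding env_def by (intro prob_space_PiM prob_space_measure_pmf)

lemma measurable_env_component [measurable]: "(\<lambda>\<omega>. \<omega> z) \<in> env p \<rightarrow>\<^sub>M count_space UNIV"
proof -
  have "(\<lambda>\<omega>. \<omega> z) \<in> env p \<rightarrow>\<^sub>M measure_pmf (bernoulli_pmf p)"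
    unfolding env_def by (rule measurable_component_singleton) simp
  then show ?thesis by (simp cong: measurable_cong_sets)
qed

lemma translate_measurable [measurable]: "translate y \<in> env p \<rightarrow>\<^sub>M env p"
proof -
  have "(\<lambda>\<omega> z. \<omega> (z + y)) \<in> env p \<rightarrow>\<^sub>M env p"
    unfolding env_def
  proof (rule measurable_PiM_single')
    show "(\<lambda>\<omega>. \<omega> (i + y)) \<in> Pi\<^sub>M UNIV (\<lambda>_. measure_pmf (bernoulli_pmf p)) \<rightarrow>\<^sub>M measure_pmf (bernoulli_pmf p)" for i
      by (rule measurable_component_singleton) simp
  qed (simp add: space_PiM)
  then show ?thesis by (simp add: translate_def[abs_def])
qed

lemma distr_translate: "distr (env p) (env p) (translate y) = env p"
  using distr_PiM_reindex[of UNIV "\<lambda>_. measure_pmf (bernoulli_pmf p)" "\<lambda>z. z + y" UNIV]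
  by (simp add: env_def translate_def[abs_def] prob_space_measure_pmf restrict_UNIV)

lemma integral_translate:
  fixes f :: "('d::finite site \<Rightarrow> bool) \<Rightarrow> real"
  assumes [measurable]: "f \<in> borel_measurable (env p)"
  shows "(\<integral>\<omega>. f (translate y \<omega>) \<partial>env p) = (\<integral>\<omega>. f \<omega> \<partial>env p)"
  using integral_distr[of "translate y" "env p" "env p" f] by (simp add: distr_translate)

section \<open>Cylinder events and mixing\<close>

definition cylinder :: "'d::finite site set \<Rightarrow> ('d site \<Rightarrow> bool set) \<Rightarrow> ('d site \<Rightarrow> bool) set" where
  "cylinder J E = {\<omega>. \<forall>i\<in>J. \<omega> i \<in> E i}"

lemma measure_cylinder:
  assumes "finite J"
  shows "measure (env p) (cylinder J E) = (\<Prod>i\<in>J. measure_pmf.prob (bernoulli_pmf p) (E i))"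
proof -
  have eq: "prod_emb UNIV (\<lambda>_. measure_pmf (bernoulli_pmf p)) J (Pi\<^sub>E J E) = cylinder J E"
    by (auto simp: prod_emb_def cylinder_def PiE_iff)
  show ?thesis using env.measure_PiM_emb[of J E p, OF subset_UNIV assms] by (simp add: eq env_def)
qed

lemma sets_env_cylinder: "finite J \<Longrightarrow> cylinder J E \<in> sets (env p)"
proof -
  assume J: "finite J"
  have "{\<omega> \<in> space (env p). \<omega> i \<in> E i} \<in> sets (env p)" for i
    using measurable_sets[OF measurable_env_component[of i p], of "E i"] by (simp add: vimage_def)
  then have "{\<omega> \<in> space (env p). \<forall>i\<in>J. \<omega> i \<in> E i} \<in> sets (env p)"
    by (intro sets.sets_Collect_finite_All J)
  then show ?thesis by (simp add: cylinder_def)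
qed

definition cylinders :: "('d::finite site \<Rightarrow> bool) set set" where
  "cylinders = {cylinder J E | J E. finite J}"

lemma cylinder_Int:
  "cylinder J E \<inter> cylinder J' E' =
   cylinder (J \<union> J') (\<lambda>i. (if i \<in> J then E i else UNIV) \<inter> (if i \<in> J' then E' i else UNIV))"
  by (auto simp: cylinder_def)

lemma Int_stable_cylinders: "Int_stable cylinders"
  unfolding Int_stable_def cylinders_def using cylinder_Int by blast

lemma sets_env: "sets (env p) = sigma_sets UNIV (cylinders :: ('d::finite site \<Rightarrow> bool) set set)"
proof (rule antisym)
  let ?M = "\<lambda>_::'d site. measure_pmf (bernoulli_pmf p)"
  have "sets (env p) = sigma_sets UNIV (prod_algebra UNIV ?M)"
    unfolding env_def sets_PiM by (simp add: space_PiM)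
  moreover have "prod_algebra UNIV ?M \<subseteq> cylinders"
  proof
    fix A assume "A \<in> prod_algebra UNIV ?M"
    then obtain J E where J: "finite J" and A: "A = prod_emb UNIV ?M J (Pi\<^sub>E J E)"
      by (rule prod_algebraE) auto
    have "A = cylinder J E" unfolding A by (auto simp: prod_emb_def cylinder_def PiE_iff)
    with J show "A \<in> cylinders" by (auto simp: cylinders_def)
  qed
  ultimately show "sets (env p) \<subseteq> sigma_sets UNIV (cylinders :: ('d site \<Rightarrow> bool) set set)" by (simp add: sigma_sets_mono')
  show "sigma_sets UNIV (cylinders :: ('d site \<Rightarrow> bool) set set) \<subseteq> sets (env p)"
    using sets.sigma_sets_subset[of cylinders "env p :: (_ \<Rightarrow> bool) measure"] sets_env_cylinder by (auto simp: cylinders_def)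
qed

lemma translate_vimage_cylinder:
  "translate y -` cylinder J E = cylinder ((\<lambda>i. i + y) ` J) (\<lambda>i. E (i - y))"
  by (auto simp: cylinder_def translate_def)

lemma measure_cylinder_translate:
  assumes J: "finite J" "finite J'" and disj: "J \<inter> (\<lambda>i. i + y) ` J' = {}"
  shows "measure (env p) (cylinder J E \<inter> translate y -` cylinder J' E') =
    measure (env p) (cylinder J E) * measure (env p) (cylinder J' E')"
proof -
  let ?J = "(\<lambda>i. i + y) ` J'" and ?m = "measure_pmf.prob (bernoulli_pmf p)"
  let ?E = "\<lambda>i. (if i \<in> J then E i else UNIV) \<inter> (if i \<in> ?J then E' (i - y) else UNIV)"
  have "measure (env p) (cylinder J E \<inter> translate y -` cylinder J' E') = (\<Prod>i\<in>J \<union> ?J. ?m (?E i))"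
    unfolding translate_vimage_cylinder cylinder_Int by (rule measure_cylinder) (use J in auto)
  also have "\<dots> = (\<Prod>i\<in>J. ?m (?E i)) * (\<Prod>i\<in>?J. ?m (?E i))"
    by (rule prod.union_disjoint) (use J disj in auto)
  also have "(\<Prod>i\<in>J. ?m (?E i)) = (\<Prod>i\<in>J. ?m (E i))" using disj by (intro prod.cong) auto
  also have "(\<Prod>i\<in>?J. ?m (?E i)) = (\<Prod>i\<in>?J. ?m (E' (i - y)))" using disj by (intro prod.cong) auto
  also have "\<dots> = (\<Prod>i\<in>J'. ?m (E' i))" by (subst prod.reindex) (auto intro: inj_onI)
  finally show ?thesis using J by (simp add: measure_cylinder)
qed

text \<open>The generator principle is used twice, once for each function: first to pass from
  cylinders to \<open>F\<close> with a translated cylinder indicator as test sequence, then to pass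
  from cylinders to \<open>G\<close>. For two cylinders the product formula holds exactly as soon as
  the translated sites avoid the fixed ones.\<close>

lemma env_mixing:
  fixes F G :: "('d::finite site \<Rightarrow> bool) \<Rightarrow> real"
  assumes [measurable]: "F \<in> borel_measurable (env p)" "G \<in> borel_measurable (env p)"
    and F: "\<And>\<omega>. \<bar>F \<omega>\<bar> \<le> B" and G: "\<And>\<omega>. \<bar>G \<omega>\<bar> \<le> C"
    and y: "filterlim y cofinite sequentially"
  shows "(\<lambda>n. \<integral>\<omega>. F \<omega> * G (translate (y n) \<omega>) \<partial>env p) \<longlonglongrightarrow> (\<integral>\<omega>. F \<omega> \<partial>env p) * (\<integral>\<omega>. G \<omega> \<partial>env p)"
proof -
  interpret prob_space "env p :: ('d site \<Rightarrow> bool) measure" by (rule prob_space_env)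
  note gen = sets_env[of p, where ?'d='d] Int_stable_cylinders
  have F_int: "integrable (env p) F" by (rule integrable_const_bound[where B=B]) (use F in auto)
  have G_int: "integrable (env p) G" by (rule integrable_const_bound[where B=C]) (use G in auto)
  have step1: "(\<lambda>n. \<integral>\<omega>. F \<omega> * indicator A (translate (y n) \<omega>) \<partial>env p) \<longlonglongrightarrow> measure (env p) A * (\<integral>\<omega>. F \<omega> \<partial>env p)"
    if Ac: "A \<in> cylinders" for A
  proof -
    obtain J' E' where J': "finite J'" and A: "A = cylinder J' E'" using Ac by (auto simp: cylinders_def)
    have [measurable]: "A \<in> sets (env p)" unfolding A by (rule sets_env_cylinder[OF J'])
    show ?thesis
    proof (rule integral_mult_tendsto_of_generator[OF prob_space_axioms _ gen(2), where B=1])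
      show "sets (env p) = sigma_sets (space (env p)) (cylinders :: ('d site \<Rightarrow> bool) set set)" using gen(1) by simp
      show "(\<lambda>n. \<integral>\<omega>. indicator A (translate (y n) \<omega>) \<partial>env p) \<longlonglongrightarrow> measure (env p) A"
        using integral_translate[of "indicator A" p] by simp
      fix D :: "('d site \<Rightarrow> bool) set" assume "D \<in> cylinders"
      then obtain J E where J: "finite J" and D: "D = cylinder J E" by (auto simp: cylinders_def)
      have [measurable]: "D \<in> sets (env p)" unfolding D by (rule sets_env_cylinder[OF J])
      \<comment> \<open>The finitely many translations that make the two sets of sites meet;
        \<open>y n\<close> eventually avoids them.\<close>
      let ?bad = "(\<lambda>(i, j). i - j) ` (J \<times> J')"
      have "eventually (\<lambda>z. z \<notin> ?bad) cofinite"
        unfolding eventually_cofinite using J J' by (simp add: finite_imageI)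
      then have "eventually (\<lambda>n. y n \<notin> ?bad) sequentially" by (rule eventually_compose_filterlim[OF _ y])
      then have "eventually (\<lambda>n. (\<integral>\<omega>. indicator D \<omega> * indicator A (translate (y n) \<omega>) \<partial>env p) = measure (env p) A * measure (env p) D) sequentially"
      proof eventually_elim
        case (elim n)
        have disj: "J \<inter> (\<lambda>i. i + y n) ` J' = {}"
        proof (rule ccontr)
          assume "J \<inter> (\<lambda>i. i + y n) ` J' \<noteq> {}"
          then obtain i j where ij: "i \<in> J" "j \<in> J'" "i = j + y n" by auto
          then have "y n = i - j" by simp
          then have "y n \<in> ?bad" using ij(1,2) by (intro image_eqI[of _ _ "(i, j)"]) simp_all
          with elim show False by contradiction
        qed
        have "(\<integral>\<omega>. indicat_real D \<omega> * indicator A (translate (y n) \<omega>) \<partial>env p) = (\<integral>\<omega>. indicator (D \<inter> translate (y n) -` A) \<omega> \<partial>env p)"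
          by (rule Bochner_Integration.integral_cong) (auto simp: indicator_def)
        also have "\<dots> = measure (env p) (D \<inter> translate (y n) -` A)" by simp
        finally show ?case unfolding A D using measure_cylinder_translate[OF J J' disj, of p E E'] by (simp add: mult.commute)
      qed
      then show "(\<lambda>n. \<integral>\<omega>. indicator D \<omega> * indicator A (translate (y n) \<omega>) \<partial>env p) \<longlonglongrightarrow> measure (env p) A * measure (env p) D"
        by (rule tendsto_eventually)
    qed (use F_int in \<open>auto simp: indicator_def\<close>)
  qed
  \<comment> \<open>Translating everything back by \<open>- y n\<close> exchanges the two roles, so
    that the convergence already obtained for \<open>F\<close> serves as the test on
    cylinders.\<close>
  have "(\<lambda>n. \<integral>\<omega>. G \<omega> * F (translate (- y n) \<omega>) \<partial>env p) \<longlonglongrightarrow> (\<integral>\<omega>. F \<omega> \<partial>env p) * (\<integral>\<omega>. G \<omega> \<partial>env p)"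
  proof (rule integral_mult_tendsto_of_generator[OF prob_space_axioms _ gen(2), where B=B])
    show "sets (env p) = sigma_sets (space (env p)) (cylinders :: ('d site \<Rightarrow> bool) set set)" using gen(1) by simp
    show "(\<lambda>n. \<integral>\<omega>. F (translate (- y n) \<omega>) \<partial>env p) \<longlonglongrightarrow> (\<integral>\<omega>. F \<omega> \<partial>env p)"
      using integral_translate[of F p] by simp
    fix A :: "('d site \<Rightarrow> bool) set" assume A: "A \<in> cylinders"
    then have [measurable]: "A \<in> sets (env p)" using sets_env_cylinder by (auto simp: cylinders_def)
    have "(\<integral>\<omega>. indicator A \<omega> * F (translate (- y n) \<omega>) \<partial>env p) = (\<integral>\<omega>. F \<omega> * indicator A (translate (y n) \<omega>) \<partial>env p)" for n
      using integral_translate[of "\<lambda>\<omega>. indicator A \<omega> * F (translate (- y n) \<omega>)" p "y n"]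
      by (simp add: translate_translate mult.commute)
    then show "(\<lambda>n. \<integral>\<omega>. indicator A \<omega> * F (translate (- y n) \<omega>) \<partial>env p) \<longlonglongrightarrow> (\<integral>\<omega>. F \<omega> \<partial>env p) * measure (env p) A"
      using step1[OF A] by (simp add: mult.commute)
  qed (use G_int F in auto)
  moreover have "(\<integral>\<omega>. G \<omega> * F (translate (- y n) \<omega>) \<partial>env p) = (\<integral>\<omega>. F \<omega> * G (translate (y n) \<omega>) \<partial>env p)" for n
    using integral_translate[of "\<lambda>\<omega>. G \<omega> * F (translate (- y n) \<omega>)" p "y n"]
    by (simp add: translate_translate mult.commute)
  ultimately show ?thesis by simp
qed

section \<open>Clusters\<close>

lemma adj_translate: "adj (x + a) (y + a) \<longleftrightarrow> adj x y"
  by (simp add: adj_def)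

lemma rtranclp_translate:
  assumes "(\<lambda>u v. adj u v \<and> \<omega> (u + a) \<and> \<omega> (v + a))\<^sup>*\<^sup>* x y"
  shows "(\<lambda>u v. adj u v \<and> \<omega> u \<and> \<omega> v)\<^sup>*\<^sup>* (x + a) (y + a)"
  using assms
proof induction
  case (step y z)
  show ?case by (rule rtranclp.rtrancl_into_rtrancl[OF step(3)]) (use step(2) in \<open>simp add: adj_translate\<close>)
qed simp

lemma cluster_translate: "cluster (translate a \<omega>) x = (\<lambda>z. z - a) ` cluster \<omega> (x + a)"
proof -
  have "y \<in> cluster (translate a \<omega>) x \<longleftrightarrow> y + a \<in> cluster \<omega> (x + a)" for y
    using rtranclp_translate[of \<omega> a x y] rtranclp_translate[of "\<lambda>z. \<omega> (z + a)" "-a" "x + a" "y + a"]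
    by (auto simp: cluster_def translate_def)
  then show ?thesis by (force simp: image_iff)
qed

lemma cluster_size_translate: "cluster_size (translate a \<omega>) x = cluster_size \<omega> (x + a)"
proof -
  have inj: "inj_on (\<lambda>z. z - a) S" for S :: "'a site set" by (auto intro: inj_onI)
  show ?thesis by (simp add: cluster_size_def cluster_translate card_image[OF inj] finite_image_iff[OF inj])
qed

text \<open>Connection by exactly \<open>n\<close> open steps is handled by induction on
  \<open>n\<close>, with a countable choice of the last but one vertex; connection is the union over
  \<open>n\<close>.\<close>

lemma cluster_measurable [measurable]: "Measurable.pred (env p) (\<lambda>\<omega>. y \<in> cluster \<omega> x)"
proof -
  let ?R = "\<lambda>\<omega> u v. adj u v \<and> \<omega> u \<and> \<omega> v"
  have "Measurable.pred (env p) (\<lambda>\<omega>. (?R \<omega> ^^ n) x y)" for n y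
  proof (induction n arbitrary: y)
    case (Suc n)
    note [measurable] = Suc
    have "(?R \<omega> ^^ Suc n) x y \<longleftrightarrow> (\<exists>z. (?R \<omega> ^^ n) x z \<and> ?R \<omega> z y)" for \<omega>
      by (auto elim!: relpowp_Suc_E intro: relpowp_Suc_I)
    then show ?case by simp
  qed simp
  then show ?thesis by (simp add: cluster_def rtranclp_power)
qed

text \<open>\<open>enat\<close> is countable, so single values suffice. Size \<open>n\<close> is a
  countable union over the finite sets \<open>S\<close> of the events that the cluster equals
  \<open>S\<close>; the value \<open>\<infinity>\<close> is what remains.\<close>

lemma cluster_size_measurable [measurable]:
  "(\<lambda>\<omega>. cluster_size \<omega> x) \<in> env p \<rightarrow>\<^sub>M count_space (UNIV :: enat set)"
proof (rule measurable_compose_countable')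
  show "(\<lambda>\<omega>. cluster_size \<omega> x) \<in> env p \<rightarrow>\<^sub>M count_space UNIV"
  proof (subst measurable_count_space_eq_countable)
    show "countable (UNIV :: enat set)" by simp
    have fin: "{\<omega>. cluster_size \<omega> x = enat n} = (\<Union>S\<in>{S. finite S \<and> card S = n}. {\<omega> \<in> space (env p). \<forall>y. y \<in> cluster \<omega> x \<longleftrightarrow> y \<in> S})" for n
      unfolding set_eq_iff[symmetric] by (auto simp: cluster_size_def split: if_splits)
    have cnt: "countable {S :: 'a site set. finite S \<and> card S = n}" for n
      by (rule countable_subset[OF _ countable_Collect_finite]) auto
    have meas: "{\<omega>. cluster_size \<omega> x = enat n} \<in> sets (env p)" for n
      unfolding fin by (intro sets.countable_UN' cnt image_subsetI) measurable
    have "(\<lambda>\<omega>. cluster_size \<omega> x) -` {a} \<in> sets (env p)" for a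
    proof (cases a)
      case (enat n)
      then show ?thesis using meas[of n] by (simp add: vimage_def)
    next
      case infinity
      have "(\<lambda>\<omega>. cluster_size \<omega> x) -` {a} = space (env p) - (\<Union>n. {\<omega>. cluster_size \<omega> x = enat n})"
        by (auto simp: infinity)
      also have "\<dots> \<in> sets (env p)"
        by (intro sets.Diff sets.top sets.countable_UN image_subsetI meas)
      finally show ?thesis .
    qed
    then show "(\<lambda>\<omega>. cluster_size \<omega> x) \<in> space (env p) \<rightarrow> UNIV \<and>
       (\<forall>a\<in>UNIV. (\<lambda>\<omega>. cluster_size \<omega> x) -` {a} \<inter> space (env p) \<in> sets (env p))" by simp
  qed
qed auto

section \<open>Jump directions and exponential clocks\<close>

definition exp1 :: "real measure" where
  "exp1 = density lborel (exponential_density 1)"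

lemma sets_exp1 [measurable_cong, simp]: "sets exp1 = sets borel"
  by (simp add: exp1_def)

lemma space_exp1 [simp]: "space exp1 = UNIV"
  by (simp add: exp1_def)

lemma prob_space_exp1: "prob_space exp1"
  unfolding exp1_def by (rule prob_space_exponential_density) simp

lemma AE_exp1_pos: "AE u in exp1. 0 < u"
proof -
  have "AE u in lborel. u \<noteq> (0::real)" by (rule AE_lborel_singleton)
  then show ?thesis unfolding exp1_def
    by (subst AE_density) (auto simp: exponential_density_def less_le elim!: eventually_mono)
qed

text \<open>Regards the identity as an exponential random variable on \<open>exp1\<close>, which
  opens access to the known moments and distribution function.\<close>

lemma distributed_exp1: "distributed exp1 lborel (\<lambda>u. u) (exponential_density 1)"
  unfolding distributed_def exp1_def by (auto simp: distr_id2)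

lemma has_integral_exp1: "has_bochner_integral exp1 (\<lambda>u. u) 1"
proof -
  interpret prob_space exp1 by (rule prob_space_exp1)
  show ?thesis using has_bochner_integral_erlang_ith_moment[OF _ distributed_exp1, of 1] by simp
qed

lemma prob_space_step_clock: "prob_space (measure_pmf q \<Otimes>\<^sub>M exp1)"
  by (intro prob_space_pair prob_space_measure_pmf prob_space_exp1)

text \<open>All randomness of the walk beyond the environment: entry \<open>k\<close> holds the step
  and the standard clock of the \<open>k\<close>-th jump, and the path is a deterministic function
  of stream and waiting times.\<close>

definition source :: "'a pmf \<Rightarrow> ('a \<times> real) stream measure" where
  "source q = stream_space (measure_pmf q \<Otimes>\<^sub>M exp1)"

lemma prob_space_source: "prob_space (source q)"
  unfolding source_def by (rule prob_space.prob_space_stream_space[OF prob_space_step_clock])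

lemma space_source [simp]: "space (source q) = UNIV"
  by (simp add: source_def space_stream_space space_pair_measure)

lemma measurable_source [measurable]:
  "shd \<in> source q \<rightarrow>\<^sub>M measure_pmf q \<Otimes>\<^sub>M exp1"
  "stl \<in> source q \<rightarrow>\<^sub>M source q"
  "(\<lambda>s. s !! n) \<in> source q \<rightarrow>\<^sub>M measure_pmf q \<Otimes>\<^sub>M exp1"
  "sdrop n \<in> source q \<rightarrow>\<^sub>M source q"
  unfolding source_def by measurable

lemma measurable_Stream_source [measurable]:
  "(\<lambda>(x, s). x ## s) \<in> (measure_pmf q \<Otimes>\<^sub>M exp1) \<Otimes>\<^sub>M source q \<rightarrow>\<^sub>M source q"
  unfolding source_def by measurable

lemma nn_integral_source:
  assumes "f \<in> borel_measurable (source q)"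
  shows "(\<integral>\<^sup>+s. f s \<partial>source q) = (\<integral>\<^sup>+x. (\<integral>\<^sup>+s. f (x ## s) \<partial>source q) \<partial>(measure_pmf q \<Otimes>\<^sub>M exp1))"
  using assms unfolding source_def by (rule prob_space.nn_integral_stream_space[OF prob_space_step_clock])

text \<open>Independence of the first entry from the others, as a change of variables.\<close>

lemma distr_Stream_source:
  "distr ((measure_pmf q \<Otimes>\<^sub>M exp1) \<Otimes>\<^sub>M source q) (source q) (\<lambda>(x, s). x ## s) = source q"
proof (rule measure_eqI)
  interpret prob_space "source q" by (rule prob_space_source)
  fix A assume "A \<in> sets (distr ((measure_pmf q \<Otimes>\<^sub>M exp1) \<Otimes>\<^sub>M source q) (source q) (\<lambda>(x, s). x ## s))"
  then have A [measurable]: "A \<in> sets (source q)" by simp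
  let ?D = "distr ((measure_pmf q \<Otimes>\<^sub>M exp1) \<Otimes>\<^sub>M source q) (source q) (\<lambda>(x, s). x ## s)"
  have "emeasure ?D A = (\<integral>\<^sup>+s. indicator A s \<partial>?D)" by simp
  also have "\<dots> = (\<integral>\<^sup>+z. indicator A (fst z ## snd z) \<partial>((measure_pmf q \<Otimes>\<^sub>M exp1) \<Otimes>\<^sub>M source q))"
    by (subst nn_integral_distr) (auto simp: split_beta')
  also have "\<dots> = (\<integral>\<^sup>+x. (\<integral>\<^sup>+s. indicator A (x ## s) \<partial>source q) \<partial>(measure_pmf q \<Otimes>\<^sub>M exp1))"
    by (subst nn_integral_fst[symmetric]) auto
  also have "\<dots> = emeasure (source q) A" by (subst nn_integral_source[symmetric]) auto
  finally show "emeasure ?D A = emeasure (source q) A" .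
qed simp

lemma distr_shd_source: "distr (source q) (measure_pmf q \<Otimes>\<^sub>M exp1) shd = measure_pmf q \<Otimes>\<^sub>M exp1"
proof (rule measure_eqI)
  interpret prob_space "source q" by (rule prob_space_source)
  fix A assume "A \<in> sets (distr (source q) (measure_pmf q \<Otimes>\<^sub>M exp1) shd)"
  then have A [measurable]: "A \<in> sets (measure_pmf q \<Otimes>\<^sub>M exp1)" by simp
  have "emeasure (distr (source q) (measure_pmf q \<Otimes>\<^sub>M exp1) shd) A =
      (\<integral>\<^sup>+x. indicator A x \<partial>distr (source q) (measure_pmf q \<Otimes>\<^sub>M exp1) shd)" by simp
  also have "\<dots> = (\<integral>\<^sup>+s. indicator A (shd s) \<partial>source q)"
    by (subst nn_integral_distr) auto
  also have "\<dots> = emeasure (measure_pmf q \<Otimes>\<^sub>M exp1) A"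
    by (subst nn_integral_source) (auto simp: emeasure_space_1[simplified])
  finally show "emeasure (distr (source q) (measure_pmf q \<Otimes>\<^sub>M exp1) shd) A = emeasure (measure_pmf q \<Otimes>\<^sub>M exp1) A" .
qed simp

lemma distr_stl_source: "distr (source q) (source q) stl = source q"
proof (rule measure_eqI)
  interpret X: prob_space "measure_pmf q \<Otimes>\<^sub>M exp1" by (rule prob_space_step_clock)
  fix A assume "A \<in> sets (distr (source q) (source q) stl)"
  then have A [measurable]: "A \<in> sets (source q)" by simp
  have "emeasure (distr (source q) (source q) stl) A = (\<integral>\<^sup>+s. indicator A s \<partial>distr (source q) (source q) stl)"
    by simp
  also have "\<dots> = (\<integral>\<^sup>+s. indicator A (stl s) \<partial>source q)"
    by (subst nn_integral_distr) auto
  also have "\<dots> = emeasure (source q) A"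
    by (subst nn_integral_source) (auto simp: X.emeasure_space_1)
  finally show "emeasure (distr (source q) (source q) stl) A = emeasure (source q) A" .
qed simp

interpretation source: measure_preserving "source q" stl for q
  unfolding measure_preserving_def measure_preserving_axioms_def
  using prob_space_source distr_stl_source by auto

lemma funpow_stl: "(stl ^^ n) s = sdrop n s"
  by (induction n arbitrary: s) (simp_all add: funpow_swap1)

lemma integral_shd_source:
  fixes h :: "'a \<times> real \<Rightarrow> real"
  assumes [measurable]: "h \<in> borel_measurable (measure_pmf q \<Otimes>\<^sub>M exp1)"
  shows "(\<integral>s. h (shd s) \<partial>source q) = (\<integral>x. h x \<partial>(measure_pmf q \<Otimes>\<^sub>M exp1))"
  using integral_distr[of shd "source q" "measure_pmf q \<Otimes>\<^sub>M exp1" h] by (simp add: distr_shd_source)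

lemma integral_snth_source:
  fixes h :: "'a \<times> real \<Rightarrow> real"
  assumes [measurable]: "h \<in> borel_measurable (measure_pmf q \<Otimes>\<^sub>M exp1)"
  shows "(\<integral>s. h (s !! n) \<partial>source q) = (\<integral>x. h x \<partial>(measure_pmf q \<Otimes>\<^sub>M exp1))"
  using source.integral_funpow_T[of "\<lambda>s. h (shd s)" q n] integral_shd_source[of h q]
  by (simp add: funpow_stl)

lemma integral_source_product:
  fixes h :: "'a \<times> real \<Rightarrow> real"
  assumes h [measurable]: "h \<in> borel_measurable (measure_pmf q \<Otimes>\<^sub>M exp1)" and B: "\<And>x. \<bar>h x\<bar> \<le> B"
  shows "(\<integral>s. h (shd s) * h (s !! Suc n) \<partial>source q) = (\<integral>x. h x \<partial>(measure_pmf q \<Otimes>\<^sub>M exp1))\<^sup>2"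
proof -
  let ?X = "measure_pmf q \<Otimes>\<^sub>M exp1"
  interpret X: prob_space ?X by (rule prob_space_step_clock)
  interpret P: pair_prob_space ?X "source q" ..
  have int: "integrable (?X \<Otimes>\<^sub>M source q) (\<lambda>z. h (fst z) * h (snd z !! n))"
    by (rule P.integrable_const_bound[where B="B * B"])
       (auto simp: abs_mult intro!: mult_mono AE_I2 B order_trans[OF abs_ge_zero B])
  have "(\<integral>s. h (shd s) * h (s !! Suc n) \<partial>source q) =
      (\<integral>s. h (shd s) * h (s !! Suc n) \<partial>distr (?X \<Otimes>\<^sub>M source q) (source q) (\<lambda>(x, s). x ## s))"
    by (simp only: distr_Stream_source)
  also have "\<dots> = (\<integral>z. h (fst z) * h (snd z !! n) \<partial>(?X \<Otimes>\<^sub>M source q))"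
    by (subst integral_distr) (auto simp: split_beta')
  also have "\<dots> = (\<integral>x. (\<integral>s. h x * h (s !! n) \<partial>source q) \<partial>?X)"
    using P.integral_fst'[OF int] by simp
  also have "\<dots> = (\<integral>x. h x \<partial>?X)\<^sup>2"
    by (simp add: integral_snth_source power2_eq_square)
  finally show ?thesis .
qed

text \<open>The strong law as a case of the ergodic theorem for \<open>stl\<close>: correlations
  factor exactly at every lag except 0. Bounded functions are enough because clocks will be
  truncated.\<close>

lemma source_LLN:
  fixes h :: "'a \<times> real \<Rightarrow> real"
  assumes h [measurable]: "h \<in> borel_measurable (measure_pmf q \<Otimes>\<^sub>M exp1)" and B: "\<And>x. \<bar>h x\<bar> \<le> B"
  shows "AE s in source q. (\<lambda>n. (\<Sum>k<n. h (s !! k)) / real n) \<longlonglongrightarrow> (\<integral>x. h x \<partial>(measure_pmf q \<Otimes>\<^sub>M exp1))"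
proof -
  let ?f = "\<lambda>s. h (shd s)"
  have int: "integrable (source q) ?f" by (rule source.integrable_const_bound[where B=B]) (use B in auto)
  have "source.mean_ergodic q ?f"
  proof (rule source.mean_ergodic_bounded[where B=B])
    have "eventually (\<lambda>n. (\<integral>s. ?f s * ?f ((stl ^^ n) s) \<partial>source q) = (\<integral>s. ?f s \<partial>source q)\<^sup>2) sequentially"
      using eventually_gt_at_top[of 0]
    proof eventually_elim
      case (elim n)
      then obtain m where m: "n = Suc m" by (cases n) auto
      have "(\<integral>s. ?f s * ?f ((stl ^^ n) s) \<partial>source q) = (\<integral>s. h (shd s) * h (s !! Suc m) \<partial>source q)"
        by (simp only: m funpow_stl sdrop_simps(1))
      then show ?case using integral_source_product[OF h B, of m] integral_shd_source[OF h] by simp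
    qed
    then show "(\<lambda>n. \<integral>s. ?f s * ?f ((stl ^^ n) s) \<partial>source q) \<longlonglongrightarrow> (\<integral>s. ?f s \<partial>source q)\<^sup>2"
      by (rule tendsto_eventually)
    show "\<bar>h (shd s)\<bar> \<le> B" for s by (rule B)
  qed measurable
  from source.birkhoff_AE[OF int this] show ?thesis
    by (simp add: source.birkhoff_sum_def funpow_stl integral_shd_source)
qed

section \<open>The environment seen from the walk\<close>

lemma (in prob_space) abs_expectation_le:
  fixes f :: "'a \<Rightarrow> real"
  assumes [measurable]: "f \<in> borel_measurable M" and B: "\<And>x. \<bar>f x\<bar> \<le> B"
  shows "\<bar>\<integral>x. f x \<partial>M\<bar> \<le> B"
proof -
  have f: "integrable M f" by (rule integrable_const_bound[where B=B]) (use B in auto)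
  have "f x \<le> B" "- B \<le> f x" for x using B[of x] by auto
  then show ?thesis using integral_le_const[OF f] integral_ge_const[OF f] by (intro abs_leI) (auto simp: minus_le_iff)
qed

section \<open>Partial sums of the steps and the recentred environment\<close>

definition displacement :: "('d::finite site \<times> real) stream \<Rightarrow> nat \<Rightarrow> 'd site" where
  "displacement s n = (\<Sum>k<n. fst (s !! k))"

lemma displacement_0 [simp]: "displacement s 0 = 0"
  by (simp add: displacement_def)

lemma displacement_Suc: "displacement s (Suc n) = fst (shd s) + displacement (stl s) n"
  by (simp add: displacement_def sum.lessThan_Suc_shift del: sum.lessThan_Suc)

lemma measurable_fst_site [measurable]:
  "fst \<in> measure_pmf q \<Otimes>\<^sub>M exp1 \<rightarrow>\<^sub>M count_space UNIV"
  using measurable_fst[of "measure_pmf q" exp1] by (simp cong: measurable_cong_sets)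

lemma measurable_displacement [measurable]:
  fixes q :: "'d::finite site pmf"
  shows "(\<lambda>s. displacement s n) \<in> source q \<rightarrow>\<^sub>M count_space UNIV"
proof (induction n)
  case (Suc n)
  have eq: "displacement s (Suc n) = displacement s n + fst (s !! n)" for s :: "('d site \<times> real) stream"
    by (simp add: displacement_def)
  have [measurable]: "(\<lambda>s. fst (s !! n)) \<in> source q \<rightarrow>\<^sub>M count_space UNIV" by measurable
  note [measurable] = Suc
  have "(\<lambda>s. (displacement s n, fst (s !! n))) \<in> source q \<rightarrow>\<^sub>M count_space UNIV \<Otimes>\<^sub>M count_space UNIV"
    by measurable
  then have "(\<lambda>s. (displacement s n, fst (s !! n))) \<in> source q \<rightarrow>\<^sub>M count_space UNIV"
    by (simp add: pair_measure_countable)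
  from measurable_compose[OF this, of "\<lambda>(x, y). x + y" "count_space UNIV"] show ?case
    by (simp add: eq)
qed simp

definition walk_shift ::
    "('d::finite site \<Rightarrow> bool) \<times> ('d site \<times> real) stream \<Rightarrow> ('d site \<Rightarrow> bool) \<times> ('d site \<times> real) stream" where
  "walk_shift = (\<lambda>(\<omega>, s). (translate (fst (shd s)) \<omega>, stl s))"

lemma funpow_walk_shift: "(walk_shift ^^ n) (\<omega>, s) = (translate (displacement s n) \<omega>, sdrop n s)"
proof (induction n arbitrary: \<omega> s)
  case (Suc n)
  have "(walk_shift ^^ Suc n) (\<omega>, s) = (walk_shift ^^ n) (translate (fst (shd s)) \<omega>, stl s)"
    by (simp add: funpow_swap1) (simp add: walk_shift_def)
  then show ?case by (simp add: Suc translate_translate displacement_Suc[of s n] add.commute)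
qed simp

lemma measurable_translate_pair:
  assumes [measurable]: "f \<in> M \<rightarrow>\<^sub>M count_space (UNIV :: 'd::finite site set)" "g \<in> M \<rightarrow>\<^sub>M env p"
  shows "(\<lambda>x. translate (f x) (g x)) \<in> M \<rightarrow>\<^sub>M env p"
  by (rule measurable_compose_countable[of "\<lambda>y x. translate y (g x)" _ _ f]) measurable

lemma measurable_walk_shift [measurable]:
  "walk_shift \<in> env p \<Otimes>\<^sub>M source q \<rightarrow>\<^sub>M env p \<Otimes>\<^sub>M source q"
proof -
  note [measurable] = measurable_translate_pair
  have [measurable]: "(\<lambda>z. fst (shd (snd z))) \<in> env p \<Otimes>\<^sub>M source q \<rightarrow>\<^sub>M count_space UNIV" by measurable
  show ?thesis unfolding walk_shift_def split_beta' by measurable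
qed

lemma nn_integral_translate:
  assumes [measurable]: "f \<in> borel_measurable (env p)"
  shows "(\<integral>\<^sup>+\<omega>. f (translate y \<omega>) \<partial>env p) = (\<integral>\<^sup>+\<omega>. f \<omega> \<partial>env p)"
  using nn_integral_distr[of "translate y" "env p" "env p" f] by (simp add: distr_translate)

interpretation env_source: pair_prob_space "env p :: ('d::finite site \<Rightarrow> bool) measure" "source q :: ('d site \<times> real) stream measure" for p q
  unfolding pair_prob_space_def pair_sigma_finite_def
  using prob_space_env prob_space_source by (auto intro: prob_space_imp_sigma_finite)

text \<open>For a fixed stream the first step is a fixed translation, which preserves
  \<open>env p\<close>; integrating \<omega> out before the stream then leaves only the invariance
  of \<open>source q\<close> under \<open>stl\<close>.\<close>

lemma distr_walk_shift: "distr (env p \<Otimes>\<^sub>M source q) (env p \<Otimes>\<^sub>M source q) walk_shift = env p \<Otimes>\<^sub>M source q"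
proof (rule measure_eqI)
  fix A assume "A \<in> sets (distr (env p \<Otimes>\<^sub>M source q) (env p \<Otimes>\<^sub>M source q) walk_shift)"
  then have A [measurable]: "A \<in> sets (env p \<Otimes>\<^sub>M source q)" by simp
  interpret X: prob_space "measure_pmf q \<Otimes>\<^sub>M exp1" by (rule prob_space_step_clock)
  have "emeasure (distr (env p \<Otimes>\<^sub>M source q) (env p \<Otimes>\<^sub>M source q) walk_shift) A =
      (\<integral>\<^sup>+z. indicator A z \<partial>distr (env p \<Otimes>\<^sub>M source q) (env p \<Otimes>\<^sub>M source q) walk_shift)" by simp
  also have "\<dots> = (\<integral>\<^sup>+z. indicator A (walk_shift z) \<partial>(env p \<Otimes>\<^sub>M source q))"
    by (subst nn_integral_distr) auto
  also have "\<dots> = (\<integral>\<^sup>+s. \<integral>\<^sup>+\<omega>. indicator A (walk_shift (\<omega>, s)) \<partial>env p \<partial>source q)"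
    by (rule env_source.nn_integral_snd[symmetric]) measurable
  also have "\<dots> = (\<integral>\<^sup>+s. \<integral>\<^sup>+\<omega>. indicator A (\<omega>, stl s) \<partial>env p \<partial>source q)"
  proof (rule nn_integral_cong)
    fix s :: "('a site \<times> real) stream"
    show "(\<integral>\<^sup>+\<omega>. indicator A (walk_shift (\<omega>, s)) \<partial>env p) = (\<integral>\<^sup>+\<omega>. indicator A (\<omega>, stl s) \<partial>env p)"
      using nn_integral_translate[of "\<lambda>\<omega>. indicator A (\<omega>, stl s)" p "fst (shd s)"] by (simp add: walk_shift_def)
  qed
  also have "\<dots> = (\<integral>\<^sup>+s. \<integral>\<^sup>+\<omega>. indicator A (\<omega>, s) \<partial>env p \<partial>source q)"
    by (subst (2) distr_stl_source[symmetric], subst nn_integral_distr) auto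
  also have "\<dots> = (\<integral>\<^sup>+z. indicator A z \<partial>(env p \<Otimes>\<^sub>M source q))"
    by (rule env_source.nn_integral_snd) measurable
  finally show "emeasure (distr (env p \<Otimes>\<^sub>M source q) (env p \<Otimes>\<^sub>M source q) walk_shift) A = emeasure (env p \<Otimes>\<^sub>M source q) A"
    by simp
qed simp

interpretation walk: measure_preserving "env p \<Otimes>\<^sub>M source q" walk_shift for p q
  unfolding measure_preserving_def measure_preserving_axioms_def
  using distr_walk_shift by (auto intro: prob_space_pair prob_space_env prob_space_source)

text \<open>For a fixed stream, the correlation of the environment at lag \<open>n\<close> is a
  mixing correlation along the translation \<open>displacement s n\<close>, hence tends to the
  square of the mean when the displacement escapes. Dominated convergence integrates this over
  streams, and the two factors \<open>h\<close> are independent for positive lags.\<close>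

lemma walk_mean_ergodic_bounded:
  fixes F :: "('d::finite site \<Rightarrow> bool) \<Rightarrow> real" and h :: "'d site \<times> real \<Rightarrow> real"
  assumes F [measurable]: "F \<in> borel_measurable (env p)" and FB: "\<And>\<omega>. \<bar>F \<omega>\<bar> \<le> B"
    and h [measurable]: "h \<in> borel_measurable (measure_pmf q \<Otimes>\<^sub>M exp1)" and hC: "\<And>x. \<bar>h x\<bar> \<le> C"
    and esc: "AE s in source q. filterlim (displacement s) cofinite sequentially"
  shows "walk.mean_ergodic p q (\<lambda>(\<omega>, s). F \<omega> * h (shd s))"
    and "(\<integral>z. (case z of (\<omega>, s) \<Rightarrow> F \<omega> * h (shd s)) \<partial>(env p \<Otimes>\<^sub>M source q)) = (\<integral>\<omega>. F \<omega> \<partial>env p) * (\<integral>x. h x \<partial>(measure_pmf q \<Otimes>\<^sub>M exp1))"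
proof -
  let ?f = "\<lambda>(\<omega>, s). F \<omega> * h (shd s)" and ?M = "env p \<Otimes>\<^sub>M source q"
  define a where "a = (\<integral>\<omega>. F \<omega> \<partial>env p)"
  define c where "c = (\<integral>x. h x \<partial>(measure_pmf q \<Otimes>\<^sub>M exp1))"
  have B0: "0 \<le> B" and C0: "0 \<le> C" using FB[of "\<lambda>_. True"] hC[of undefined] by (auto intro: order_trans[OF abs_ge_zero])
  have f_meas [measurable]: "?f \<in> borel_measurable ?M" unfolding split_beta' by measurable
  have fB: "\<bar>?f z\<bar> \<le> B * C" for z
    using FB[of "fst z"] hC[of "shd (snd z)"] B0 by (auto simp: split_beta' abs_mult intro!: mult_mono)
  have f_int: "integrable ?M ?f" by (rule env_source.P.integrable_const_bound[where B="B * C"]) (use fB in auto)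
  have "(\<integral>z. ?f z \<partial>?M) = (\<integral>s. (\<integral>\<omega>. F \<omega> * h (shd s) \<partial>env p) \<partial>source q)"
    using env_source.integral_snd[of p q "\<lambda>\<omega> s. F \<omega> * h (shd s)"] f_int by simp
  also have "\<dots> = a * c"
    unfolding a_def c_def by (simp add: integral_shd_source)
  finally show f_eq: "(\<integral>z. ?f z \<partial>?M) = a * c" .
  show "walk.mean_ergodic p q ?f"
  proof (rule walk.mean_ergodic_bounded[where B="B * C", OF f_meas fB])
    let ?rho = "\<lambda>n s. \<integral>\<omega>. F \<omega> * F (translate (displacement s n) \<omega>) \<partial>env p"
    note [measurable] = measurable_translate_pair
    have FF_meas [measurable]: "(\<lambda>(\<omega>, s). F \<omega> * F (translate (displacement s n) \<omega>)) \<in> borel_measurable ?M" for n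
    proof -
      have [measurable]: "(\<lambda>z. displacement (snd z) n) \<in> ?M \<rightarrow>\<^sub>M count_space UNIV" by measurable
      show ?thesis unfolding split_beta' by measurable
    qed
    have rho_meas [measurable]: "?rho n \<in> borel_measurable (source q)" for n
    proof (rule env_source.M1.borel_measurable_lebesgue_integral)
      have [measurable]: "(\<lambda>z. displacement (fst z) n) \<in> source q \<Otimes>\<^sub>M env p \<rightarrow>\<^sub>M count_space UNIV" by measurable
      show "(\<lambda>(s, \<omega>). F \<omega> * F (translate (displacement s n) \<omega>)) \<in> borel_measurable (source q \<Otimes>\<^sub>M env p)"
        unfolding split_beta' by measurable
    qed
    have rhoB: "\<bar>?rho n s\<bar> \<le> B * B" for n s
      by (rule env_source.M1.abs_expectation_le) (use FB B0 in \<open>auto simp: abs_mult intro!: mult_mono\<close>)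
    have "\<bar>a\<bar> \<le> B" unfolding a_def by (rule env_source.M1.abs_expectation_le[OF F FB])
    then have aB: "\<bar>a * a\<bar> \<le> B * B" using B0 unfolding abs_mult by (intro mult_mono) auto
    have hhB: "\<bar>h (shd s) * h (s !! n)\<bar> \<le> C * C" for s n
      unfolding abs_mult by (intro mult_mono hC abs_ge_zero C0)
    have corr: "(\<integral>z. ?f z * ?f ((walk_shift ^^ n) z) \<partial>?M) = (\<integral>s. h (shd s) * h (s !! n) * ?rho n s \<partial>source q)" for n
    proof -
      let ?k = "\<lambda>\<omega> s. h (shd s) * h (s !! n) * (F \<omega> * F (translate (displacement s n) \<omega>))"
      have eq: "?f z * ?f ((walk_shift ^^ n) z) = case_prod ?k z" for z
        by (cases z) (simp add: funpow_walk_shift)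
      have int: "integrable ?M (case_prod ?k)"
      proof (rule env_source.P.integrable_const_bound[where B="(C * C) * (B * B)"])
        show "AE z in ?M. norm (case_prod ?k z) \<le> (C * C) * (B * B)"
        proof (rule AE_I2)
          fix z
          show "norm (case_prod ?k z) \<le> (C * C) * (B * B)"
            unfolding split_beta' real_norm_def abs_mult
            by (intro mult_mono FB hC abs_ge_zero C0 B0 mult_nonneg_nonneg)
        qed
        show "case_prod ?k \<in> borel_measurable ?M"
          using FF_meas[of n] unfolding split_beta' by measurable
      qed
      have "(\<integral>z. case_prod ?k z \<partial>?M) = (\<integral>s. (\<integral>\<omega>. ?k \<omega> s \<partial>env p) \<partial>source q)"
        by (rule env_source.integral_snd[OF int, symmetric])
      then show ?thesis by (simp add: eq)
    qed
    \<comment> \<open>The limit \<open>a * a\<close> is subtracted under the integral because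
      \<open>h (s !! n)\<close> itself has no pointwise limit; only the bracket tends to 0.\<close>
    have "(\<lambda>n. \<integral>s. h (shd s) * h (s !! n) * (?rho n s - a * a) \<partial>source q) \<longlonglongrightarrow> (\<integral>s. 0 \<partial>source q)"
    proof (rule integral_dominated_convergence[where w="\<lambda>_. (C * C) * (B * B + B * B)"])
      show "AE s in source q. (\<lambda>n. h (shd s) * h (s !! n) * (?rho n s - a * a)) \<longlonglongrightarrow> 0"
        using esc
      proof eventually_elim
        case (elim s)
        have "(\<lambda>n. ?rho n s) \<longlonglongrightarrow> a * a" unfolding a_def by (rule env_mixing[OF F F FB FB elim])
        then have "(\<lambda>n. ?rho n s - a * a) \<longlonglongrightarrow> 0" by (simp add: LIM_zero)
        then show ?case
          by (rule tendsto_0_le[where K="C * C"])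
             (use hhB[of s] in \<open>auto intro!: always_eventually mult_left_mono simp: abs_mult mult.commute[of _ "\<bar>?rho _ s - a * a\<bar>"]\<close>)
      qed
      show "AE s in source q. norm (h (shd s) * h (s !! n) * (?rho n s - a * a)) \<le> (C * C) * (B * B + B * B)" for n
        unfolding real_norm_def abs_mult
        by (intro AE_I2 mult_mono order_trans[OF abs_triangle_ineq4] add_mono rhoB aB hC abs_ge_zero C0 mult_nonneg_nonneg)
    qed auto
    moreover have "eventually (\<lambda>n. (\<integral>s. h (shd s) * h (s !! n) * (?rho n s - a * a) \<partial>source q) =
        (\<integral>z. ?f z * ?f ((walk_shift ^^ n) z) \<partial>?M) - (a * c)\<^sup>2) sequentially"
      using eventually_gt_at_top[of 0]
    proof eventually_elim
      case (elim n)
      then obtain m where m: "n = Suc m" by (cases n) auto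
      have i1: "integrable (source q) (\<lambda>s. h (shd s) * h (s !! n))"
        by (rule source.integrable_const_bound[where B="C * C"]) (use hhB in auto)
      have i2: "integrable (source q) (\<lambda>s. h (shd s) * h (s !! n) * ?rho n s)"
        by (rule source.integrable_const_bound[where B="(C * C) * (B * B)"])
           (auto simp: abs_mult intro!: mult_mono AE_I2 rhoB hC C0)
      have "(\<integral>s. h (shd s) * h (s !! n) * (?rho n s - a * a) \<partial>source q) =
          (\<integral>s. h (shd s) * h (s !! n) * ?rho n s - (a * a) * (h (shd s) * h (s !! n)) \<partial>source q)"
        by (simp add: algebra_simps)
      also have "\<dots> = (\<integral>s. h (shd s) * h (s !! n) * ?rho n s \<partial>source q) - (a * a) * c\<^sup>2"
        using i1 i2 integral_source_product[OF h hC, of m] unfolding m c_def by simp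
      finally show ?case by (simp add: corr power2_eq_square algebra_simps)
    qed
    ultimately have "(\<lambda>n. (\<integral>z. ?f z * ?f ((walk_shift ^^ n) z) \<partial>?M) - (a * c)\<^sup>2) \<longlonglongrightarrow> 0"
      by (simp add: tendsto_cong)
    then show "(\<lambda>n. \<integral>z. ?f z * ?f ((walk_shift ^^ n) z) \<partial>?M) \<longlonglongrightarrow> (\<integral>z. ?f z \<partial>?M)\<^sup>2"
      unfolding f_eq by (rule LIM_zero_cancel)
  qed
qed

section \<open>Counting jumps\<close>

text \<open>With \<open>A n\<close> the time of the \<open>n\<close>-th jump, the least index counts
  the jumps up to \<open>t\<close>. Minimality of a positive count \<open>N\<close> gives
  \<open>A N \<le> t\<close>, which the linear lower bound on \<open>A\<close> turns into a bound on
  \<open>N\<close>.\<close>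

lemma count_upper:
  fixes A :: "nat \<Rightarrow> ennreal"
  assumes b: "0 < b" and ev: "eventually (\<lambda>n. ennreal (b * real n) \<le> A n) sequentially"
  shows "eventually (\<lambda>t. real (LEAST n. ennreal t < A (Suc n)) \<le> t / b) at_top"
proof -
  obtain n0 where n0: "\<And>n. n \<ge> n0 \<Longrightarrow> ennreal (b * real n) \<le> A n"
    using ev by (auto simp: eventually_sequentially)
  show ?thesis
    \<comment> \<open>This threshold settles the counts below \<open>max n0 1\<close>, to which the
      linear bound does not apply.\<close>
    using eventually_ge_at_top[of "b * real (max n0 1)"]
  proof eventually_elim
    case (elim t)
    define N where "N = (LEAST n. ennreal t < A (Suc n))"
    have t0: "0 \<le> t" using elim b by (intro order_trans[OF _ elim]) simp
    show ?case unfolding N_def[symmetric]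
    proof (cases "N \<ge> max n0 1")
      case True
      then obtain m where m: "N = Suc m" by (cases N) auto
      then have "\<not> ennreal t < A (Suc m)"
        unfolding N_def by (intro not_less_Least) simp
      then have "A N \<le> ennreal t" by (simp add: m not_less)
      then have "ennreal (b * real N) \<le> ennreal t" using n0[of N] True by (auto intro: order_trans)
      then have "b * real N \<le> t" using t0 by (simp add: ennreal_le_iff)
      then show "real N \<le> t / b" using b by (simp add: field_simps)
    next
      case False
      then have "N \<le> max n0 1" by linarith
      then have "b * real N \<le> b * real (max n0 1)" using b by (intro mult_left_mono of_nat_mono) auto
      also note elim
      finally show "real N \<le> t / b" using b by (simp add: field_simps)
    qed
  qed
qed

text \<open>The count \<open>N\<close> is attained by divergence, so
  \<open>t < A (Suc N) \<le> b * (N + 1)\<close>; the index \<open>Suc N\<close> is the source of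
  the \<open>- 1\<close>.\<close>

lemma count_lower:
  fixes A :: "nat \<Rightarrow> ennreal"
  assumes b: "0 < b" and ev: "eventually (\<lambda>n. A n \<le> ennreal (b * real n)) sequentially"
    and mono: "incseq A" and div: "\<And>t::real. \<exists>n. ennreal t < A (Suc n)"
  shows "eventually (\<lambda>t. t / b - 1 \<le> real (LEAST n. ennreal t < A (Suc n))) at_top"
proof -
  obtain n0 where n0: "\<And>n. n \<ge> n0 \<Longrightarrow> A n \<le> ennreal (b * real n)"
    using ev by (auto simp: eventually_sequentially)
  show ?thesis
    using eventually_ge_at_top[of "b * real n0"]
  proof eventually_elim
    case (elim t)
    define N where "N = (LEAST n. ennreal t < A (Suc n))"
    have N: "ennreal t < A (Suc N)" unfolding N_def by (rule LeastI_ex[OF div])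
    have "Suc N \<ge> n0"
    proof (rule ccontr)
      assume "\<not> Suc N \<ge> n0"
      then have "A (Suc N) \<le> A n0" using incseqD[OF mono, of "Suc N" n0] by simp
      also have "\<dots> \<le> ennreal (b * real n0)" by (rule n0) simp
      also have "\<dots> \<le> ennreal t" using elim by (rule ennreal_leI)
      finally show False using N by simp
    qed
    then have "ennreal t < ennreal (b * real (Suc N))" using N n0[of "Suc N"] by (auto intro: less_le_trans)
    then have "t < b * real (Suc N)" by (metis ennreal_leI not_le)
    then show ?case unfolding N_def[symmetric] using b by (simp add: field_simps)
  qed
qed

lemma ennreal_divide_mult_cancel:
  fixes a b :: ennreal
  shows "b \<noteq> 0 \<Longrightarrow> b \<noteq> top \<Longrightarrow> a / b * b = a"
  by (metis ennreal_times_divide mult.commute mult_divide_eq_ennreal)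

text \<open>Inverts the asymptotics of the jump times by comparing with linear functions of slope
  slightly off \<open>J\<close>. An infinite \<open>J\<close> gives speed 0, and then the lower
  bound is only asked for negative \<open>a\<close>, where it is trivial.\<close>

lemma renewal:
  fixes A :: "nat \<Rightarrow> ennreal"
  assumes lim: "(\<lambda>n. A n / ennreal (real n)) \<longlonglongrightarrow> J" and J0: "0 < J" and mono: "incseq A"
  shows "((\<lambda>t. real (LEAST n. ennreal t < A (Suc n)) / t) \<longlongrightarrow> enn2real (inverse J)) at_top"
proof -
  define N where "N t = (LEAST n. ennreal t < A (Suc n))" for t :: real
  define v where "v = enn2real (inverse J)"
  have vJ: "inverse J = ennreal v" "0 \<le> v"
    unfolding v_def using J0 by (auto simp: ennreal_inverse_eq_top_iff less_top[symmetric] intro!: ennreal_enn2real[symmetric])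
  have Jinv: "J = inverse (ennreal v)"
  proof (cases J)
    case (real c)
    then have "0 < c" using J0 by simp
    then have "v = inverse c" using vJ real by (simp add: inverse_ennreal)
    then show ?thesis using real \<open>0 < c\<close> by (simp add: inverse_ennreal)
  next
    case top
    then show ?thesis using vJ by simp
  qed
  have low: "eventually (\<lambda>n. ennreal (b * real n) \<le> A n) sequentially" if "ennreal b < J" "0 < b" for b
    using order_tendstoD(1)[OF lim that(1)] eventually_gt_at_top[of 0]
  proof eventually_elim
    case (elim n)
    have "ennreal (b * real n) = ennreal b * ennreal (real n)" using that by (simp add: ennreal_mult)
    also have "\<dots> \<le> A n / ennreal (real n) * ennreal (real n)" using elim by (intro mult_right_mono) auto
    also have "\<dots> = A n" using elim by (intro ennreal_divide_mult_cancel) auto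
    finally show ?case .
  qed
  have up: "eventually (\<lambda>n. A n \<le> ennreal (b * real n)) sequentially" if "J < ennreal b" "0 < b" for b
    using order_tendstoD(2)[OF lim that(1)] eventually_gt_at_top[of 0]
  proof eventually_elim
    case (elim n)
    have "A n = A n / ennreal (real n) * ennreal (real n)" using elim by (intro ennreal_divide_mult_cancel[symmetric]) auto
    also have "\<dots> \<le> ennreal b * ennreal (real n)" using elim by (intro mult_right_mono) auto
    also have "\<dots> = ennreal (b * real n)" using that by (simp add: ennreal_mult)
    finally show ?case .
  qed
  have inv_less: "ennreal (inverse a) < J" if "v < a" for a
  proof (cases "v = 0")
    case True
    then show ?thesis using Jinv by simp
  next
    case False
    then have "J = ennreal (inverse v)" using Jinv vJ(2) by (simp add: inverse_ennreal)
    then show ?thesis using that vJ(2) False by (simp add: ennreal_less_iff)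
  qed
  have upper: "eventually (\<lambda>t. real (N t) / t < a) at_top" if a: "v < a" for a
  proof -
    obtain a' where a': "v < a'" "a' < a" using dense[OF a] by auto
    have "0 < a'" using a' vJ by simp
    then have "eventually (\<lambda>t. real (N t) \<le> t / inverse a') at_top"
      unfolding N_def by (intro count_upper low inv_less a') auto
    then show ?thesis using eventually_gt_at_top[of 0]
    proof eventually_elim
      case (elim t)
      then have "real (N t) / t \<le> a'" by (simp add: field_simps)
      with a' show ?case by simp
    qed
  qed
  have lower: "eventually (\<lambda>t. a < real (N t) / t) at_top" if a: "a < v" for a
  proof (cases "a < 0")
    case True
    show ?thesis using eventually_gt_at_top[of 0]
      by eventually_elim (use True in \<open>auto intro: less_le_trans\<close>)
  next
    case False
    obtain a' where a': "a < a'" "a' < v" using dense[OF a] by auto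
    have a'0: "0 < a'" using a' False by simp
    have J: "J = ennreal (inverse v)" using Jinv a' a'0 by (simp add: inverse_ennreal)
    have "J < ennreal (inverse a')" using a' a'0 by (simp add: J ennreal_less_iff)
    \<comment> \<open>The slope \<open>inverse (v + 1)\<close> is positive and below
      \<open>J\<close>, so the jump times grow at least linearly and exceed every
      \<open>t\<close>.\<close>
    moreover have "\<exists>n. ennreal t < A (Suc n)" for t
    proof -
      have "v < v + 1" by simp
      then have "eventually (\<lambda>n. ennreal (inverse (v + 1) * real n) \<le> A n) sequentially"
        using vJ by (intro low inv_less) auto
      then obtain n0 where n0: "\<And>n. n \<ge> n0 \<Longrightarrow> ennreal (inverse (v + 1) * real n) \<le> A n"
        by (auto simp: eventually_sequentially)
      obtain k :: nat where k: "t * (v + 1) < real k" using reals_Archimedean2 by blast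
      let ?n = "max n0 (Suc k)"
      have v1: "0 < v + 1" using vJ by simp
      have "t < inverse (v + 1) * real (Suc ?n)" using k v1 by (simp add: field_simps)
      then have "ennreal t < ennreal (inverse (v + 1) * real (Suc ?n))" using v1 by (intro ennreal_lessI) auto
      also have "\<dots> \<le> A (Suc ?n)" by (rule n0) simp
      finally show ?thesis by blast
    qed
    ultimately have "eventually (\<lambda>t. t / inverse a' - 1 \<le> real (N t)) at_top"
      unfolding N_def using a'0 by (intro count_lower up mono) auto
    \<comment> \<open>Beyond \<open>1 / (a' - a)\<close> the gap \<open>(a' - a) * t\<close> exceeds
      the \<open>1\<close> lost in the count.\<close>
    then show ?thesis using eventually_gt_at_top[of "1 / (a' - a)"] eventually_gt_at_top[of 0]
    proof eventually_elim
      case (elim t)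
      have "1 < t * (a' - a)" using elim a' by (simp add: field_simps)
      then have "a * t < real (N t)" using elim(1) a'0 by (simp add: field_simps)
      then show ?case using elim by (simp add: field_simps)
    qed
  qed
  show ?thesis unfolding N_def[symmetric] v_def[symmetric]
    by (rule order_tendstoI) (use upper lower in auto)
qed

text \<open>\<open>X n - n m\<close> is o(n) and \<open>N t\<close> is O(t), so the error after
  substitution is o(t). The limit of \<open>N t / t\<close> enters only multiplied by
  \<open>m\<close>; for \<open>m = 0\<close> the linear bound alone controls the time
  change.\<close>

lemma tendsto_time_change:
  fixes X :: "nat \<Rightarrow> 'a::real_normed_vector" and N :: "real \<Rightarrow> nat"
  assumes X: "(\<lambda>n. X n /\<^sub>R real n) \<longlonglongrightarrow> m"
    and bnd: "eventually (\<lambda>t. real (N t) \<le> C * t) at_top"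
    and lim: "((\<lambda>t. (real (N t) / t) *\<^sub>R m) \<longlongrightarrow> w) at_top"
  shows "((\<lambda>t. (1 / t) *\<^sub>R X (N t)) \<longlongrightarrow> w) at_top"
proof -
  define r where "r n = X n - real n *\<^sub>R m" for n
  \<comment> \<open>\<open>N t\<close> is not assumed to tend to infinity, so the error is bounded
    at every \<open>n\<close>, with a constant \<open>K\<close> for the small indices.\<close>
  have r_bnd: "\<exists>K\<ge>0. \<forall>n. norm (r n) \<le> e * real n + K" if e: "0 < e" for e
  proof -
    obtain n0 where n0: "\<And>n. n \<ge> n0 \<Longrightarrow> norm (X n /\<^sub>R real n - m) < e" using LIMSEQ_D[OF X e] by blast
    define K where "K = (\<Sum>n\<le>n0. norm (r n))"
    have "norm (r n) \<le> e * real n + K" for n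
    proof (cases "n \<le> n0")
      case True
      then have "norm (r n) \<le> K" unfolding K_def by (intro member_le_sum) auto
      then show ?thesis using e by (simp add: add_increasing)
    next
      case False
      then have n: "n \<ge> n0" "real n > 0" by auto
      have "r n = real n *\<^sub>R (X n /\<^sub>R real n - m)" using n by (simp add: r_def scaleR_diff_right)
      then have "norm (r n) = real n * norm (X n /\<^sub>R real n - m)" by simp
      also have "\<dots> \<le> real n * e" using n0[OF n(1)] by (intro mult_left_mono) auto
      also have "\<dots> \<le> e * real n + K" unfolding K_def by (simp add: sum_nonneg)
      finally show ?thesis .
    qed
    moreover have "K \<ge> 0" unfolding K_def by (simp add: sum_nonneg)
    ultimately show ?thesis by blast
  qed
  have "((\<lambda>t. (1 / t) *\<^sub>R r (N t)) \<longlongrightarrow> 0) at_top"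
  proof (rule tendstoI)
    fix e :: real assume e: "0 < e"
    define d where "d = e / (2 * (\<bar>C\<bar> + 1))"
    have d: "0 < d" using e unfolding d_def by (simp add: add_nonneg_pos)
    obtain K where K: "K \<ge> 0" "\<And>n. norm (r n) \<le> d * real n + K" using r_bnd[OF d] by auto
    show "eventually (\<lambda>t. dist ((1 / t) *\<^sub>R r (N t)) 0 < e) at_top"
      using bnd eventually_gt_at_top[of 0] eventually_gt_at_top[of "2 * K / e"]
    proof eventually_elim
      case (elim t)
      have "C * t \<le> \<bar>C\<bar> * t" using elim by (intro mult_right_mono) auto
      then have "real (N t) \<le> \<bar>C\<bar> * t" using elim by linarith
      then have "d * real (N t) \<le> d * (\<bar>C\<bar> * t)"
        using d by (intro mult_left_mono) auto
      also have "\<dots> \<le> d * (\<bar>C\<bar> + 1) * t" using elim d by (simp add: algebra_simps)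
      also have "\<dots> = e / 2 * t" unfolding d_def by (simp add: field_simps)
      finally have "norm (r (N t)) \<le> e / 2 * t + K" using K(2)[of "N t"] by simp
      also have "K < e / 2 * t" using elim e by (simp add: field_simps)
      finally have "norm (r (N t)) < e * t" by simp
      then show ?case using elim by (simp add: field_simps)
    qed
  qed
  from tendsto_add[OF this lim] show ?thesis
    by (simp add: r_def scaleR_diff_right)
qed

section \<open>Law of large numbers for the walk\<close>

definition arrival :: "('d::finite site \<Rightarrow> ennreal) \<Rightarrow> ('d site \<times> real) stream \<Rightarrow> nat \<Rightarrow> ennreal" where
  "arrival W s n = (\<Sum>k<n. ennreal (snd (s !! k)) * W (displacement s k))"

text \<open>At a site of infinite waiting time the next arrival is at \<open>\<infinity>\<close>, so that the walk stays there.\<close>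

definition jumps :: "('d::finite site \<Rightarrow> ennreal) \<Rightarrow> ('d site \<times> real) stream \<Rightarrow> real \<Rightarrow> nat" where
  "jumps W s t = (LEAST n. ennreal t < arrival W s (Suc n))"

definition position :: "('d::finite site \<Rightarrow> ennreal) \<Rightarrow> ('d site \<times> real) stream \<Rightarrow> real \<Rightarrow> 'd site" where
  "position W s t = displacement s (jumps W s t)"

lemma incseq_arrival: "incseq (arrival W s)"
  by (rule incseq_SucI) (simp add: arrival_def)

text \<open>The truncation at 0 agrees with the coercion to \<open>ennreal\<close> used in
  \<open>arrival\<close> for every stream, so real integrands can be used without discarding a null
  set of negative clocks.\<close>

definition clock :: "'a \<times> real \<Rightarrow> real" where
  "clock x = max 0 (snd x)"

lemma clock_measurable [measurable]: "clock \<in> borel_measurable (measure_pmf q \<Otimes>\<^sub>M exp1)"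
  unfolding clock_def[abs_def] by measurable

lemma clock_nonneg [simp]: "0 \<le> clock x"
  by (simp add: clock_def)

lemma ennreal_clock: "ennreal (snd x) = ennreal (clock x)"
  by (simp add: clock_def max_def ennreal_neg)

lemma nn_integral_clock: "(\<integral>\<^sup>+x. ennreal (clock x) \<partial>(measure_pmf q \<Otimes>\<^sub>M exp1)) = 1"
proof -
  interpret X: prob_space exp1 by (rule prob_space_exp1)
  interpret q: prob_space "measure_pmf q" by (rule prob_space_measure_pmf)
  have "(\<integral>\<^sup>+x. ennreal (clock x) \<partial>(measure_pmf q \<Otimes>\<^sub>M exp1)) = (\<integral>\<^sup>+a. (\<integral>\<^sup>+u. ennreal u \<partial>exp1) \<partial>measure_pmf q)"
    by (subst X.nn_integral_fst[symmetric]) (auto simp: ennreal_clock[symmetric])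
  also have "(\<integral>\<^sup>+u. ennreal u \<partial>exp1) = ennreal (\<integral>u. u \<partial>exp1)"
    using has_integral_exp1 AE_exp1_pos
    by (intro nn_integral_eq_integral) (auto simp: has_bochner_integral_iff elim!: eventually_mono)
  also have "\<dots> = 1" using has_integral_exp1 by (simp add: has_bochner_integral_iff)
  finally show ?thesis by simp
qed

lemma AE_clock_pos: "AE x in measure_pmf q \<Otimes>\<^sub>M exp1. 0 < snd x"
proof -
  interpret X: prob_space exp1 by (rule prob_space_exp1)
  interpret q: prob_space "measure_pmf q" by (rule prob_space_measure_pmf)
  interpret pair_sigma_finite "measure_pmf q" exp1 ..
  show ?thesis by (rule AE_pair_measure) (use AE_exp1_pos in auto)
qed

text \<open>The mean of a clock truncated at 1, a bounded function to which the strong law applies.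
  Its positivity is what lower bounds on arrival times rest on.\<close>

definition mean_clock :: "'a pmf \<Rightarrow> real" where
  "mean_clock q = (\<integral>x. min 1 (clock x) \<partial>(measure_pmf q \<Otimes>\<^sub>M exp1))"

lemma mean_clock_pos: "0 < mean_clock q"
proof -
  interpret X: prob_space "measure_pmf q \<Otimes>\<^sub>M exp1" by (rule prob_space_step_clock)
  have int: "integrable (measure_pmf q \<Otimes>\<^sub>M exp1) (\<lambda>x. min 1 (clock x))"
    by (rule X.integrable_const_bound[where B=1]) auto
  have "mean_clock q \<noteq> 0"
  proof
    assume "mean_clock q = 0"
    then have "AE x in measure_pmf q \<Otimes>\<^sub>M exp1. min 1 (clock x) = 0"
      unfolding mean_clock_def using int by (subst (asm) integral_nonneg_eq_0_iff_AE) auto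
    then have "AE x in measure_pmf q \<Otimes>\<^sub>M exp1. False"
      using AE_clock_pos by eventually_elim (auto simp: clock_def)
    then show False using X.AE_False by simp
  qed
  moreover have "0 \<le> mean_clock q" unfolding mean_clock_def by (rule Bochner_Integration.integral_nonneg) auto
  ultimately show ?thesis by simp
qed

text \<open>Both factors are truncated at \<open>k\<close>, which reduces to the bounded case; the
  truncated product is dominated by the full one and eventually equal to it at each point, hence
  close in L1. The clock has mean 1 and disappears from the integral.\<close>

lemma walk_mean_ergodic:
  fixes G :: "('d::finite site \<Rightarrow> bool) \<Rightarrow> real"
  assumes G: "integrable (env p) G" and Gnn: "\<And>\<omega>. 0 \<le> G \<omega>"
    and esc: "AE s in source q. filterlim (displacement s) cofinite sequentially"
  shows "walk.mean_ergodic p q (\<lambda>(\<omega>, s). G \<omega> * clock (shd s))"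
    and "integrable (env p \<Otimes>\<^sub>M source q) (\<lambda>(\<omega>, s). G \<omega> * clock (shd s))"
    and "(\<integral>z. (case z of (\<omega>, s) \<Rightarrow> G \<omega> * clock (shd s)) \<partial>(env p \<Otimes>\<^sub>M source q)) = (\<integral>\<omega>. G \<omega> \<partial>env p)"
proof -
  let ?M = "(env p :: ('d site \<Rightarrow> bool) measure) \<Otimes>\<^sub>M source q" and ?X = "measure_pmf q \<Otimes>\<^sub>M exp1"
  have [measurable]: "G \<in> borel_measurable (env p)" using G by simp
  have [measurable]: "(\<lambda>s. clock (shd s)) \<in> borel_measurable (source q)" by measurable
  define f where "f = (\<lambda>(\<omega>, s :: ('d site \<times> real) stream). G \<omega> * clock (shd s))"
  have f_meas [measurable]: "f \<in> borel_measurable ?M" unfolding f_def split_beta' by measurable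
  have f_nn: "0 \<le> f z" for z unfolding f_def by (auto simp: split_beta' Gnn)
  have clk: "(\<integral>\<^sup>+s. ennreal (clock (shd s)) \<partial>source q) = 1"
    using nn_integral_distr[of shd "source q" ?X "\<lambda>x. ennreal (clock x)"]
    by (simp add: distr_shd_source nn_integral_clock)
  have "(\<integral>\<^sup>+z. ennreal (f z) \<partial>?M) = (\<integral>\<^sup>+\<omega>. (\<integral>\<^sup>+s. ennreal (G \<omega>) * ennreal (clock (shd s)) \<partial>source q) \<partial>env p)"
    by (subst source.nn_integral_fst[symmetric]) (auto simp: f_def ennreal_mult Gnn)
  also have "\<dots> = (\<integral>\<^sup>+\<omega>. ennreal (G \<omega>) \<partial>env p)"
    by (simp add: nn_integral_cmult clk)
  also have "\<dots> = ennreal (\<integral>\<omega>. G \<omega> \<partial>env p)" by (rule nn_integral_eq_integral[OF G]) (simp add: Gnn)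
  finally have nn: "(\<integral>\<^sup>+z. ennreal (f z) \<partial>?M) = ennreal (\<integral>\<omega>. G \<omega> \<partial>env p)" .
  have f_int: "integrable ?M f"
    by (rule integrableI_nonneg) (auto simp: f_nn nn)
  then show "integrable ?M (\<lambda>(\<omega>, s). G \<omega> * clock (shd s))" unfolding f_def .
  have "(\<integral>z. f z \<partial>?M) = (\<integral>\<omega>. G \<omega> \<partial>env p)"
    using nn nn_integral_eq_integral[OF f_int] f_nn Gnn by (simp add: integral_nonneg)
  then show "(\<integral>z. (case z of (\<omega>, s) \<Rightarrow> G \<omega> * clock (shd s)) \<partial>?M) = (\<integral>\<omega>. G \<omega> \<partial>env p)" unfolding f_def .
  define g where "g k = (\<lambda>(\<omega>, s :: ('d site \<times> real) stream). min (G \<omega>) (real k) * min (clock (shd s)) (real k))" for k :: nat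
  have g_meas [measurable]: "g k \<in> borel_measurable ?M" for k unfolding g_def split_beta' by measurable
  have g_le: "0 \<le> g k z" "g k z \<le> f z" for k z
    unfolding g_def f_def by (auto simp: split_beta' Gnn intro!: mult_mono)
  have min_abs: "\<bar>min a (real k)\<bar> \<le> real k" if "0 \<le> a" for a :: real and k
    using that by (auto simp: min_def)
  have g_mean: "walk.mean_ergodic p q (g k)" for k
    unfolding g_def
    by (rule walk_mean_ergodic_bounded(1)[where B="real k" and C="real k" and h="\<lambda>x. min (clock x) (real k)", OF _ _ _ _ esc])
       (auto simp: Gnn intro!: min_abs)
  have g_int: "integrable ?M (g k)" for k
    by (rule Bochner_Integration.integrable_bound[OF f_int]) (use g_le f_nn in auto)
  have "(\<lambda>k. \<integral>z. \<bar>f z - g k z\<bar> \<partial>?M) \<longlonglongrightarrow> (\<integral>z. 0 \<partial>?M)"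
  proof (rule integral_dominated_convergence[where w=f])
    show "AE z in ?M. norm \<bar>f z - g k z\<bar> \<le> f z" for k using g_le f_nn by (auto intro!: AE_I2)
    show "AE z in ?M. (\<lambda>k. \<bar>f z - g k z\<bar>) \<longlonglongrightarrow> 0"
    proof (rule AE_I2)
      fix z :: "('d site \<Rightarrow> bool) \<times> ('d site \<times> real) stream"
      obtain \<omega> s where z: "z = (\<omega>, s)" by (cases z)
      obtain k0 :: nat where k0: "max (G \<omega>) (clock (shd s)) \<le> real k0" using real_arch_simple by blast
      have "\<bar>f z - g k z\<bar> = 0" if "k \<ge> k0" for k
      proof -
        have "real k0 \<le> real k" using that by simp
        then show ?thesis using k0 by (simp add: z f_def g_def min_absorb1)
      qed
      then have "eventually (\<lambda>k. \<bar>f z - g k z\<bar> = 0) sequentially" by (auto simp: eventually_sequentially)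
      then show "(\<lambda>k. \<bar>f z - g k z\<bar>) \<longlonglongrightarrow> 0" by (rule tendsto_eventually)
    qed
  qed (use f_int in auto)
  then have to0: "(\<lambda>k. \<integral>z. \<bar>f z - g k z\<bar> \<partial>?M) \<longlonglongrightarrow> 0" by simp
  show "walk.mean_ergodic p q (\<lambda>(\<omega>, s). G \<omega> * clock (shd s))"
    unfolding f_def[symmetric]
  proof (rule walk.mean_ergodic_approx[OF f_int])
    fix e :: real assume "0 < e"
    then obtain k where "\<bar>\<integral>z. \<bar>f z - g k z\<bar> \<partial>?M\<bar> < e" using LIMSEQ_D[OF to0, of e] by auto
    then show "\<exists>h. integrable ?M h \<and> walk.mean_ergodic p q h \<and> (\<integral>z. \<bar>f z - h z\<bar> \<partial>?M) \<le> e"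
      using g_int g_mean by (intro exI[of _ "g k"]) auto
  qed
qed

lemma birkhoff_walk:
  "walk.birkhoff_sum (\<lambda>(\<omega>, s). F \<omega> * h (shd s)) n (\<omega>, s) = (\<Sum>k<n. F (translate (displacement s k) \<omega>) * h (s !! k))"
  unfolding walk.birkhoff_sum_def by (simp add: funpow_walk_shift)

lemma divide_ennreal_real:
  "0 \<le> x \<Longrightarrow> 0 < n \<Longrightarrow> ennreal x / ennreal (real n) = ennreal (x / real n)"
  by (simp add: divide_ennreal)

text \<open>If the mean is finite, almost surely no site has infinite waiting time and the arrival
  times are Birkhoff sums of an integrable function. If it is infinite, waiting times truncated at
  \<open>k\<close> and clocks truncated at 1 give lower averages whose limits are unbounded in
  \<open>k\<close>.\<close>

lemma arrival_LLN:
  fixes W :: "('d::finite site \<Rightarrow> bool) \<Rightarrow> ennreal"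
  assumes W [measurable]: "W \<in> borel_measurable (env p)"
    and esc: "AE s in source q. filterlim (displacement s) cofinite sequentially"
  shows "AE (\<omega>, s) in env p \<Otimes>\<^sub>M source q.
    (\<lambda>n. arrival (\<lambda>z. W (translate z \<omega>)) s n / ennreal (real n)) \<longlonglongrightarrow> (\<integral>\<^sup>+\<omega>. W \<omega> \<partial>env p)"
proof (cases "(\<integral>\<^sup>+\<omega>. W \<omega> \<partial>env p) = \<infinity>")
  case False
  let ?M = "(env p :: ('d site \<Rightarrow> bool) measure) \<Otimes>\<^sub>M source q"
  define G where "G \<omega> = enn2real (W \<omega>)" for \<omega>
  have G_meas [measurable]: "G \<in> borel_measurable (env p)" unfolding G_def by measurable
  have fin: "AE \<omega> in env p. W \<omega> \<noteq> \<infinity>" by (rule nn_integral_PInf_AE[OF W False])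
  have nnG: "(\<integral>\<^sup>+\<omega>. ennreal (G \<omega>) \<partial>env p) = (\<integral>\<^sup>+\<omega>. W \<omega> \<partial>env p)"
    using fin by (intro nn_integral_cong_AE) (auto simp: G_def less_top elim!: eventually_mono)
  have G_int: "integrable (env p) G"
    using False by (intro integrableI_nonneg) (auto simp: G_def nnG[unfolded G_def] less_top)
  \<comment> \<open>The walk may visit any site, so finiteness is needed at all of the countably
    many sites simultaneously.\<close>
  have "AE \<omega> in env p. W (translate z \<omega>) \<noteq> \<infinity>" for z
    by (rule AE_distrD[OF translate_measurable]) (subst distr_translate, rule fin)
  then have "AE \<omega> in env p. \<forall>z. W (translate z \<omega>) \<noteq> \<infinity>" by (simp add: AE_all_countable)
  then have finM: "AE z in ?M. \<forall>y. W (translate y (fst z)) \<noteq> \<infinity>"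
    by (intro env_source.AE_pair_measure) (auto elim!: eventually_mono)
  note erg = walk_mean_ergodic[OF G_int _ esc, unfolded G_def, simplified, folded G_def]
  have lim: "AE z in ?M. (\<lambda>n. walk.birkhoff_sum (\<lambda>(\<omega>, s). G \<omega> * clock (shd s)) n z / real n) \<longlonglongrightarrow> (\<integral>\<omega>. G \<omega> \<partial>env p)"
    using walk.birkhoff_AE[OF erg(2,1)] erg(3) by simp
  show ?thesis using lim finM
  proof eventually_elim
    case (elim z)
    obtain \<omega> s where z: "z = (\<omega>, s)" by (cases z)
    let ?b = "\<lambda>n. \<Sum>k<n. G (translate (displacement s k) \<omega>) * clock (s !! k)"
    have "arrival (\<lambda>z. W (translate z \<omega>)) s n = ennreal (?b n)" for n
    proof -
      have "ennreal (snd (s !! k)) * W (translate (displacement s k) \<omega>) =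
          ennreal (G (translate (displacement s k) \<omega>) * clock (s !! k))" for k
        using elim(2) by (simp add: z G_def ennreal_mult ennreal_clock less_top mult.commute)
      then show ?thesis unfolding arrival_def
        by (subst sum_ennreal[symmetric]) (auto simp: G_def)
    qed
    then have eq: "arrival (\<lambda>z. W (translate z \<omega>)) s n / ennreal (real n) = ennreal (?b n / real n)" if "0 < n" for n
      using that by (simp add: divide_ennreal_real sum_nonneg G_def)
    have "(\<lambda>n. ennreal (?b n / real n)) \<longlonglongrightarrow> ennreal (\<integral>\<omega>. G \<omega> \<partial>env p)"
      using elim(1) by (intro tendsto_ennrealI) (simp add: z birkhoff_walk)
    also have "ennreal (\<integral>\<omega>. G \<omega> \<partial>env p) = (\<integral>\<^sup>+\<omega>. W \<omega> \<partial>env p)"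
      unfolding nnG[symmetric] by (rule nn_integral_eq_integral[OF G_int, symmetric]) (simp add: G_def)
    finally have "(\<lambda>n. arrival (\<lambda>z. W (translate z \<omega>)) s n / ennreal (real n)) \<longlonglongrightarrow> (\<integral>\<^sup>+\<omega>. W \<omega> \<partial>env p)"
      by (rule Lim_transform_eventually[OF _ eventually_mono[OF eventually_gt_at_top[of 0]]]) (simp add: eq)
    then show ?case by (simp add: z)
  qed
next
  case True
  let ?M = "(env p :: ('d site \<Rightarrow> bool) measure) \<Otimes>\<^sub>M source q"
  define F where "F k \<omega> = enn2real (min (W \<omega>) (of_nat k))" for k :: nat and \<omega>
  have F_meas [measurable]: "F k \<in> borel_measurable (env p)" for k unfolding F_def by measurable
  have F_ennreal: "ennreal (F k \<omega>) = min (W \<omega>) (of_nat k)" for k \<omega>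
    unfolding F_def by (intro ennreal_enn2real) (auto simp: min_def less_top[symmetric] top_unique)
  have F_le: "F k \<omega> \<le> real k" for k \<omega>
    unfolding F_def by (rule enn2real_leI) (auto simp: ennreal_of_nat_eq_real_of_nat min_le_iff_disj)
  have F_nn: "0 \<le> F k \<omega>" for k \<omega> by (simp add: F_def)
  have F_abs: "\<bar>F k \<omega>\<bar> \<le> real k" for k \<omega> using F_le[of k \<omega>] F_nn[of k \<omega>] by simp
  have F_int: "integrable (env p) (F k)" for k
    by (rule env_source.M1.integrable_const_bound[where B="real k"]) (use F_abs in auto)
  define h where "h x = min 1 (clock x)" for x :: "'d site \<times> real"
  have h_meas [measurable]: "h \<in> borel_measurable (measure_pmf q \<Otimes>\<^sub>M exp1)" unfolding h_def by measurable
  have h_abs: "\<bar>h x\<bar> \<le> 1" and h_nn: "0 \<le> h x" for x unfolding h_def by auto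
  have "AE z in ?M. (\<lambda>n. walk.birkhoff_sum (\<lambda>(\<omega>, s). F k \<omega> * h (shd s)) n z / real n) \<longlonglongrightarrow> (\<integral>\<omega>. F k \<omega> \<partial>env p) * mean_clock q" for k
  proof -
    note erg = walk_mean_ergodic_bounded[OF F_meas[of k] F_abs h_meas h_abs esc]
    have "integrable ?M (\<lambda>(\<omega>, s). F k \<omega> * h (shd s))"
    proof (rule env_source.P.integrable_const_bound[where B="real k * 1"])
      show "AE z in ?M. norm (case z of (\<omega>, s) \<Rightarrow> F k \<omega> * h (shd s)) \<le> real k * 1"
        unfolding split_beta' real_norm_def abs_mult by (intro AE_I2 mult_mono F_abs h_abs) auto
      show "(\<lambda>(\<omega>, s). F k \<omega> * h (shd s)) \<in> borel_measurable ?M" unfolding split_beta' by measurable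
    qed
    from walk.birkhoff_AE[OF this erg(1)] show ?thesis unfolding erg(2) unfolding mean_clock_def h_def[abs_def] .
  qed
  then have "AE z in ?M. \<forall>k. (\<lambda>n. walk.birkhoff_sum (\<lambda>(\<omega>, s). F k \<omega> * h (shd s)) n z / real n) \<longlonglongrightarrow> (\<integral>\<omega>. F k \<omega> \<partial>env p) * mean_clock q"
    by (simp add: AE_all_countable)
  then show ?thesis
  proof eventually_elim
    case (elim z)
    obtain \<omega> s where z: "z = (\<omega>, s)" by (cases z)
    let ?A = "arrival (\<lambda>z. W (translate z \<omega>)) s"
    have "(\<lambda>n. ?A n / ennreal (real n)) \<longlonglongrightarrow> top"
    proof (rule order_tendstoI)
      fix a :: ennreal assume "a < top"
      then obtain r where a: "a = ennreal r" and r: "0 \<le> r" by (cases a) auto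
      have "(SUP k. \<integral>\<^sup>+\<omega>. min (W \<omega>) (of_nat k) \<partial>env p) = (\<integral>\<^sup>+\<omega>. (SUP k. min (W \<omega>) (of_nat k)) \<partial>env p)"
        by (rule nn_integral_monotone_convergence_SUP[symmetric])
           (auto simp: incseq_def le_fun_def intro!: min.mono of_nat_mono simp del: min.bounded_iff)
      also have "\<dots> = (\<integral>\<^sup>+\<omega>. W \<omega> \<partial>env p)"
      proof (rule nn_integral_cong)
        fix \<omega> :: "'d site \<Rightarrow> bool"
        have "(SUP k. min (W \<omega>) (of_nat k)) = min (W \<omega>) (SUP k. of_nat k)"
          by (simp add: inf_min[symmetric] inf_SUP)
        then show "(SUP k. min (W \<omega>) (of_nat k)) = W \<omega>" by (simp add: ennreal_SUP_of_nat_eq_top)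
      qed
      \<comment> \<open>Division by \<open>mean_clock q\<close> compensates for the truncated
        clocks, whose mean takes the place of 1.\<close>
      finally have "ennreal (r / mean_clock q) < (SUP k. \<integral>\<^sup>+\<omega>. min (W \<omega>) (of_nat k) \<partial>env p)"
        unfolding True by (simp only: infinity_ennreal_def ennreal_less_top)
      then obtain k where k: "ennreal (r / mean_clock q) < (\<integral>\<^sup>+\<omega>. min (W \<omega>) (of_nat k) \<partial>env p)"
        by (auto simp: less_SUP_iff)
      have "(\<integral>\<^sup>+\<omega>. min (W \<omega>) (of_nat k) \<partial>env p) = ennreal (\<integral>\<omega>. F k \<omega> \<partial>env p)"
        using nn_integral_eq_integral[OF F_int, of k] by (simp add: F_nn F_ennreal)
      with k have "r / mean_clock q < (\<integral>\<omega>. F k \<omega> \<partial>env p)"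
        using r mean_clock_pos[of q] by (simp add: ennreal_less_iff)
      then have rk: "r < (\<integral>\<omega>. F k \<omega> \<partial>env p) * mean_clock q" using mean_clock_pos[of q] by (simp add: field_simps)
      have lim: "(\<lambda>n. (\<Sum>j<n. F k (translate (displacement s j) \<omega>) * h (s !! j)) / real n) \<longlonglongrightarrow> (\<integral>\<omega>. F k \<omega> \<partial>env p) * mean_clock q"
        using elim by (simp add: z birkhoff_walk)
      show "eventually (\<lambda>n. a < ?A n / ennreal (real n)) sequentially"
        using order_tendstoD(1)[OF lim rk] eventually_gt_at_top[of 0]
      proof eventually_elim
        case (elim n)
        let ?b = "\<Sum>j<n. F k (translate (displacement s j) \<omega>) * h (s !! j)"
        have "ennreal ?b \<le> ?A n" unfolding arrival_def
        proof (subst sum_ennreal[symmetric])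
          show "(\<Sum>j<n. ennreal (F k (translate (displacement s j) \<omega>) * h (s !! j))) \<le>
              (\<Sum>j<n. ennreal (snd (s !! j)) * W (translate (displacement s j) \<omega>))"
          proof (rule sum_mono)
            fix j
            have "ennreal (F k (translate (displacement s j) \<omega>) * h (s !! j)) =
                ennreal (h (s !! j)) * min (W (translate (displacement s j) \<omega>)) (of_nat k)"
              by (simp add: ennreal_mult F_nn h_nn F_ennreal mult.commute)
            also have "\<dots> \<le> ennreal (snd (s !! j)) * W (translate (displacement s j) \<omega>)"
              unfolding ennreal_clock by (intro mult_mono ennreal_leI) (auto simp: h_def)
            finally show "ennreal (F k (translate (displacement s j) \<omega>) * h (s !! j)) \<le>
                ennreal (snd (s !! j)) * W (translate (displacement s j) \<omega>)" .
          qed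
        qed (auto simp: F_nn h_nn)
        then have "ennreal ?b / ennreal (real n) \<le> ?A n / ennreal (real n)" by (rule divide_right_mono_ennreal)
        moreover have "ennreal r < ennreal (?b / real n)" using elim r by (simp add: ennreal_less_iff)
        ultimately show ?case using elim unfolding a
          by (simp add: divide_ennreal_real sum_nonneg F_nn h_nn)
      qed
    qed (simp add: top_unique)
    then show ?case using True by (simp add: z)
  qed
qed

lemma AE_snd_source:
  fixes q :: "'d::finite site pmf"
  assumes "AE s in source q. P s"
  shows "AE z in (env p :: ('d site \<Rightarrow> bool) measure) \<Otimes>\<^sub>M source q. P (snd z)"
proof -
  obtain N where N: "N \<in> null_sets (source q)" "{s. \<not> P s} \<subseteq> N"
    using assms by (auto simp: eventually_ae_filter)
  have [measurable]: "N \<in> sets (source q)" using N(1) by auto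
  have "AE z in (env p :: ('d site \<Rightarrow> bool) measure) \<Otimes>\<^sub>M source q. snd z \<notin> N"
    by (rule env_source.AE_pair_measure) (use AE_not_in[OF N(1)] in auto)
  then show ?thesis by eventually_elim (use N(2) in auto)
qed

lemma displacement_LLN:
  fixes q :: "'d::finite site pmf"
  assumes bnd: "\<And>e. e \<in> set_pmf q \<Longrightarrow> norm (real_site e) \<le> 1"
  shows "AE s in source q. (\<lambda>n. real_site (displacement s n) /\<^sub>R real n) \<longlonglongrightarrow> (\<integral>e. real_site e \<partial>measure_pmf q)"
proof -
  let ?X = "measure_pmf q \<Otimes>\<^sub>M exp1"
  interpret q: prob_space "measure_pmf q" by (rule prob_space_measure_pmf)
  interpret U: prob_space exp1 by (rule prob_space_exp1)
  interpret P: pair_prob_space "measure_pmf q" exp1 ..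
  have supp: "AE x in ?X. fst x \<in> set_pmf q"
    by (rule P.AE_pair_measure) (auto simp: AE_measure_pmf)
  have "AE s in source q. stream_all (\<lambda>x. fst x \<in> set_pmf q) s"
    unfolding source_def by (rule prob_space.AE_stream_all[OF prob_space_step_clock _ supp]) measurable
  then have all: "AE s in source q. \<forall>n. fst (s !! n) \<in> set_pmf q"
    by eventually_elim (auto intro: snth_sset)
  \<comment> \<open>Set to 0 off the support of \<open>q\<close>, where coordinates are unbounded,
    so that the strong law for bounded functions applies to each coordinate.\<close>
  define h where "h k x = (if fst x \<in> set_pmf q then real_of_int (fst x $ k) else 0)" for k and x :: "'d site \<times> real"
  have h_meas [measurable]: "h k \<in> borel_measurable ?X" for k
  proof -
    have "(\<lambda>e. if e \<in> set_pmf q then real_of_int (e $ k) else 0) \<in> borel_measurable (measure_pmf q)" by simp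
    from measurable_compose[OF measurable_fst this] show ?thesis unfolding h_def[abs_def] .
  qed
  have h_abs: "\<bar>h k x\<bar> \<le> 1" for k x
    using component_le_norm_cart[of "real_site (fst x)" k] bnd[of "fst x"]
    by (auto simp: h_def real_site_def)
  have site_int: "integrable (measure_pmf q) real_site"
    by (rule measure_pmf.integrable_const_bound[where B=1]) (use bnd in \<open>auto simp: AE_measure_pmf_iff\<close>)
  have h_eq: "(\<integral>x. h k x \<partial>?X) = (\<integral>e. real_site e \<partial>measure_pmf q) $ k" for k
  proof -
    have "integrable ?X (h k)" by (rule P.P.integrable_const_bound[where B=1]) (use h_abs in auto)
    note fubini = P.integral_fst'[OF this, symmetric]
    have "(\<integral>x. h k x \<partial>?X) = (\<integral>e. (if e \<in> set_pmf q then real_of_int (e $ k) else 0) \<partial>measure_pmf q)"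
      unfolding fubini by (simp add: h_def prob_space.prob_space[OF prob_space_exp1, simplified] cong: if_cong)
    also have "\<dots> = (\<integral>e. real_site e $ k \<partial>measure_pmf q)"
      by (rule integral_cong_AE) (auto simp: AE_measure_pmf_iff real_site_def)
    also have "\<dots> = (\<integral>e. real_site e \<partial>measure_pmf q) $ k"
      by (rule integral_bounded_linear[OF bounded_linear_vec_nth site_int])
    finally show ?thesis .
  qed
  have "AE s in source q. \<forall>k. (\<lambda>n. (\<Sum>j<n. h k (s !! j)) / real n) \<longlonglongrightarrow> (\<integral>e. real_site e \<partial>measure_pmf q) $ k"
  proof -
    have "AE s in source q. \<forall>k\<in>UNIV. (\<lambda>n. (\<Sum>j<n. h k (s !! j)) / real n) \<longlonglongrightarrow> (\<integral>e. real_site e \<partial>measure_pmf q) $ k"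
      using source_LLN[OF h_meas h_abs] by (intro AE_finite_allI) (auto simp: h_eq)
    then show ?thesis by simp
  qed
  then show ?thesis using all
  proof eventually_elim
    case (elim s)
    have "(real_site (displacement s n) /\<^sub>R real n) $ k = (\<Sum>j<n. h k (s !! j)) / real n" for n k
      using elim(2) by (simp add: real_site_def displacement_def h_def divide_inverse mult.commute)
    then show ?case using elim(1) by (intro vec_tendstoI) simp
  qed
qed

text \<open>A fixed site divided by \<open>n\<close> tends to 0 while the displacement divided by
  \<open>n\<close> stays away from 0, so each site, and then each finite set, is eventually
  avoided.\<close>

lemma displacement_escapes:
  fixes s :: "('d::finite site \<times> real) stream"
  assumes lim: "(\<lambda>n. real_site (displacement s n) /\<^sub>R real n) \<longlonglongrightarrow> m" and m: "m \<noteq> 0"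
  shows "filterlim (displacement s) cofinite sequentially"
proof -
  have avoid: "eventually (\<lambda>n. displacement s n \<noteq> z) sequentially" for z
  proof -
    have "(\<lambda>n. real_site z /\<^sub>R real n) \<longlonglongrightarrow> 0 *\<^sub>R real_site z"
      by (intro tendsto_scaleR lim_inverse_n tendsto_const)
    then have "(\<lambda>n. norm (real_site (displacement s n) /\<^sub>R real n - real_site z /\<^sub>R real n)) \<longlonglongrightarrow> norm (m - 0)"
      using lim by (intro tendsto_norm tendsto_diff) auto
    moreover have "0 < norm (m - 0)" using m by simp
    ultimately have "eventually (\<lambda>n. 0 < norm (real_site (displacement s n) /\<^sub>R real n - real_site z /\<^sub>R real n)) sequentially"
      by (rule order_tendstoD)
    then show ?thesis by eventually_elim auto
  qed
  show ?thesis unfolding filterlim_iff eventually_cofinite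
  proof (intro allI impI)
    fix P :: "'d site \<Rightarrow> bool" assume "finite {x. \<not> P x}"
    then have "eventually (\<lambda>n. \<forall>z\<in>{x. \<not> P x}. displacement s n \<noteq> z) sequentially"
      by (intro eventually_ball_finite) (auto simp: avoid)
    then show "eventually (\<lambda>n. P (displacement s n)) sequentially" by eventually_elim auto
  qed
qed

theorem position_LLN:
  fixes W :: "('d::finite site \<Rightarrow> bool) \<Rightarrow> ennreal" and q :: "'d site pmf"
  assumes W [measurable]: "W \<in> borel_measurable (env p)" and W1: "\<And>\<omega>. 1 \<le> W \<omega>"
    and bnd: "\<And>e. e \<in> set_pmf q \<Longrightarrow> norm (real_site e) \<le> 1"
  shows "AE (\<omega>, s) in env p \<Otimes>\<^sub>M source q.
    ((\<lambda>t. (1 / t) *\<^sub>R real_site (position (\<lambda>z. W (translate z \<omega>)) s t)) \<longlongrightarrow>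
      enn2real (inverse (\<integral>\<^sup>+\<omega>. W \<omega> \<partial>env p)) *\<^sub>R (\<integral>e. real_site e \<partial>measure_pmf q)) at_top"
proof -
  let ?M = "(env p :: ('d site \<Rightarrow> bool) measure) \<Otimes>\<^sub>M source q"
  define m where "m = (\<integral>e. real_site e \<partial>measure_pmf q)"
  define J where "J = (\<integral>\<^sup>+\<omega>. W \<omega> \<partial>env p)"
  have "(\<integral>\<^sup>+\<omega>. 1 \<partial>(env p :: ('d site \<Rightarrow> bool) measure)) \<le> J" unfolding J_def by (intro nn_integral_mono W1)
  moreover have "(\<integral>\<^sup>+\<omega>. 1 \<partial>(env p :: ('d site \<Rightarrow> bool) measure)) = 1" using prob_space.emeasure_space_1[OF prob_space_env] by simp
  ultimately have "1 \<le> J" by simp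
  then have J0: "0 < J" by (rule less_le_trans[OF zero_less_one])
  have disp: "AE s in source q. (\<lambda>n. real_site (displacement s n) /\<^sub>R real n) \<longlonglongrightarrow> m"
    unfolding m_def by (rule displacement_LLN[OF bnd])
  have clk: "AE s in source q. (\<lambda>n. (\<Sum>k<n. min 1 (clock (s !! k))) / real n) \<longlonglongrightarrow> mean_clock q"
    unfolding mean_clock_def by (rule source_LLN[where B=1]) auto
  \<comment> \<open>Guarded by \<open>m \<noteq> 0\<close> because arrival times are averaged along
    an escaping displacement; the guard lets both cases share the pointwise argument below.\<close>
  have arr: "AE z in ?M. m \<noteq> 0 \<longrightarrow> (\<lambda>n. arrival (\<lambda>y. W (translate y (fst z))) (snd z) n / ennreal (real n)) \<longlonglongrightarrow> J"
  proof (cases "m = 0")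
    case False
    have "AE s in source q. filterlim (displacement s) cofinite sequentially"
      using disp by eventually_elim (rule displacement_escapes[OF _ False])
    from arrival_LLN[OF W this] show ?thesis unfolding J_def by eventually_elim (simp add: split_beta')
  qed simp
  show ?thesis using AE_snd_source[OF disp, of p] AE_snd_source[OF clk, of p] arr
  proof eventually_elim
    case (elim z)
    obtain \<omega> s where z: "z = (\<omega>, s)" by (cases z)
    let ?W = "\<lambda>y. W (translate y \<omega>)"
    \<comment> \<open>Any slope below the mean truncated clock serves; since waiting times are at
      least 1, the clocks alone then bound the number of jumps linearly.\<close>
    let ?b = "mean_clock q / 2"
    have b: "0 < ?b" "?b < mean_clock q" using mean_clock_pos[of q] by auto
    have "eventually (\<lambda>n. ennreal (?b * real n) \<le> arrival ?W s n) sequentially"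
      using order_tendstoD(1)[OF elim(2) b(2)] eventually_gt_at_top[of 0]
    proof eventually_elim
      case (elim n)
      have "?b * real n \<le> (\<Sum>k<n. min 1 (clock (s !! k)))" using elim by (simp add: z field_simps)
      then have "ennreal (?b * real n) \<le> ennreal (\<Sum>k<n. min 1 (clock (s !! k)))" by (rule ennreal_leI)
      also have "\<dots> = (\<Sum>k<n. ennreal (min 1 (clock (s !! k))))" by (rule sum_ennreal[symmetric]) simp
      also have "\<dots> \<le> arrival ?W s n" unfolding arrival_def
      proof (rule sum_mono)
        fix k
        have "ennreal (min 1 (clock (s !! k))) * 1 \<le> ennreal (snd (s !! k)) * ?W (displacement s k)"
          unfolding ennreal_clock by (intro mult_mono ennreal_leI W1) auto
        then show "ennreal (min 1 (clock (s !! k))) \<le> ennreal (snd (s !! k)) * ?W (displacement s k)" by simp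
      qed
      finally show ?case .
    qed
    from count_upper[OF b(1) this]
    have bound: "eventually (\<lambda>t. real (jumps ?W s t) \<le> (1 / ?b) * t) at_top"
      unfolding jumps_def by (simp add: mult.commute)
    have "((\<lambda>t. (real (jumps ?W s t) / t) *\<^sub>R m) \<longlongrightarrow> enn2real (inverse J) *\<^sub>R m) at_top"
    proof (cases "m = 0")
      case False
      then have "(\<lambda>n. arrival ?W s n / ennreal (real n)) \<longlonglongrightarrow> J" using elim(3) by (simp add: z)
      from renewal[OF this J0 incseq_arrival] show ?thesis
        unfolding jumps_def by (intro tendsto_scaleR tendsto_const)
    qed simp
    from tendsto_time_change[OF _ bound this, of "\<lambda>n. real_site (displacement s n)"] elim(1)
    show ?case unfolding J_def m_def by (simp add: z position_def)
  qed
qed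

section \<open>The first jump\<close>

definition walk_path :: "('d::finite site \<Rightarrow> ennreal) \<Rightarrow> 'd site \<Rightarrow> ('d site \<times> real) stream \<Rightarrow> real \<Rightarrow> 'd site" where
  "walk_path W x s t = x + position (\<lambda>z. W (x + z)) s t"

text \<open>Speaks of the clocks only: with waiting times at least 1 it makes every time preceded by
  finitely many jumps, so one null set serves all waiting times and all starting points.\<close>

definition non_explosive :: "('d::finite site \<times> real) stream \<Rightarrow> bool" where
  "non_explosive s \<longleftrightarrow> (\<forall>t::real. \<exists>n. ennreal t < (\<Sum>k<Suc n. ennreal (snd (s !! k))))"

lemma AE_non_explosive: "AE s in source q. non_explosive s"
proof -
  have "AE s in source q. (\<lambda>n. (\<Sum>k<n. min 1 (clock (s !! k))) / real n) \<longlonglongrightarrow> mean_clock q"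
    unfolding mean_clock_def by (rule source_LLN[where B=1]) auto
  then show ?thesis
  proof eventually_elim
    case (elim s)
    define b where "b = mean_clock q / 2"
    have b: "0 < b" "b < mean_clock q" unfolding b_def using mean_clock_pos[of q] by auto
    show ?case unfolding non_explosive_def
    proof
      fix t :: real
      obtain k :: nat where k: "t / b < real k" using reals_Archimedean2 by blast
      have "eventually (\<lambda>n. b < (\<Sum>k<n. min 1 (clock (s !! k))) / real n \<and> Suc k \<le> n) sequentially"
        using order_tendstoD(1)[OF elim b(2)] eventually_ge_at_top[of "Suc k"] by eventually_elim simp
      then obtain n where n: "b < (\<Sum>k<n. min 1 (clock (s !! k))) / real n" "Suc k \<le> n"
        by (auto simp: eventually_sequentially)
      have "t < b * real k" using k b by (simp add: field_simps)
      also have "b * real k \<le> b * real n" using n b by (intro mult_left_mono) auto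
      also have "b * real n < (\<Sum>k<n. min 1 (clock (s !! k)))" using n by (simp add: field_simps)
      finally have "t < (\<Sum>k<n. min 1 (clock (s !! k)))" .
      then have "ennreal t < ennreal (\<Sum>k<n. min 1 (clock (s !! k)))"
        using n b by (intro ennreal_lessI) (auto simp: sum_nonneg intro: le_less_trans[OF _ \<open>b * real n < _\<close>])
      also have "\<dots> = (\<Sum>k<n. ennreal (min 1 (clock (s !! k))))" by (rule sum_ennreal[symmetric]) simp
      also have "\<dots> \<le> (\<Sum>k<n. ennreal (snd (s !! k)))"
        by (intro sum_mono) (auto simp: ennreal_clock intro: ennreal_leI)
      also have "\<dots> \<le> (\<Sum>k<Suc n. ennreal (snd (s !! k)))" by simp
      finally show "\<exists>n. ennreal t < (\<Sum>k<Suc n. ennreal (snd (s !! k)))" by blast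
    qed
  qed
qed

lemma sum_le_arrival:
  assumes "\<And>z. 1 \<le> W z"
  shows "(\<Sum>k<n. ennreal (snd (s !! k))) \<le> arrival W s n"
  unfolding arrival_def
proof (rule sum_mono)
  fix k
  show "ennreal (snd (s !! k)) \<le> ennreal (snd (s !! k)) * W (displacement s k)"
    using mult_left_mono[OF assms, of "ennreal (snd (s !! k))"] by simp
qed

lemma arrival_Stream:
  "arrival W ((e, v) ## s) (Suc n) = ennreal v * W 0 + arrival (\<lambda>z. W (e + z)) s n"
  unfolding arrival_def by (simp add: sum.lessThan_Suc_shift displacement_Suc del: sum.lessThan_Suc)

lemma walk_path_before:
  assumes "ennreal t < ennreal v * W x"
  shows "walk_path W x ((e, v) ## s) t = x"
proof -
  have "jumps (\<lambda>z. W (x + z)) ((e, v) ## s) t = 0"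
    unfolding jumps_def using assms by (intro Least_eq_0) (simp add: arrival_Stream, simp add: arrival_def)
  then show ?thesis by (simp add: walk_path_def position_def)
qed

text \<open>Removing the first entry shifts both time, by \<open>v * w\<close>, and the number of
  jumps, by one. The shift of the least index needs a witness, which the clocks supply through
  \<open>non_explosive\<close>.\<close>

lemma walk_path_after:
  assumes W: "\<And>z. 1 \<le> W z" and Wx: "W x = ennreal w" and w: "0 \<le> w" and v: "0 < v" and t: "v * w \<le> t"
    and ne: "non_explosive s"
  shows "walk_path W x ((e, v) ## s) t = walk_path W (x + e) s (t - v * w)"
proof -
  let ?V = "\<lambda>z. W (x + z)" and ?V' = "\<lambda>z. W (x + e + z)"
  have tt: "ennreal t = ennreal (v * w) + ennreal (t - v * w)" using t v w by (subst ennreal_plus[symmetric]) auto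
  have iff: "ennreal t < arrival ?V ((e, v) ## s) (Suc (Suc n)) \<longleftrightarrow> ennreal (t - v * w) < arrival ?V' s (Suc n)" for n
    unfolding arrival_Stream using v w by (simp add: Wx ennreal_mult[symmetric] tt ennreal_add_left_cancel_less add.assoc)
  have no: "\<not> ennreal t < arrival ?V ((e, v) ## s) (Suc 0)"
    unfolding arrival_Stream using v w t by (simp add: Wx ennreal_mult[symmetric] arrival_def not_less ennreal_leI)
  obtain n where "ennreal (t - v * w) < (\<Sum>k<Suc n. ennreal (snd (s !! k)))"
    using ne by (auto simp: non_explosive_def)
  also have "\<dots> \<le> arrival ?V' s (Suc n)" by (rule sum_le_arrival) (rule W)
  finally have "ennreal t < arrival ?V ((e, v) ## s) (Suc (Suc n))" by (simp add: iff)
  from Least_Suc[of "\<lambda>n. ennreal t < arrival ?V ((e, v) ## s) (Suc n)", OF this no]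
  have "jumps ?V ((e, v) ## s) t = Suc (jumps ?V' s (t - v * w))"
    unfolding jumps_def iff .
  then show ?thesis by (simp add: walk_path_def position_def displacement_Suc add.assoc)
qed

section \<open>Memorylessness and the first-jump equation\<close>

definition rate :: "('d::finite site \<Rightarrow> ennreal) \<Rightarrow> 'd site \<Rightarrow> real" where
  "rate W x = enn2real (inverse (W x))"

lemma rate_real: "W x = ennreal w \<Longrightarrow> 1 \<le> w \<Longrightarrow> rate W x = 1 / w"
  by (simp add: rate_def inverse_ennreal inverse_eq_divide)

lemma rate_cases:
  assumes "1 \<le> W x"
  obtains "W x = top" "rate W x = 0" | w where "W x = ennreal w" "1 \<le> w" "rate W x = 1 / w"
proof (cases "W x")
  case (real w)
  then have "1 \<le> w" using assms by (simp add: ennreal_1[symmetric] del: ennreal_1)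
  then show ?thesis using that(2)[of w] rate_real[of W x w] real by auto
next
  case top
  then show ?thesis using that(1) by (simp add: rate_def)
qed

lemma rate_nonneg: "0 \<le> rate W x"
  by (simp add: rate_def)

lemma rate_le_1: "1 \<le> W x \<Longrightarrow> rate W x \<le> 1"
  by (erule rate_cases) auto

text \<open>Times in the list are increments.\<close>

fun path_cyl :: "(real \<times> 's) list \<Rightarrow> (real \<Rightarrow> 's) \<Rightarrow> bool" where
  "path_cyl [] Y \<longleftrightarrow> True"
| "path_cyl ((d, y) # ts) Y \<longleftrightarrow> Y d = y \<and> path_cyl ts (\<lambda>r. Y (d + r))"

lemma path_cyl_cong:
  assumes "\<And>r. 0 \<le> r \<Longrightarrow> Y r = Y' r" and "\<forall>z\<in>set ts. 0 \<le> fst z"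
  shows "path_cyl ts Y \<longleftrightarrow> path_cyl ts Y'"
  using assms
proof (induction ts arbitrary: Y Y')
  case (Cons z ts)
  obtain d y where z: "z = (d, y)" by (cases z)
  have "0 \<le> d" using Cons.prems(2) by (simp add: z)
  then have "path_cyl ts (\<lambda>r. Y (d + r)) \<longleftrightarrow> path_cyl ts (\<lambda>r. Y' (d + r))"
    using Cons.prems by (intro Cons.IH) auto
  then show ?case using Cons.prems(1)[OF \<open>0 \<le> d\<close>] by (simp add: z)
qed simp

text \<open>Waiting a time \<open>t\<close> without a jump uses up \<open>rate W x * t\<close> of
  the current clock, and the rest of the clock drives the rest of the path. At a site of infinite
  waiting time nothing is used up and the walk stays.\<close>

lemma walk_path_memoryless:
  assumes W: "\<And>z. 1 \<le> W z" and t: "0 \<le> t" and r: "0 \<le> r" and v: "rate W x * t < v" and ne: "non_explosive s"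
  shows "walk_path W x ((e, v) ## s) (t + r) = walk_path W x ((e, v - rate W x * t) ## s) r"
  using W[of x]
proof (cases rule: rate_cases)
  case 1
  then have "ennreal v * W x = top" "ennreal (v - rate W x * t) * W x = top"
    using v by (auto simp: ennreal_mult_top)
  then show ?thesis by (simp add: walk_path_before)
next
  case (2 w)
  let ?v' = "v - rate W x * t"
  have v0: "0 < v" using v t rate_nonneg[of W x] by (auto intro: le_less_trans[OF mult_nonneg_nonneg])
  have vw: "?v' * w = v * w - t" using 2 by (simp add: field_simps)
  show ?thesis
  proof (cases "t + r < v * w")
    case True
    then have "ennreal (t + r) < ennreal v * W x" "ennreal r < ennreal ?v' * W x"
      using 2 v v0 t r vw by (auto simp: ennreal_mult[symmetric] simp del: ennreal_plus intro!: ennreal_lessI)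
    then show ?thesis by (simp add: walk_path_before)
  next
    case False
    have "walk_path W x ((e, v) ## s) (t + r) = walk_path W (x + e) s (t + r - v * w)"
      using False 2 v0 by (intro walk_path_after W ne) auto
    also have "t + r - v * w = r - ?v' * w" using vw by simp
    also have "walk_path W (x + e) s (r - ?v' * w) = walk_path W x ((e, ?v') ## s) r"
      using False 2 v vw by (intro walk_path_after[symmetric] W ne) auto
    finally show ?thesis .
  qed
qed

text \<open>Stream and waiting times depend on a common parameter, so that measurability in the
  environment and measurability in the first entry are both instances. Sites being countable, the
  visited site can be fixed.\<close>

lemma measurable_arrival:
  fixes q :: "'d::finite site pmf"
  assumes s [measurable]: "s \<in> M \<rightarrow>\<^sub>M source q" and W [measurable]: "\<And>z. (\<lambda>w. W w z) \<in> borel_measurable M"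
  shows "(\<lambda>w. arrival (W w) (s w) n) \<in> borel_measurable M"
proof -
  have [measurable]: "(\<lambda>w. W w (displacement (s w) k)) \<in> borel_measurable M" for k
    by (rule measurable_compose_countable[of "\<lambda>z w. W w z" _ _ "\<lambda>w. displacement (s w) k"]) measurable
  have [measurable]: "(\<lambda>w. snd (s w !! k)) \<in> borel_measurable M" for k
  proof -
    have "(\<lambda>w. s w !! k) \<in> M \<rightarrow>\<^sub>M measure_pmf q \<Otimes>\<^sub>M exp1" by measurable
    from measurable_compose[OF this measurable_snd] show ?thesis by (simp cong: measurable_cong_sets)
  qed
  show ?thesis unfolding arrival_def by measurable
qed

lemma measurable_position:
  fixes q :: "'d::finite site pmf"
  assumes s [measurable]: "s \<in> M \<rightarrow>\<^sub>M source q" and W [measurable]: "\<And>z. (\<lambda>w. W w z) \<in> borel_measurable M"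
    and t [measurable]: "t \<in> borel_measurable M"
  shows "(\<lambda>w. position (W w) (s w) (t w)) \<in> M \<rightarrow>\<^sub>M count_space UNIV"
proof -
  note [measurable] = measurable_arrival[OF s W]
  have [measurable]: "(\<lambda>w. jumps (W w) (s w) (t w)) \<in> M \<rightarrow>\<^sub>M count_space UNIV"
    unfolding jumps_def by measurable
  show ?thesis unfolding position_def
    by (rule measurable_compose_countable[of "\<lambda>n w. displacement (s w) n" _ _ "\<lambda>w. jumps (W w) (s w) (t w)"]) measurable
qed

lemma measurable_walk_path:
  fixes q :: "'d::finite site pmf"
  assumes s [measurable]: "s \<in> M \<rightarrow>\<^sub>M source q" and W [measurable]: "\<And>z. (\<lambda>w. W w z) \<in> borel_measurable M"
    and t [measurable]: "t \<in> borel_measurable M" and x [measurable]: "x \<in> M \<rightarrow>\<^sub>M count_space UNIV"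
  shows "(\<lambda>w. walk_path (W w) (x w) (s w) (t w)) \<in> M \<rightarrow>\<^sub>M count_space UNIV"
proof (rule measurable_compose_countable[of "\<lambda>x w. walk_path (W w) x (s w) (t w)" _ _ x])
  fix x :: "'d site"
  have "(\<lambda>w. position (\<lambda>z. W w (x + z)) (s w) (t w)) \<in> M \<rightarrow>\<^sub>M count_space UNIV"
    by (rule measurable_position) measurable
  from measurable_compose[OF this, of "\<lambda>y. x + y" "count_space UNIV"]
  show "(\<lambda>w. walk_path (W w) x (s w) (t w)) \<in> M \<rightarrow>\<^sub>M count_space UNIV" by (simp add: walk_path_def)
qed measurable

lemma measurable_path_cyl:
  fixes q :: "'d::finite site pmf"
  assumes s [measurable]: "s \<in> M \<rightarrow>\<^sub>M source q" and W [measurable]: "\<And>z. (\<lambda>w. W w z) \<in> borel_measurable M"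
    and x [measurable]: "x \<in> M \<rightarrow>\<^sub>M count_space UNIV" and a: "a \<in> borel_measurable M"
  shows "Measurable.pred M (\<lambda>w. path_cyl ts (\<lambda>r. walk_path (W w) (x w) (s w) (a w + r)))"
  using a
proof (induction ts arbitrary: a)
  case (Cons z ts)
  obtain d y where z: "z = (d, y)" by (cases z)
  note [measurable] = Cons.prems
  have [measurable]: "(\<lambda>w. walk_path (W w) (x w) (s w) (a w + d)) \<in> M \<rightarrow>\<^sub>M count_space UNIV"
    by (rule measurable_walk_path[OF s W]) measurable
  have [measurable]: "Measurable.pred M (\<lambda>w. path_cyl ts (\<lambda>r. walk_path (W w) (x w) (s w) (a w + d + r)))"
    by (rule Cons.IH) measurable
  show ?case by (simp add: z add.assoc[symmetric])
qed simp

definition walk_prob :: "'d::finite site pmf \<Rightarrow> ('d site \<Rightarrow> ennreal) \<Rightarrow> (real \<times> 'd site) list \<Rightarrow> 'd site \<Rightarrow> real" where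
  "walk_prob q W ts x = measure (source q) {s. path_cyl ts (walk_path W x s)}"

lemma sets_path_cyl [measurable]:
  fixes q :: "'d::finite site pmf"
  shows "{s. path_cyl ts (walk_path W x s)} \<in> sets (source q)"
  using measurable_path_cyl[of "\<lambda>s. s" "source q" q "\<lambda>_. W" "\<lambda>_. x" "\<lambda>_. 0" ts]
  by (simp add: pred_def)

text \<open>The memoryless property of the exponential law in integral form.\<close>

lemma nn_integral_exp1_shift:
  assumes [measurable]: "f \<in> borel_measurable borel" and c: "0 \<le> c"
  shows "(\<integral>\<^sup>+v. indicator {c<..} v * f (v - c) \<partial>exp1) = ennreal (exp (- c)) * (\<integral>\<^sup>+v. f v \<partial>exp1)"
proof -
  have "(\<integral>\<^sup>+v. indicator {c<..} v * f (v - c) \<partial>exp1) =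
      (\<integral>\<^sup>+v. ennreal (exponential_density 1 v) * (indicator {c<..} v * f (v - c)) \<partial>lborel)"
    unfolding exp1_def by (rule nn_integral_density) auto
  also have "\<dots> = (\<integral>\<^sup>+v. ennreal (exponential_density 1 (c + v)) * (indicator {c<..} (c + v) * f v) \<partial>lborel)"
    by (subst nn_integral_real_affine[where c=1 and t=c]) auto
  also have "\<dots> = (\<integral>\<^sup>+v. ennreal (exp (- c)) * (ennreal (exponential_density 1 v) * f v) \<partial>lborel)"
  proof (rule nn_integral_cong_AE)
    \<comment> \<open>The point 0 is excluded because the strict indicator vanishes there while the
      density does not.\<close>
    have "AE v in lborel. v \<noteq> (0::real)" by (rule AE_lborel_singleton)
    then show "AE v in lborel. ennreal (exponential_density 1 (c + v)) * (indicator {c<..} (c + v) * f v) =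
        ennreal (exp (- c)) * (ennreal (exponential_density 1 v) * f v)"
    proof eventually_elim
      case (elim v)
      show ?case
      proof (cases "0 < v")
        case True
        have "exp (- c - v) = exp (- c) * exp (- v)" by (simp add: mult_exp_exp)
        then show ?thesis using c True
          by (simp add: exponential_density_def ennreal_mult mult.assoc)
      next
        case False
        then show ?thesis using elim by (simp add: exponential_density_def)
      qed
    qed
  qed
  also have "\<dots> = ennreal (exp (- c)) * (\<integral>\<^sup>+v. f v \<partial>exp1)"
    unfolding exp1_def by (simp add: nn_integral_cmult nn_integral_density)
  finally show ?thesis .
qed

lemma measurable_walk_prob:
  fixes q :: "'d::finite site pmf"
  assumes a [measurable]: "a \<in> borel_measurable M" and x [measurable]: "x \<in> M \<rightarrow>\<^sub>M count_space UNIV"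
  shows "(\<lambda>w. walk_prob q W ((a w, y) # ts) (x w)) \<in> borel_measurable M"
proof -
  let ?P = "\<lambda>w s. path_cyl ((a w, y) # ts) (walk_path W (x w) s)"
  have [measurable]: "(\<lambda>z. walk_path W (x (fst z)) (snd z) (a (fst z))) \<in> M \<Otimes>\<^sub>M source q \<rightarrow>\<^sub>M count_space UNIV"
    by (rule measurable_walk_path[of _ _ q]) measurable
  have [measurable]: "Measurable.pred (M \<Otimes>\<^sub>M source q) (\<lambda>z. path_cyl ts (\<lambda>r. walk_path W (x (fst z)) (snd z) (a (fst z) + r)))"
    by (rule measurable_path_cyl[of _ _ q]) measurable
  have P: "Measurable.pred (M \<Otimes>\<^sub>M source q) (\<lambda>z. ?P (fst z) (snd z))" by simp
  have "(\<lambda>w. emeasure (source q) {s \<in> space (source q). ?P w s}) \<in> borel_measurable M"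
  proof (rule source.measurable_emeasure)
    have "{z \<in> space (M \<Otimes>\<^sub>M source q). ?P (fst z) (snd z)} \<in> sets (M \<Otimes>\<^sub>M source q)" using P by measurable
    then show "{z \<in> space (M \<Otimes>\<^sub>M source q). snd z \<in> {s \<in> space (source q). ?P (fst z) s}} \<in> sets (M \<Otimes>\<^sub>M source q)" by simp
  qed simp
  then show ?thesis by (simp add: walk_prob_def measure_def)
qed

lemma walk_prob_le_1: "walk_prob q W ts x \<le> 1" and walk_prob_nonneg: "0 \<le> walk_prob q W ts x"
  by (simp_all add: walk_prob_def prob_space.prob_le_1[OF prob_space_source])

lemma walk_prob_Nil [simp]: "walk_prob q W [] x = 1"
  using prob_space.prob_space[OF prob_space_source, of q] by (simp add: walk_prob_def)

text \<open>The first clock is compared with \<open>c = rate W x * t\<close>. Beyond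
  \<open>c\<close>, the walk is still at \<open>x\<close> at time \<open>t\<close>, and the unspent
  clock is again exponential, so the remaining increments restart from \<open>x\<close>. Otherwise
  the jump comes at time \<open>v * W x\<close> and only the first increment is shortened. With
  \<open>y\<close> and \<open>ts\<close> fixed this is a closed equation in
  \<open>(t, x)\<close>.\<close>

lemma walk_prob_first_step:
  fixes q :: "'d::finite site pmf"
  assumes W: "\<And>z. 1 \<le> W z" and t: "0 \<le> t" and ts: "\<forall>z\<in>set ts. 0 \<le> fst z"
  shows "ennreal (walk_prob q W ((t, y) # ts) x) =
    ennreal (exp (- (rate W x * t)) * (of_bool (x = y) * walk_prob q W ts x)) +
    (\<integral>\<^sup>+z. indicator {..rate W x * t} (snd z) * ennreal (walk_prob q W ((t - snd z * enn2real (W x), y) # ts) (x + fst z)) \<partial>(measure_pmf q \<Otimes>\<^sub>M exp1))"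
proof -
  let ?X = "measure_pmf q \<Otimes>\<^sub>M exp1"
  interpret X: prob_space ?X by (rule prob_space_step_clock)
  interpret U: prob_space exp1 by (rule prob_space_exp1)
  define c where "c = rate W x * t"
  have c0: "0 \<le> c" unfolding c_def using t rate_nonneg[of W x] by simp
  define A where "A = {s. path_cyl ts (walk_path W x s)}"
  define B where "B z = {s. path_cyl ((t - snd z * enn2real (W x), y) # ts) (walk_path W (x + fst z) s)}" for z :: "'d site \<times> real"
  have A [measurable]: "A \<in> sets (source q)" unfolding A_def by measurable
  have B [measurable]: "B z \<in> sets (source q)" for z unfolding B_def by measurable
  have emB: "emeasure (source q) (B z) = ennreal (walk_prob q W ((t - snd z * enn2real (W x), y) # ts) (x + fst z))" for z
    unfolding B_def walk_prob_def by (rule source.emeasure_eq_measure)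
  \<comment> \<open>The first entry is kept as an argument, so that its clock can be replaced by the
    unspent part \<open>snd z - c\<close>.\<close>
  define \<Phi> where "\<Phi> z = (\<integral>\<^sup>+s. indicator A (z ## s) \<partial>source q)" for z
  have [measurable]: "(\<lambda>(z, s). indicator A (z ## s) :: ennreal) \<in> borel_measurable (?X \<Otimes>\<^sub>M source q)"
    using measurable_compose[OF measurable_Stream_source[of q] borel_measurable_indicator[OF A]] by (simp add: split_beta')
  have \<Phi>_meas [measurable]: "\<Phi> \<in> borel_measurable ?X" unfolding \<Phi>_def[abs_def] by (rule source.borel_measurable_nn_integral) simp
  have fst_meas [measurable]: "(\<lambda>z. x + fst z) \<in> ?X \<rightarrow>\<^sub>M count_space UNIV"
    using measurable_compose[OF measurable_fst_site[of q], of "\<lambda>e. x + e" "count_space UNIV"] by simp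
  have [measurable]: "(\<lambda>z. emeasure (source q) (B z)) \<in> borel_measurable ?X"
    unfolding emB by (intro measurable_compose[OF measurable_walk_prob measurable_ennreal] fst_meas) measurable
  have inner: "AE z in ?X. (\<integral>\<^sup>+s. indicator {s. path_cyl ((t, y) # ts) (walk_path W x s)} (z ## s) \<partial>source q) =
      indicator {c<..} (snd z) * (of_bool (x = y) * \<Phi> (fst z, snd z - c)) + indicator {..c} (snd z) * emeasure (source q) (B z)"
    using AE_clock_pos
  proof eventually_elim
    case (elim z)
    obtain e v where z: "z = (e, v)" by (cases z)
    have v: "0 < v" using elim by (simp add: z)
    have "(\<integral>\<^sup>+s. indicator {s. path_cyl ((t, y) # ts) (walk_path W x s)} (z ## s) \<partial>source q) =
        (\<integral>\<^sup>+s. indicator {c<..} v * of_bool (x = y) * indicator A ((e, v - c) ## s) + indicator {..c} v * indicator (B z) s \<partial>source q)"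
    proof (rule nn_integral_cong_AE)
      show "AE s in source q. indicator {s. path_cyl ((t, y) # ts) (walk_path W x s)} (z ## s) =
          indicator {c<..} v * of_bool (x = y) * indicator A ((e, v - c) ## s) + indicator {..c} v * (indicator (B z) s :: ennreal)"
        using AE_non_explosive
      proof eventually_elim
        case (elim s)
        show ?case
        proof (cases "c < v")
          case True
          have eq: "walk_path W x ((e, v) ## s) (t + r) = walk_path W x ((e, v - c) ## s) r" if "0 \<le> r" for r
            unfolding c_def by (rule walk_path_memoryless[OF W t that _ elim]) (use True in \<open>simp add: c_def\<close>)
          have "ennreal 0 < ennreal (v - c) * W x"
          proof -
            have "ennreal 0 < ennreal (v - c) * 1" using True by simp
            also have "\<dots> \<le> ennreal (v - c) * W x" by (intro mult_left_mono W) simp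
            finally show ?thesis .
          qed
          then have "walk_path W x ((e, v) ## s) t = x" using eq[of 0] by (simp add: walk_path_before)
          moreover have "path_cyl ts (\<lambda>r. walk_path W x ((e, v) ## s) (t + r)) \<longleftrightarrow> path_cyl ts (walk_path W x ((e, v - c) ## s))"
            using eq ts by (intro path_cyl_cong)
          ultimately show ?thesis using True by (auto simp: z A_def indicator_def)
        next
          case False
          from W[of x] show ?thesis
          proof (cases rule: rate_cases)
            \<comment> \<open>At a site of infinite waiting time \<open>c\<close> is 0, and a
              positive clock is never below it.\<close>
            case 1
            then show ?thesis using False v by (simp add: c_def)
          next
            case (2 w)
            have vt: "v * w \<le> t" using False 2 by (simp add: c_def field_simps)
            have eq: "walk_path W x ((e, v) ## s) r = walk_path W (x + e) s (r - v * w)" if "t \<le> r" for r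
              by (rule walk_path_after[of W x w v r s e]) (use W 2 v vt that elim in auto)
            have "path_cyl ts (\<lambda>r. walk_path W x ((e, v) ## s) (t + r)) \<longleftrightarrow> path_cyl ts (\<lambda>r. walk_path W (x + e) s (t - v * w + r))"
              using ts by (intro path_cyl_cong) (auto simp: eq algebra_simps)
            then show ?thesis using False 2 by (auto simp: z B_def eq indicator_def)
          qed
        qed
      qed
    qed
    also have "\<dots> = indicator {c<..} v * of_bool (x = y) * \<Phi> (e, v - c) + indicator {..c} v * emeasure (source q) (B z)"
      unfolding \<Phi>_def by (simp add: nn_integral_add nn_integral_cmult)
    finally show ?case by (simp add: z mult.assoc)
  qed
  have part1: "(\<integral>\<^sup>+z. indicator {c<..} (snd z) * (of_bool (x = y) * \<Phi> (fst z, snd z - c)) \<partial>?X) =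
      ennreal (exp (- c) * (of_bool (x = y) * walk_prob q W ts x))"
  proof -
    have "(\<integral>\<^sup>+z. indicator {c<..} (snd z) * (of_bool (x = y) * \<Phi> (fst z, snd z - c)) \<partial>?X) =
        (\<integral>\<^sup>+e. (\<integral>\<^sup>+v. indicator {c<..} v * (of_bool (x = y) * \<Phi> (e, v - c)) \<partial>exp1) \<partial>measure_pmf q)"
      by (subst U.nn_integral_fst[symmetric]) auto
    also have "\<dots> = (\<integral>\<^sup>+e. ennreal (exp (- c)) * (\<integral>\<^sup>+v. of_bool (x = y) * \<Phi> (e, v) \<partial>exp1) \<partial>measure_pmf q)"
    proof (rule nn_integral_cong)
      fix e
      have "(\<lambda>v. \<Phi> (e, v)) \<in> borel_measurable exp1" by measurable
      then have "(\<lambda>v. of_bool (x = y) * \<Phi> (e, v)) \<in> borel_measurable borel" by (simp cong: measurable_cong_sets)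
      from nn_integral_exp1_shift[OF this c0]
      show "(\<integral>\<^sup>+v. indicator {c<..} v * (of_bool (x = y) * \<Phi> (e, v - c)) \<partial>exp1) = ennreal (exp (- c)) * (\<integral>\<^sup>+v. of_bool (x = y) * \<Phi> (e, v) \<partial>exp1)" .
    qed
    also have "\<dots> = ennreal (exp (- c)) * (of_bool (x = y) * (\<integral>\<^sup>+z. \<Phi> z \<partial>?X))"
      by (subst U.nn_integral_fst[symmetric]) (auto simp: nn_integral_cmult)
    also have "(\<integral>\<^sup>+z. \<Phi> z \<partial>?X) = emeasure (source q) A"
      unfolding \<Phi>_def using nn_integral_source[of "indicator A" q] by simp
    also have "\<dots> = ennreal (walk_prob q W ts x)" unfolding A_def walk_prob_def by (rule source.emeasure_eq_measure)
    finally show ?thesis by (cases "x = y") (simp_all add: ennreal_mult walk_prob_nonneg)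
  qed
  have "ennreal (walk_prob q W ((t, y) # ts) x) = (\<integral>\<^sup>+s. indicator {s. path_cyl ((t, y) # ts) (walk_path W x s)} s \<partial>source q)"
    unfolding walk_prob_def
    by (subst nn_integral_indicator) (rule sets_path_cyl, rule source.emeasure_eq_measure[symmetric])
  also have "\<dots> = (\<integral>\<^sup>+z. (\<integral>\<^sup>+s. indicator {s. path_cyl ((t, y) # ts) (walk_path W x s)} (z ## s) \<partial>source q) \<partial>?X)"
    by (rule nn_integral_source) (intro borel_measurable_indicator sets_path_cyl)
  also have "\<dots> = (\<integral>\<^sup>+z. indicator {c<..} (snd z) * (of_bool (x = y) * \<Phi> (fst z, snd z - c)) + indicator {..c} (snd z) * emeasure (source q) (B z) \<partial>?X)"
    by (rule nn_integral_cong_AE[OF inner])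
  also have "\<dots> = (\<integral>\<^sup>+z. indicator {c<..} (snd z) * (of_bool (x = y) * \<Phi> (fst z, snd z - c)) \<partial>?X) +
      (\<integral>\<^sup>+z. indicator {..c} (snd z) * emeasure (source q) (B z) \<partial>?X)"
    by (rule nn_integral_add) measurable
  finally show ?thesis unfolding part1 emB by (simp add: c_def)
qed

section \<open>Semigroups with a bounded generator\<close>

text \<open>The nonnegative integral handles bounded nonnegative functions; adding the bound
  \<open>B\<close> reduces the signed case to them.\<close>

lemma expectation_bind_pmf:
  fixes f :: "'b \<Rightarrow> real"
  assumes B: "\<And>y. \<bar>f y\<bar> \<le> B"
  shows "measure_pmf.expectation (bind_pmf M N) f = measure_pmf.expectation M (\<lambda>x. measure_pmf.expectation (N x) f)"
proof -
  have nonneg: "measure_pmf.expectation (bind_pmf M N) g = measure_pmf.expectation M (\<lambda>x. measure_pmf.expectation (N x) g)"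
    if g: "\<And>y. 0 \<le> g y" "\<And>y. g y \<le> C" for g :: "'b \<Rightarrow> real" and C
  proof -
    have C0: "0 \<le> C" using order_trans[OF g] .
    have int: "integrable (measure_pmf p) g" for p :: "'b pmf"
      by (rule measure_pmf.integrable_const_bound[where B=C]) (use g in \<open>auto simp: abs_of_nonneg\<close>)
    have ex: "0 \<le> measure_pmf.expectation p g" "measure_pmf.expectation p g \<le> C" for p :: "'b pmf"
      using g by (auto intro!: Bochner_Integration.integral_nonneg measure_pmf.integral_le_const int)
    have int2: "integrable (measure_pmf M) (\<lambda>x. measure_pmf.expectation (N x) g)"
      by (rule measure_pmf.integrable_const_bound[where B=C]) (use ex in \<open>auto simp: abs_of_nonneg\<close>)
    have "ennreal (measure_pmf.expectation (bind_pmf M N) g) = (\<integral>\<^sup>+y. ennreal (g y) \<partial>bind_pmf M N)"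
      using g by (intro nn_integral_eq_integral[symmetric] int) auto
    also have "\<dots> = (\<integral>\<^sup>+x. (\<integral>\<^sup>+y. ennreal (g y) \<partial>N x) \<partial>M)" by simp
    also have "\<dots> = (\<integral>\<^sup>+x. ennreal (measure_pmf.expectation (N x) g) \<partial>M)"
      using g by (intro nn_integral_cong nn_integral_eq_integral int) auto
    also have "\<dots> = ennreal (measure_pmf.expectation M (\<lambda>x. measure_pmf.expectation (N x) g))"
      using ex by (intro nn_integral_eq_integral int2) auto
    finally show ?thesis using ex by (simp add: Bochner_Integration.integral_nonneg)
  qed
  have int: "integrable (measure_pmf p) f" for p :: "'b pmf"
    by (rule measure_pmf.integrable_const_bound[where B=B]) (use B in auto)
  have shift: "measure_pmf.expectation p (\<lambda>y. f y + B) = measure_pmf.expectation p f + B" for p :: "'b pmf"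
    using int by (simp add: measure_pmf.prob_space[simplified])
  have int3: "integrable (measure_pmf M) (\<lambda>x. measure_pmf.expectation (N x) f)"
    by (rule measure_pmf.integrable_const_bound[where B=B])
       (use measure_pmf.abs_expectation_le[of f] B in auto)
  have "measure_pmf.expectation (bind_pmf M N) (\<lambda>y. f y + B) = measure_pmf.expectation M (\<lambda>x. measure_pmf.expectation (N x) (\<lambda>y. f y + B))"
  proof (rule nonneg)
    show "0 \<le> f y + B" "f y + B \<le> 2 * B" for y using B[of y] by auto
  qed
  then show ?thesis
    using int3 by (simp add: shift measure_pmf.prob_space[simplified])
qed

locale bounded_semigroup =
  fixes T :: "real \<Rightarrow> 's \<Rightarrow> 's pmf" and L :: "('s \<Rightarrow> real) \<Rightarrow> 's \<Rightarrow> real"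
  assumes semigroup: "transition_semigroup T" and generator: "has_generator T L"
    and L_bounded: "bounded (range f) \<Longrightarrow> bounded (range (L f))"
begin

definition E :: "real \<Rightarrow> ('s \<Rightarrow> real) \<Rightarrow> 's \<Rightarrow> real" where
  "E t f x = measure_pmf.expectation (T t x) f"

definition quotient :: "real \<Rightarrow> ('s \<Rightarrow> real) \<Rightarrow> 's \<Rightarrow> real" where
  "quotient h f x = (E h f x - f x) / h"

lemma bounded_rangeE:
  assumes "bounded (range f)"
  obtains B :: real where "0 \<le> B" "\<And>x :: 's. \<bar>f x :: real\<bar> \<le> B"
proof -
  obtain B where "\<And>x. norm (f x) \<le> B" using assms by (auto simp: bounded_iff)
  then show ?thesis using that[of "\<bar>B\<bar>"] by (metis abs_ge_self abs_ge_zero order_trans real_norm_def)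
qed

lemma bounded_rangeI: "(\<And>x :: 's. \<bar>f x :: real\<bar> \<le> B) \<Longrightarrow> bounded (range f)"
  by (auto simp: bounded_iff)

lemma integrable_bounded: "bounded (range f) \<Longrightarrow> integrable (measure_pmf p) f" for p :: "'s pmf" and f :: "'s \<Rightarrow> real"
proof (erule bounded_rangeE)
  fix B assume "\<And>x. \<bar>f x\<bar> \<le> B"
  then show "integrable (measure_pmf p) f" by (intro measure_pmf.integrable_const_bound[where B=B]) auto
qed

lemma E_abs_le: "(\<And>y. \<bar>f y\<bar> \<le> B) \<Longrightarrow> \<bar>E t f x\<bar> \<le> B"
  unfolding E_def by (rule measure_pmf.abs_expectation_le) auto

lemma E_bounded: "bounded (range f) \<Longrightarrow> bounded (range (E t f))"
  by (erule bounded_rangeE) (auto intro: bounded_rangeI E_abs_le)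

lemma E_0 [simp]: "E 0 f x = f x"
  using semigroup by (simp add: E_def transition_semigroup_def)

lemma E_add: "0 \<le> s \<Longrightarrow> 0 \<le> t \<Longrightarrow> bounded (range f) \<Longrightarrow> E (s + t) f x = E s (E t f) x"
proof (erule bounded_rangeE)
  fix B assume st: "0 \<le> s" "0 \<le> t" and B: "\<And>x. \<bar>f x\<bar> \<le> B"
  have "T (s + t) x = bind_pmf (T s x) (T t)" using semigroup st by (simp add: transition_semigroup_def)
  then show "E (s + t) f x = E s (E t f) x" by (simp add: E_def[abs_def] expectation_bind_pmf[OF B])
qed

lemma E_diff: "bounded (range f) \<Longrightarrow> bounded (range g) \<Longrightarrow> E t (\<lambda>y. f y - g y) x = E t f x - E t g x"
  by (simp add: E_def integrable_bounded)

lemma E_diff_le: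
  assumes "bounded (range f)" "bounded (range g)" "\<And>y. \<bar>f y - g y\<bar> \<le> c"
  shows "\<bar>E t f x - E t g x\<bar> \<le> c"
  using E_abs_le[of "\<lambda>y. f y - g y" c t x] assms by (simp add: E_diff)

lemma quotient_bounded: "bounded (range f) \<Longrightarrow> bounded (range (quotient h f))"
proof (erule bounded_rangeE)
  fix B assume B: "0 \<le> B" "\<And>x. \<bar>f x\<bar> \<le> B"
  have "\<bar>quotient h f x\<bar> \<le> (B + B) / \<bar>h\<bar>" for x
    unfolding quotient_def abs_divide
    using order_trans[OF abs_triangle_ineq4 add_mono[OF E_abs_le[OF B(2)] B(2)]] by (rule divide_right_mono) simp
  then show ?thesis by (rule bounded_rangeI)
qed

lemma E_quotient:
  assumes f: "bounded (range f)" and s: "0 \<le> s" and h: "0 < h"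
  shows "E s (quotient h f) x = (E (s + h) f x - E s f x) / h"
proof -
  have "E s (quotient h f) x = E s (\<lambda>y. E h f y - f y) x / h"
    by (simp add: E_def quotient_def[abs_def])
  then show ?thesis using f s h by (simp add: E_diff E_bounded E_add)
qed

lemma quotient_tendsto:
  assumes "bounded (range f)" and e: "0 < e"
  obtains d where "0 < d" "\<And>h x. 0 < h \<Longrightarrow> h < d \<Longrightarrow> \<bar>quotient h f x - L f x\<bar> < e"
proof -
  have "uniform_limit UNIV (\<lambda>t x. quotient t f x) (L f) (at_right 0)"
    using generator assms(1) by (simp add: has_generator_def quotient_def E_def)
  then have "eventually (\<lambda>t. \<forall>x\<in>UNIV. dist (quotient t f x) (L f x) < e) (at_right 0)"
    using e by (rule uniform_limitD)
  then show ?thesis using that by (auto simp: eventually_at_right_field dist_real_def)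
qed

text \<open>For short increments the difference quotient is within 1 of \<open>L f\<close>,
  uniformly in the site, and applying \<open>E s\<close> does not enlarge a uniform bound.\<close>

lemma E_lipschitz:
  assumes f: "bounded (range f)"
  obtains C d where "0 < C" "0 < d" "\<And>s t x. 0 \<le> s \<Longrightarrow> 0 \<le> t \<Longrightarrow> \<bar>t - s\<bar> < d \<Longrightarrow> \<bar>E t f x - E s f x\<bar> \<le> C * \<bar>t - s\<bar>"
proof -
  obtain d where d: "0 < d" "\<And>h x. 0 < h \<Longrightarrow> h < d \<Longrightarrow> \<bar>quotient h f x - L f x\<bar> < 1"
    using quotient_tendsto[OF f, of 1] by auto
  obtain B where B: "0 \<le> B" "\<And>x. \<bar>L f x\<bar> \<le> B" using bounded_rangeE[OF L_bounded[OF f]] by blast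
  have step: "\<bar>E t f x - E s f x\<bar> \<le> (B + 1) * (t - s)" if "0 \<le> s" "s < t" "t - s < d" for s t x
  proof -
    have "\<bar>quotient (t - s) f y\<bar> \<le> B + 1" for y
      using d(2)[of "t - s" y] B(2)[of y] that by auto
    then have "\<bar>E s (quotient (t - s) f) x\<bar> \<le> B + 1" by (rule E_abs_le)
    then show ?thesis using E_quotient[OF f, of s "t - s" x] that by (simp add: field_simps)
  qed
  have "\<bar>E t f x - E s f x\<bar> \<le> (B + 1) * \<bar>t - s\<bar>" if "0 \<le> s" "0 \<le> t" "\<bar>t - s\<bar> < d" for s t x
    using step[of s t x] step[of t s x] that by (cases s t rule: linorder_cases) (auto simp: abs_minus_commute)
  then show ?thesis using that[of "B + 1" d] B d by auto
qed

lemma continuous_E: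
  assumes f: "bounded (range f)"
  shows "continuous_on {0..} (\<lambda>t. E t f x)"
proof -
  obtain C d where C: "0 < C" "0 < d" "\<And>s t x. 0 \<le> s \<Longrightarrow> 0 \<le> t \<Longrightarrow> \<bar>t - s\<bar> < d \<Longrightarrow> \<bar>E t f x - E s f x\<bar> \<le> C * \<bar>t - s\<bar>"
    using E_lipschitz[OF f] by blast
  show ?thesis unfolding continuous_on_iff
  proof (intro ballI allI impI)
    fix s e :: real assume s: "s \<in> {0..}" and e: "0 < e"
    show "\<exists>d>0. \<forall>t\<in>{0..}. dist t s < d \<longrightarrow> dist (E t f x) (E s f x) < e"
    proof (intro exI[of _ "min d (e / C)"] conjI ballI impI)
      show "0 < min d (e / C)" using C e by simp
      fix t assume t: "t \<in> {0..}" "dist t s < min d (e / C)"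
      then have "C * \<bar>t - s\<bar> < e" using C(1) by (simp add: dist_real_def field_simps)
      moreover have "\<bar>E t f x - E s f x\<bar> \<le> C * \<bar>t - s\<bar>"
        using t s by (intro C(3)) (auto simp: dist_real_def)
      ultimately show "dist (E t f x) (E s f x) < e" by (simp add: dist_real_def)
    qed
  qed
qed

text \<open>The quotient between times \<open>y\<close> and \<open>t\<close> is the semigroup at the
  earlier of them, applied to a quotient at 0. This replaces the quotient by \<open>L f\<close> up
  to \<open>e / 2\<close>, and the Lipschitz bound for \<open>L f\<close> moves the earlier time to
  \<open>t\<close>.\<close>

lemma E_has_derivative:
  assumes f: "bounded (range f)" and t: "0 \<le> t"
  shows "((\<lambda>t. E t f x) has_real_derivative E t (L f) x) (at t within {0..})"
  unfolding has_field_derivative_iff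
proof (rule tendstoI)
  fix e :: real assume e: "0 < e"
  note Lf = L_bounded[OF f]
  obtain d where d: "0 < d" "\<And>h x. 0 < h \<Longrightarrow> h < d \<Longrightarrow> \<bar>quotient h f x - L f x\<bar> < e / 2"
    using quotient_tendsto[OF f, of "e / 2"] e by auto
  obtain C d' where C: "0 < C" "0 < d'" "\<And>s t x. 0 \<le> s \<Longrightarrow> 0 \<le> t \<Longrightarrow> \<bar>t - s\<bar> < d' \<Longrightarrow> \<bar>E t (L f) x - E s (L f) x\<bar> \<le> C * \<bar>t - s\<bar>"
    using E_lipschitz[OF Lf] by blast
  show "eventually (\<lambda>y. dist ((E y f x - E t f x) / (y - t)) (E t (L f) x) < e) (at t within {0..})"
    unfolding eventually_at
  proof (intro exI[of _ "min d (min d' (e / (2 * C)))"] conjI ballI impI)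
    show "0 < min d (min d' (e / (2 * C)))" using C d e by simp
    fix y assume y: "y \<in> {0..}" "y \<noteq> t \<and> dist y t < min d (min d' (e / (2 * C)))"
    \<comment> \<open>Taking the earlier time treats left and right derivatives together.\<close>
    define m where "m = min y t"
    define h where "h = \<bar>y - t\<bar>"
    have h: "0 < h" "h < d" "h < d'" "h < e / (2 * C)" using y by (auto simp: h_def dist_real_def)
    have m: "0 \<le> m" "\<bar>m - t\<bar> \<le> h" using y t by (auto simp: m_def h_def)
    have "(E y f x - E t f x) / (y - t) = E m (quotient h f) x"
    proof (cases "y < t")
      case True
      have "E m (quotient h f) x = (E t f x - E y f x) / (t - y)"
        using E_quotient[OF f m(1) h(1), of x] True by (simp add: m_def h_def)
      also have "\<dots> = (E y f x - E t f x) / (y - t)" using True by (simp add: field_simps)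
      finally show ?thesis by simp
    next
      case False
      then show ?thesis using E_quotient[OF f m(1) h(1), of x] y by (simp add: m_def h_def)
    qed
    moreover have "\<bar>E m (quotient h f) x - E m (L f) x\<bar> \<le> e / 2"
      using d(2)[OF h(1,2)] by (intro E_diff_le quotient_bounded f Lf) (auto intro: less_imp_le)
    moreover have "\<bar>E m (L f) x - E t (L f) x\<bar> < e / 2"
    proof -
      have "\<bar>E m (L f) x - E t (L f) x\<bar> \<le> C * \<bar>m - t\<bar>" using m h t by (intro C(3)) auto
      also have "\<dots> \<le> C * h" using m C(1) by (intro mult_left_mono) auto
      also have "\<dots> < e / 2" using h(4) C(1) by (simp add: field_simps)
      finally show ?thesis .
    qed
    ultimately show "dist ((E y f x - E t f x) / (y - t)) (E t (L f) x) < e" unfolding dist_real_def by linarith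
  qed
qed

text \<open>Difference quotients at 0 commute with the semigroup, and the uniform limit inherits
  this. It turns the derivative \<open>E t (L f)\<close> into the backward form
  \<open>L (E t f)\<close>, which is the one that conditions on the first jump.\<close>

lemma E_commute:
  assumes f: "bounded (range f)" and t: "0 \<le> t"
  shows "L (E t f) x = E t (L f) x"
proof -
  have "\<bar>L (E t f) x - E t (L f) x\<bar> \<le> e" if e: "0 < e" for e
  proof -
    obtain d where d: "0 < d" "\<And>h x. 0 < h \<Longrightarrow> h < d \<Longrightarrow> \<bar>quotient h f x - L f x\<bar> < e / 2"
      using quotient_tendsto[OF f, of "e / 2"] e by auto
    obtain d' where d': "0 < d'" "\<And>h x. 0 < h \<Longrightarrow> h < d' \<Longrightarrow> \<bar>quotient h (E t f) x - L (E t f) x\<bar> < e / 2"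
      using quotient_tendsto[OF E_bounded[OF f], of "e / 2" t] e by auto
    obtain h where h: "0 < h" "h < min d d'" using dense[of 0 "min d d'"] d d' by auto
    have "quotient h (E t f) x = E t (quotient h f) x"
      using E_add[of h t f x] E_quotient[OF f t h(1), of x] h t f by (simp add: quotient_def add.commute)
    moreover have "\<bar>E t (quotient h f) x - E t (L f) x\<bar> \<le> e / 2"
      using d(2)[of h] h by (intro E_diff_le quotient_bounded f L_bounded) (auto intro: less_imp_le)
    ultimately show ?thesis using d'(2)[of h x] h by linarith
  qed
  then have "\<bar>L (E t f) x - E t (L f) x\<bar> \<le> 0" by (rule field_le_epsilon) simp
  then show ?thesis by simp
qed

end

section \<open>Uniqueness of the walk\<close>

definition jump_generator :: "'d::finite site pmf \<Rightarrow> ('d site \<Rightarrow> real) \<Rightarrow> ('d site \<Rightarrow> real) \<Rightarrow> 'd site \<Rightarrow> real" where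
  "jump_generator q r f x = r x * (measure_pmf.expectation q (\<lambda>e. f (x + e)) - f x)"

lemma measure_exp1_atMost: "0 \<le> c \<Longrightarrow> measure exp1 {..c} = 1 - exp (- c)"
proof -
  assume "0 \<le> c"
  interpret prob_space exp1 by (rule prob_space_exp1)
  show ?thesis using exponential_distributedD_le[OF distributed_exp1 \<open>0 \<le> c\<close>] by (simp add: atMost_def)
qed

text \<open>The backward equation in integrated form, with time measured by the clock: at a site
  with finite waiting time \<open>w\<close>, clock value \<open>v\<close> corresponds to time
  \<open>v * w\<close>. At a site of rate 0 the backward derivative vanishes, so the semigroup is
  constant in time there.\<close>

lemma jump_semigroup_first_step:
  fixes q :: "'d::finite site pmf"
  assumes W: "\<And>z. 1 \<le> W z" and T: "transition_semigroup T" "has_generator T (jump_generator q (rate W))"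
    and f: "\<And>x. \<bar>f x\<bar> \<le> B" and t: "0 \<le> t"
  shows "(\<lambda>z. indicator {..rate W x * t} (snd z) * measure_pmf.expectation (T (t - snd z * enn2real (W x)) (x + fst z)) f) \<in> borel_measurable (measure_pmf q \<Otimes>\<^sub>M exp1)" (is ?meas)
    and "measure_pmf.expectation (T t x) f = exp (- (rate W x * t)) * f x +
      (\<integral>z. indicator {..rate W x * t} (snd z) * measure_pmf.expectation (T (t - snd z * enn2real (W x)) (x + fst z)) f \<partial>(measure_pmf q \<Otimes>\<^sub>M exp1))" (is ?eq)
proof -
  interpret bounded_semigroup T "jump_generator q (rate W)"
  proof
    fix h :: "'d site \<Rightarrow> real" assume "bounded (range h)"
    then obtain B where B: "\<And>x. \<bar>h x\<bar> \<le> B" by (auto simp: bounded_iff)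
    have "\<bar>jump_generator q (rate W) h x\<bar> \<le> 1 * (B + B)" for x
      unfolding jump_generator_def abs_mult using rate_nonneg[of W x] rate_le_1[of W x, OF W]
      by (intro mult_mono order_trans[OF abs_triangle_ineq4] add_mono B measure_pmf.abs_expectation_le) auto
    then show "bounded (range (jump_generator q (rate W) h))" by (auto simp: bounded_iff)
  qed (fact T)+
  let ?X = "measure_pmf q \<Otimes>\<^sub>M exp1"
  interpret U: prob_space exp1 by (rule prob_space_exp1)
  interpret P: pair_prob_space "measure_pmf q" exp1 ..
  have bf: "bounded (range f)" using f by (rule bounded_rangeI)
  define w where "w = enn2real (W x)"
  define c where "c = rate W x * t"
  have c0: "0 \<le> c" using t rate_nonneg[of W x] by (simp add: c_def)
  have wc: "c * w \<le> t" and w0: "0 \<le> w"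
    using W[of x] t by (auto simp: c_def w_def elim!: rate_cases)
  have nonneg: "0 \<le> t - v * w" if "v \<le> c" for v
    using mult_right_mono[OF that w0] wc by simp
  let ?k = "\<lambda>e v. indicator {..c} v * E (t - v * w) f (x + e)"
  have k_meas: "(\<lambda>z. ?k (fst z) (snd z)) \<in> borel_measurable ?X"
  proof (rule measurable_compose_countable[of "\<lambda>e z. ?k e (snd z)" _ _ fst])
    fix e
    have "continuous_on {..c} (\<lambda>v. E (t - v * w) f (x + e))"
      by (rule continuous_on_compose2[OF continuous_E[OF bf]]) (auto intro!: continuous_intros nonneg)
    then have "(\<lambda>v. indicator {..c} v *\<^sub>R E (t - v * w) f (x + e)) \<in> borel_measurable borel"
      by (rule borel_measurable_continuous_on_indicator[rotated]) simp
    then have "?k e \<in> borel_measurable exp1" by (simp cong: measurable_cong_sets)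
    from measurable_compose[OF measurable_snd this] show "(\<lambda>z. ?k e (snd z)) \<in> borel_measurable ?X" .
  qed (rule measurable_fst_site)
  then show ?meas by (simp add: c_def w_def E_def)
  have kB: "\<bar>?k e v\<bar> \<le> B" for e v
    using E_abs_le[of f B "t - v * w" "x + e", OF f] by (auto simp: indicator_def)
  have "integrable ?X (\<lambda>z. ?k (fst z) (snd z))"
    by (rule P.P.integrable_const_bound[where B=B]) (use kB k_meas in auto)
  then have "(\<integral>z. ?k (fst z) (snd z) \<partial>?X) = (\<integral>v. (\<integral>e. ?k e v \<partial>measure_pmf q) \<partial>exp1)"
    using P.integral_snd[of ?k] by (simp add: split_beta')
  also have "\<dots> = (\<integral>v. exponential_density 1 v * (indicator {..c} v * (\<integral>e. E (t - v * w) f (x + e) \<partial>measure_pmf q)) \<partial>lborel)"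
  proof -
    have "(\<lambda>v. \<integral>e. ?k e v \<partial>measure_pmf q) \<in> borel_measurable exp1"
      by (rule measure_pmf.borel_measurable_lebesgue_integral)
         (use measurable_compose[OF measurable_pair_swap' k_meas] in \<open>simp add: split_beta'\<close>)
    then show ?thesis unfolding exp1_def
      by (subst integral_real_density) (auto simp: exponential_density_nonneg exp1_def)
  qed
  finally have int_eq: "(\<integral>z. ?k (fst z) (snd z) \<partial>?X) =
      (\<integral>v. exponential_density 1 v * (indicator {..c} v * (\<integral>e. E (t - v * w) f (x + e) \<partial>measure_pmf q)) \<partial>lborel)" .
  from W[of x] have main: "E t f x = exp (- c) * f x + (\<integral>z. ?k (fst z) (snd z) \<partial>?X)"
  proof (cases rule: rate_cases)
    case 1
    have "((\<lambda>t. E t f x) has_real_derivative 0) (at s within {0..})" if "s \<in> {0..}" for s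
      using E_has_derivative[OF bf, of s x] E_commute[OF bf, of s x] that 1 by (simp add: jump_generator_def)
    then have "\<exists>k. \<forall>s\<in>{0..}. E s f x = k"
      by (intro has_field_derivative_zero_constant) auto
    then have "E t f x = E 0 f x" using t by (metis atLeast_iff order_refl)
    moreover have "(\<integral>z. ?k (fst z) (snd z) \<partial>?X) = (\<integral>z. 0 \<partial>?X)"
      using AE_clock_pos[of q] k_meas 1 by (intro integral_cong_AE) (auto simp: c_def elim!: eventually_mono)
    ultimately show ?thesis using 1 by (simp add: c_def)
  next
    case (2 w')
    have w: "w = w'" "1 \<le> w" and r: "rate W x = 1 / w" and cw: "c * w = t" using 2 by (auto simp: w_def c_def)
    \<comment> \<open>An antiderivative in the clock variable. In its derivative \<open>G\<close>,
      \<open>w\<close> times the generator is the mean over the neighbours minus the value at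
      \<open>x\<close>, because the rate is \<open>1 / w\<close>; the value at \<open>x\<close>
      cancels and the exponential density times the neighbour mean remains.\<close>
    define F where "F v = - (exp (- v) * E (t - v * w) f x)" for v
    define G where "G v = exp (- v) * (E (t - v * w) f x + w * E (t - v * w) (jump_generator q (rate W) f) x)" for v
    have nn: "0 \<le> t - v * w" if "v \<in> {0..c}" for v using that nonneg by simp
    have deriv: "(F has_real_derivative G v) (at v within {0..c})" if v: "v \<in> {0..c}" for v
    proof -
      have sub: "(\<lambda>v. t - v * w) ` {0..c} \<subseteq> {0..}" using nn by auto
      have d1: "((\<lambda>v. t - v * w) has_real_derivative - w) (at v within {0..c})"
        by (auto intro!: derivative_eq_intros)
      have d2: "((\<lambda>s. E s f x) has_real_derivative E (t - v * w) (jump_generator q (rate W) f) x) (at (t - v * w) within (\<lambda>v. t - v * w) ` {0..c})"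
        by (rule has_field_derivative_subset[OF E_has_derivative[OF bf nn[OF v]] sub])
      have "((\<lambda>v. E (t - v * w) f x) has_real_derivative E (t - v * w) (jump_generator q (rate W) f) x * - w) (at v within {0..c})"
        using DERIV_image_chain[OF d2 d1] by (simp add: o_def)
      then show ?thesis unfolding F_def G_def
        by (auto intro!: derivative_eq_intros simp: algebra_simps)
    qed
    have cont: "continuous_on {0..c} G"
      unfolding G_def
      by (intro continuous_intros continuous_on_compose2[OF continuous_E[OF bf]]
           continuous_on_compose2[OF continuous_E[OF L_bounded[OF bf]]]) (use nn in auto)
    have "(\<integral>v. indicator {0..c} v *\<^sub>R G v \<partial>lborel) = F c - F 0"
      by (rule integral_FTC_Icc[OF c0 _ cont]) (use deriv in \<open>auto simp: has_real_derivative_iff_has_vector_derivative\<close>)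
    also have "F c - F 0 = E t f x - exp (- c) * f x" unfolding F_def by (simp add: cw)
    also have "(\<lambda>v. indicator {0..c} v *\<^sub>R G v) =
        (\<lambda>v. exponential_density 1 v * (indicator {..c} v * (\<integral>e. E (t - v * w) f (x + e) \<partial>measure_pmf q)))"
    proof
      fix v
      show "indicator {0..c} v *\<^sub>R G v = exponential_density 1 v * (indicator {..c} v * (\<integral>e. E (t - v * w) f (x + e) \<partial>measure_pmf q))"
      proof (cases "v \<in> {0..c}")
        case True
        have "w * E (t - v * w) (jump_generator q (rate W) f) x = (\<integral>e. E (t - v * w) f (x + e) \<partial>measure_pmf q) - E (t - v * w) f x"
          unfolding E_commute[OF bf nn[OF True], symmetric] jump_generator_def r using w by simp
        then show ?thesis using True by (simp add: G_def exponential_density_def)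
      qed (auto simp: exponential_density_def)
    qed
    finally show ?thesis unfolding int_eq by simp
  qed
  then show ?eq by (simp add: c_def w_def E_def)
qed

fun chain_prob :: "(real \<Rightarrow> 's \<Rightarrow> 's pmf) \<Rightarrow> (real \<times> 's) list \<Rightarrow> 's \<Rightarrow> real" where
  "chain_prob T [] x = 1"
| "chain_prob T ((d, y) # ts) x = pmf (T d x) y * chain_prob T ts y"

text \<open>
  On a time interval \<open>[0, t0]\<close> the first-step equation is a contraction of ratio
  \<open>1 - exp (- t0)\<close> for the supremum norm, because jump rates are at most \<open>1\<close>.
\<close>

lemma first_step_unique:
  fixes q :: "'d::finite site pmf" and D :: "real \<Rightarrow> 'd site \<Rightarrow> real"
  assumes W: "\<And>z. 1 \<le> W z" and bnd: "\<And>t x. \<bar>D t x\<bar> \<le> B"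
    and meas: "\<And>t x. 0 \<le> t \<Longrightarrow> (\<lambda>z. indicator {..rate W x * t} (snd z) * D (t - snd z * enn2real (W x)) (x + fst z)) \<in> borel_measurable (measure_pmf q \<Otimes>\<^sub>M exp1)"
    and eq: "\<And>t x. 0 \<le> t \<Longrightarrow> D t x = (\<integral>z. indicator {..rate W x * t} (snd z) * D (t - snd z * enn2real (W x)) (x + fst z) \<partial>(measure_pmf q \<Otimes>\<^sub>M exp1))"
    and t: "0 \<le> t"
  shows "D t x = 0"
proof -
  let ?X = "measure_pmf q \<Otimes>\<^sub>M exp1"
  interpret X: prob_space ?X by (rule prob_space_step_clock)
  interpret U: prob_space exp1 by (rule prob_space_exp1)
  define \<rho> where "\<rho> = 1 - exp (- t)"
  have \<rho>: "0 \<le> \<rho>" "\<rho> < 1" using t by (auto simp: \<rho>_def)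
  have B0: "0 \<le> B" using bnd[of 0 undefined] by simp
  have iter: "\<bar>D s x\<bar> \<le> B * \<rho> ^ n" if "0 \<le> s" "s \<le> t" for s x n
    using that
  proof (induction n arbitrary: s x)
    case 0
    then show ?case using bnd by simp
  next
    case (Suc n)
    define c where "c = rate W x * s"
    have c0: "0 \<le> c" using Suc.prems rate_nonneg[of W x] by (simp add: c_def)
    have ct: "c \<le> t"
    proof -
      have "c \<le> 1 * s" unfolding c_def using Suc.prems rate_le_1[of W x, OF W] by (intro mult_right_mono) auto
      then show ?thesis using Suc.prems by simp
    qed
    let ?k = "\<lambda>z. indicator {..c} (snd z) * D (s - snd z * enn2real (W x)) (x + fst z)"
    have k: "AE z in ?X. \<bar>?k z\<bar> \<le> indicator {..c} (snd z) * (B * \<rho> ^ n)"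
      using AE_clock_pos
    proof eventually_elim
      case (elim z)
      \<comment> \<open>The remaining time stays in \<open>[0, s]\<close>: its sign comes from
        \<open>snd z \<le> c\<close>, its upper bound from the positivity of the clock.\<close>
      have "\<bar>D (s - snd z * enn2real (W x)) (x + fst z)\<bar> \<le> B * \<rho> ^ n" if "snd z \<le> c"
      proof (rule Suc.IH)
        have "c * enn2real (W x) \<le> s" using W[of x] Suc.prems by (auto simp: c_def elim!: rate_cases)
        then show "0 \<le> s - snd z * enn2real (W x)"
          using mult_right_mono[OF that, of "enn2real (W x)"] by simp
        have "0 \<le> snd z * enn2real (W x)" using elim by simp
        then show "s - snd z * enn2real (W x) \<le> t" using Suc.prems by linarith
      qed
      then show ?case by (auto simp: indicator_def)
    qed
    have m: "?k \<in> borel_measurable ?X" using meas[of s x] Suc.prems by (simp add: c_def)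
    have ind_meas [measurable]: "(\<lambda>z. indicator {..c} (snd z) :: real) \<in> borel_measurable ?X"
      by measurable
    have "\<bar>D s x\<bar> = \<bar>\<integral>z. ?k z \<partial>?X\<bar>" using eq[of s x] Suc.prems by (simp add: c_def)
    also have "\<dots> \<le> (\<integral>z. \<bar>?k z\<bar> \<partial>?X)" by (rule integral_abs_bound)
    also have "\<dots> \<le> (\<integral>z. indicator {..c} (snd z) * (B * \<rho> ^ n) \<partial>?X)"
    proof (rule integral_mono_AE[OF _ _ k])
      show "integrable ?X (\<lambda>z. \<bar>?k z\<bar>)"
        by (rule integrable_abs, rule X.integrable_const_bound[where B=B])
           (use m bnd in \<open>auto simp: indicator_def B0\<close>)
      show "integrable ?X (\<lambda>z. indicator {..c} (snd z) * (B * \<rho> ^ n))"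
        by (rule X.integrable_const_bound[where B="B * \<rho> ^ n"]) (use B0 \<rho> in \<open>auto simp: indicator_def\<close>)
    qed
    also have "\<dots> = (1 - exp (- c)) * (B * \<rho> ^ n)"
    proof -
      interpret P: pair_prob_space "measure_pmf q" exp1 ..
      have i: "integrable ?X (\<lambda>z. indicator {..c} (snd z) :: real)"
        by (rule X.integrable_const_bound[where B=1]) (auto simp: indicator_def)
      have "(\<integral>z. indicat_real {..c} (snd z) \<partial>?X) = (\<integral>e. (\<integral>v. indicat_real {..c} v \<partial>exp1) \<partial>measure_pmf q)"
        using P.integral_fst'[OF i] by simp
      also have "\<dots> = 1 - exp (- c)" using measure_exp1_atMost[OF c0] by (simp add: measure_pmf.prob_space[simplified])
      finally show ?thesis by simp
    qed
    also have "\<dots> \<le> \<rho> * (B * \<rho> ^ n)" using ct B0 \<rho> by (intro mult_right_mono) (auto simp: \<rho>_def)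
    finally show ?case by (simp add: algebra_simps)
  qed
  have "(\<lambda>n. B * \<rho> ^ n) \<longlonglongrightarrow> B * 0" using \<rho> by (intro tendsto_mult tendsto_const LIMSEQ_realpow_zero)
  then have "\<bar>D t x\<bar> \<le> B * 0" by (rule LIMSEQ_le_const) (use iter[OF t order_refl] in auto)
  then show ?thesis by simp
qed

text \<open>Induction on the list. With \<open>y\<close> and \<open>ts\<close> fixed, the walk
  probability and the transition probability times the constant \<open>c\<close> of the remaining
  increments solve the same first-jump equation; the inhomogeneous terms agree because
  \<open>of_bool (x = y)\<close> only lets \<open>x = y\<close> through. Their difference solves the
  homogeneous equation.\<close>

theorem walk_prob_eq_chain_prob:
  fixes q :: "'d::finite site pmf"
  assumes W: "\<And>z. 1 \<le> W z" and T: "transition_semigroup T" "has_generator T (jump_generator q (rate W))"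
    and ts: "\<forall>z\<in>set ts. 0 \<le> fst z"
  shows "walk_prob q W ts x = chain_prob T ts x"
  using ts
proof (induction ts arbitrary: x)
  case (Cons a ts)
  obtain d y where a: "a = (d, y)" by (cases a)
  let ?X = "measure_pmf q \<Otimes>\<^sub>M exp1"
  interpret X: prob_space ?X by (rule prob_space_step_clock)
  define c where "c = chain_prob T ts y"
  have IH: "walk_prob q W ts z = chain_prob T ts z" for z using Cons by simp
  have c: "c = walk_prob q W ts y" by (simp add: c_def IH)
  have c01: "0 \<le> c" "c \<le> 1" unfolding c by (rule walk_prob_nonneg walk_prob_le_1)+
  define U where "U t x = walk_prob q W ((t, y) # ts) x" for t x
  define V where "V t x = pmf (T t x) y" for t x
  have V_eq: "V t x = measure_pmf.expectation (T t x) (indicator {y})" for t x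
    by (simp add: V_def measure_pmf_single)
  have Vb: "0 \<le> V t x" "V t x \<le> 1" for t x by (auto simp: V_def pmf_le_1)
  have Ub: "0 \<le> U t x" "U t x \<le> 1" for t x unfolding U_def by (rule walk_prob_nonneg walk_prob_le_1)+
  have fst_meas [measurable]: "(\<lambda>z. x + fst z) \<in> ?X \<rightarrow>\<^sub>M count_space UNIV" for x
    using measurable_compose[OF measurable_fst_site[of q], of "\<lambda>e. x + e" "count_space UNIV"] by simp
  have snd_meas [measurable]: "snd \<in> borel_measurable ?X"
    using measurable_snd[of "measure_pmf q" exp1] by (simp cong: measurable_cong_sets)
  let ?int = "\<lambda>Z t x z. indicator {..rate W x * t} (snd z) * Z (t - snd z * enn2real (W x)) (x + fst z) :: real"
  have U_meas: "(\<lambda>z. ?int U t x z) \<in> borel_measurable ?X" for t x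
  proof -
    have [measurable]: "(\<lambda>z. U (t - snd z * enn2real (W x)) (x + fst z)) \<in> borel_measurable ?X"
      unfolding U_def by (rule measurable_walk_prob) measurable
    show ?thesis by measurable
  qed
  have V_meas: "(\<lambda>z. ?int V t x z) \<in> borel_measurable ?X" if "0 \<le> t" for t x
    unfolding V_eq by (rule jump_semigroup_first_step(1)[where W=W and T=T and q=q and B=1, OF W T _ that]) (auto simp: indicator_def)
  have int: "integrable ?X (\<lambda>z. ?int Z t x z)"
    if "(\<lambda>z. ?int Z t x z) \<in> borel_measurable ?X" "\<And>t x. 0 \<le> Z t x" "\<And>t x. Z t x \<le> 1" for Z t x
    by (rule X.integrable_const_bound[where B=1]) (use that in \<open>auto simp: indicator_def\<close>)
  have U_step: "U t x = exp (- (rate W x * t)) * (of_bool (x = y) * c) + (\<integral>z. ?int U t x z \<partial>?X)" if t: "0 \<le> t" for t x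
  proof -
    have "ennreal (U t x) = ennreal (exp (- (rate W x * t)) * (of_bool (x = y) * walk_prob q W ts x)) +
        (\<integral>\<^sup>+z. ennreal (?int U t x z) \<partial>?X)"
      unfolding U_def using walk_prob_first_step[of W t ts q y x, OF W t] Cons.prems
      by (simp add: indicator_mult_ennreal[symmetric] ennreal_mult walk_prob_nonneg)
    also have "(\<integral>\<^sup>+z. ennreal (?int U t x z) \<partial>?X) = ennreal (\<integral>z. ?int U t x z \<partial>?X)"
      by (rule nn_integral_eq_integral[OF int[OF U_meas Ub]]) (auto simp: Ub)
    also have "of_bool (x = y) * walk_prob q W ts x = of_bool (x = y) * c" by (simp add: c)
    finally have "ennreal (U t x) = ennreal (exp (- (rate W x * t)) * (of_bool (x = y) * c)) + ennreal (\<integral>z. ?int U t x z \<partial>?X)" .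
    moreover have "0 \<le> exp (- (rate W x * t)) * (of_bool (x = y) * c)" using c01 by simp
    moreover have "0 \<le> (\<integral>z. ?int U t x z \<partial>?X)" by (intro Bochner_Integration.integral_nonneg) (simp add: Ub)
    ultimately show ?thesis using Ub[of t x]
      by (simp only: ennreal_plus[symmetric] ennreal_inj add_nonneg_nonneg)
  qed
  have V_step: "V t x = exp (- (rate W x * t)) * of_bool (x = y) + (\<integral>z. ?int V t x z \<partial>?X)" if t: "0 \<le> t" for t x
    using jump_semigroup_first_step(2)[where W=W and T=T and q=q and B=1 and f="indicator {y}" and x=x, OF W T _ t]
    by (simp add: V_eq indicator_def of_bool_def)
  have "U d x - V d x * c = 0"
  proof (rule first_step_unique[where D="\<lambda>t x. U t x - V t x * c" and B=1 and q=q and W=W, OF W])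
    show "0 \<le> d" using Cons.prems by (simp add: a)
    show "\<bar>U t x - V t x * c\<bar> \<le> 1" for t x
    proof -
      have "0 \<le> V t x * c" "V t x * c \<le> 1" using Vb c01 by (auto intro: mult_le_one)
      then show ?thesis using Ub[of t x] by auto
    qed
    fix t :: real and x :: "'d site" assume t: "0 \<le> t"
    have split: "?int (\<lambda>t x. U t x - V t x * c) t x z = ?int U t x z - ?int V t x z * c" for z
      by (simp add: algebra_simps)
    show "(\<lambda>z. ?int (\<lambda>t x. U t x - V t x * c) t x z) \<in> borel_measurable ?X"
      unfolding split using U_meas[of x t] V_meas[OF t, of x] by measurable
    have "(\<integral>z. ?int U t x z - ?int V t x z * c \<partial>?X) = (\<integral>z. ?int U t x z \<partial>?X) - (\<integral>z. ?int V t x z \<partial>?X) * c"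
      using int[OF U_meas Ub] int[OF V_meas[OF t] Vb] by simp
    then show "U t x - V t x * c = (\<integral>z. ?int (\<lambda>t x. U t x - V t x * c) t x z \<partial>?X)"
      unfolding split using U_step[OF t, of x] V_step[OF t, of x] by (simp add: algebra_simps)
  qed
  then show ?case by (simp add: a U_def V_def c_def)
qed simp

section \<open>Finite-dimensional distributions\<close>

lemma path_cyl_append:
  "path_cyl (ts @ [(d, y)]) Y \<longleftrightarrow> path_cyl ts Y \<and> Y (sum_list (map fst ts) + d) = y"
proof (induction ts arbitrary: Y)
  case (Cons z ts)
  then show ?case by (cases z) (simp add: add.assoc)
qed simp

lemma path_cyl_iff:
  "path_cyl ts Y \<longleftrightarrow> (\<forall>i<length ts. Y (sum_list (map fst (take (Suc i) ts))) = snd (ts ! i))"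
proof (induction ts arbitrary: Y)
  case (Cons z ts)
  then show ?case by (cases z) (simp add: All_less_Suc2)
qed simp

lemma chain_prob_append:
  "chain_prob T (ts @ [(d, y)]) x = chain_prob T ts x * pmf (T d (last (x # map snd ts))) y"
proof (induction ts arbitrary: x)
  case (Cons z ts)
  then show ?case by (cases z) (simp add: mult.assoc)
qed simp

text \<open>Times are added in increasing order. The induction also records that the increments sum
  to a time already present, or to 0, so the next increment is nonnegative.\<close>

lemma exists_path_cyl:
  fixes J :: "real set"
  assumes "finite J" "J \<subseteq> {0..}"
  shows "\<exists>ts. (\<forall>z\<in>set ts. 0 \<le> fst z) \<and> sum_list (map fst ts) \<in> insert 0 J \<and> (\<forall>Y. path_cyl ts Y \<longleftrightarrow> (\<forall>t\<in>J. Y t = x t))"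
  using assms
proof (induction J rule: finite_linorder_max_induct)
  case empty
  then show ?case by (intro exI[of _ "[]"]) simp
next
  case (insert b J)
  then obtain ts where ts: "\<forall>z\<in>set ts. 0 \<le> fst z" "sum_list (map fst ts) \<in> insert 0 J"
    "\<And>Y. path_cyl ts Y \<longleftrightarrow> (\<forall>t\<in>J. Y t = x t)" by auto
  have "sum_list (map fst ts) \<le> b" using ts(2) insert by (auto intro: less_imp_le)
  then show ?case using ts by (intro exI[of _ "ts @ [(b - sum_list (map fst ts), x b)]"]) (auto simp: path_cyl_append)
qed

text \<open>The product space without any continuity: for a stream that violates
  \<open>non_explosive\<close> the least index may be unspecified, so the constructed path is not
  claimed to be right-continuous, and laws are compared here.\<close>

definition paths :: "(real \<Rightarrow> 's) measure" where
  "paths = PiM {0..} (\<lambda>_. count_space UNIV)"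

definition point_cyl :: "real set \<Rightarrow> (real \<Rightarrow> 's) \<Rightarrow> (real \<Rightarrow> 's) set" where
  "point_cyl J x = {Y \<in> space paths. \<forall>t\<in>J. Y t = x t}"

text \<open>The empty set is added for intersections of cylinders that prescribe conflicting
  values.\<close>

definition point_cyls :: "(real \<Rightarrow> 's) set set" where
  "point_cyls = insert {} {point_cyl J x | J x. finite J \<and> J \<subseteq> {0..}}"

lemma space_paths: "space paths = {0..} \<rightarrow>\<^sub>E UNIV"
  by (simp add: paths_def space_PiM)

lemma measurable_paths_component [measurable]: "0 \<le> t \<Longrightarrow> (\<lambda>Y. Y t) \<in> paths \<rightarrow>\<^sub>M count_space UNIV"
  unfolding paths_def by (rule measurable_component_singleton) simp

lemma sets_point_cyl: "finite J \<Longrightarrow> J \<subseteq> {0..} \<Longrightarrow> point_cyl J x \<in> sets paths"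
  unfolding point_cyl_def
proof (intro sets.sets_Collect_finite_All)
  fix t assume "t \<in> J" "J \<subseteq> {0..}"
  then have [measurable]: "(\<lambda>Y. Y t) \<in> paths \<rightarrow>\<^sub>M count_space (UNIV :: 'a set)" by auto
  show "{Y \<in> space paths. Y t = x t} \<in> sets paths" by measurable
qed

lemma Int_stable_point_cyls: "Int_stable point_cyls"
proof (rule Int_stableI)
  fix A B :: "(real \<Rightarrow> 'a) set" assume "A \<in> point_cyls" "B \<in> point_cyls"
  then consider "A \<inter> B = {}" | J x J' x' where "A = point_cyl J x" "B = point_cyl J' x'" "finite J" "finite J'" "J \<subseteq> {0..}" "J' \<subseteq> {0..}"
    unfolding point_cyls_def by auto
  then show "A \<inter> B \<in> point_cyls"
  proof cases
    case 1
    then show ?thesis by (simp add: point_cyls_def)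
  next
    case 2
    show ?thesis
    proof (cases "\<forall>t\<in>J \<inter> J'. x t = x' t")
      case True
      then have "A \<inter> B = point_cyl (J \<union> J') (\<lambda>t. if t \<in> J then x t else x' t)"
        unfolding 2 point_cyl_def by (auto split: if_splits)
      then show ?thesis using 2 unfolding point_cyls_def by blast
    next
      case False
      then have "A \<inter> B = {}" unfolding 2 point_cyl_def by auto
      then show ?thesis by (simp add: point_cyls_def)
    qed
  qed
qed

text \<open>The state space is countable, so an event on one coordinate is a countable union of
  cylinders that prescribe its value.\<close>

lemma sets_paths: "sets paths = sigma_sets (space paths) (point_cyls :: (real \<Rightarrow> 's::countable) set set)"
proof (rule antisym)
  let ?S = "sigma_sets (space paths) (point_cyls :: (real \<Rightarrow> 's) set set)"
  interpret sigma_algebra "space paths" ?S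
    by (rule sigma_algebra_sigma_sets) (auto simp: point_cyls_def point_cyl_def)
  have "sets paths = sigma_sets ({0..} \<rightarrow>\<^sub>E UNIV) {{f \<in> {0..} \<rightarrow>\<^sub>E UNIV. f i \<in> A} | i (A :: 's set). i \<in> {0::real..}}"
    unfolding paths_def sets_PiM_single by simp
  also have "\<dots> \<subseteq> ?S" unfolding space_paths[symmetric]
  proof (rule sigma_sets_mono, rule subsetI)
    fix X assume "X \<in> {{f \<in> space paths. f i \<in> A} | i (A :: 's set). i \<in> {0::real..}}"
    then obtain i and A :: "'s set" where i: "i \<in> {0..}" and X: "X = {f \<in> space paths. f i \<in> A}" by auto
    have "{f \<in> space paths. f i \<in> A} = (\<Union>a\<in>A. point_cyl {i} (\<lambda>_. a))" by (auto simp: point_cyl_def)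
    also have "\<dots> \<in> ?S"
      using i by (intro countable_UN' image_subsetI sigma_sets.Basic) (auto simp: point_cyls_def)
    finally show "X \<in> ?S" unfolding X .
  qed
  finally show "sets paths \<subseteq> ?S" .
  show "?S \<subseteq> sets paths"
    by (rule sets.sigma_sets_subset) (auto simp: point_cyls_def intro: sets_point_cyl)
qed

lemma paths_measure_eqI:
  fixes M N :: "(real \<Rightarrow> 's::countable) measure"
  assumes M: "prob_space M" "sets M = sets paths" and N: "prob_space N" "sets N = sets paths"
    and eq: "\<And>ts. \<forall>z\<in>set ts. 0 \<le> fst z \<Longrightarrow> measure M {Y \<in> space paths. path_cyl ts Y} = measure N {Y \<in> space paths. path_cyl ts Y}"
  shows "M = N"
proof (rule measure_eqI_generator_eq[where E=point_cyls and \<Omega>="space paths" and A="\<lambda>_. space paths"])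
  interpret M: prob_space M by fact
  interpret N: prob_space N by fact
  have sp: "space M = space paths" "space N = space paths" using M N by (auto dest: sets_eq_imp_space_eq)
  show "emeasure M X = emeasure N X" if "X \<in> point_cyls" for X
  proof (cases "X = {}")
    case False
    then obtain J x where J: "X = point_cyl J x" "finite J" "J \<subseteq> {0..}" using \<open>X \<in> point_cyls\<close> by (auto simp: point_cyls_def)
    obtain ts where ts: "\<forall>z\<in>set ts. 0 \<le> fst z" "\<And>Y. path_cyl ts Y \<longleftrightarrow> (\<forall>t\<in>J. Y t = x t)"
      using exists_path_cyl[OF J(2,3), of x] by auto
    have "X = {Y \<in> space paths. path_cyl ts Y}" by (simp add: J(1) ts(2) point_cyl_def)
    then show ?thesis using eq[OF ts(1)] by (simp add: M.emeasure_eq_measure N.emeasure_eq_measure)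
  qed simp
  show "Int_stable point_cyls" by (rule Int_stable_point_cyls)
  show "point_cyls \<subseteq> Pow (space paths)" by (auto simp: point_cyls_def point_cyl_def)
  show "sets M = sigma_sets (space paths) point_cyls" "sets N = sigma_sets (space paths) point_cyls"
    using M N by (simp_all add: sets_paths)
  have "space paths = point_cyl {} undefined" by (simp add: point_cyl_def)
  then show "range (\<lambda>_. space paths) \<subseteq> point_cyls" unfolding point_cyls_def by blast
  show "emeasure M (space paths) \<noteq> \<infinity>" using sp by simp
qed auto

lemma path_space_measurable: "(\<lambda>Y. Y) \<in> path_space \<rightarrow>\<^sub>M paths"
  unfolding path_space_def paths_def by (rule measurable_restrict_space1) simp

lemma space_path_space: "space path_space = {Y \<in> space paths. \<forall>t\<ge>0. continuous (at_right t) Y}"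
  by (auto simp: path_space_def space_restrict_space paths_def)

text \<open>The Markov property adds one time at the end of the list. The event
  \<open>Y 0 = x0\<close> is carried along so that there is a conditioning time even when the list
  is empty.\<close>

lemma markov_chain_law_chain_prob:
  fixes Q :: "(real \<Rightarrow> 's::{topological_space, countable}) measure"
  assumes Q: "prob_space Q" "sets Q = sets path_space" "AE Y in Q. Y 0 = x0"
    and markov: "\<And>(n::nat) (s :: nat \<Rightarrow> real) (x :: nat \<Rightarrow> 's) t y.
           0 \<le> s 0 \<Longrightarrow> mono_on {..n} s \<Longrightarrow> s n \<le> t \<Longrightarrow>
           \<P>(Y in Q. (\<forall>i\<le>n. Y (s i) = x i) \<and> Y t = y) =
           \<P>(Y in Q. \<forall>i\<le>n. Y (s i) = x i) * pmf (T (t - s n) (x n)) y"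
    and ts: "\<forall>z\<in>set ts. 0 \<le> fst z"
  shows "\<P>(Y in Q. Y 0 = x0 \<and> path_cyl ts Y) = chain_prob T ts x0"
  using ts
proof (induction ts rule: rev_induct)
  case Nil
  interpret prob_space Q by fact
  have [measurable]: "(\<lambda>Y. Y 0) \<in> Q \<rightarrow>\<^sub>M count_space UNIV"
    using measurable_compose[OF path_space_measurable measurable_paths_component[of 0]] measurable_cong_sets[OF Q(2) refl] by blast
  have "{Y \<in> space Q. Y 0 = x0} \<in> sets Q" by measurable
  then show ?case using prob_Collect_eq_1 Q(3) by simp
next
  case (snoc z ts)
  obtain d y where z: "z = (d, y)" by (cases z)
  \<comment> \<open>Index 0 stands for time 0 and the state \<open>x0\<close>; the entries of the
    list follow, shifted by one.\<close>
  define s where "s i = sum_list (map fst (take i ts))" for i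
  define x where "x i = (if i = 0 then x0 else snd (ts ! (i - 1)))" for i
  let ?n = "length ts"
  have ev: "(\<forall>i\<le>?n. Y (s i) = x i) \<longleftrightarrow> Y 0 = x0 \<and> path_cyl ts Y" for Y
  proof -
    have "(\<forall>i\<le>?n. Y (s i) = x i) \<longleftrightarrow> (\<forall>i<Suc ?n. Y (s i) = x i)" by (simp add: less_Suc_eq_le)
    also have "\<dots> \<longleftrightarrow> Y 0 = x0 \<and> (\<forall>i<?n. Y (s (Suc i)) = x (Suc i))"
      unfolding All_less_Suc2 by (simp add: s_def x_def)
    finally show ?thesis unfolding path_cyl_iff by (simp add: s_def x_def)
  qed
  have mono: "mono_on {..?n} s"
  proof (rule mono_onI)
    fix i j assume ij: "i \<in> {..?n}" "j \<in> {..?n}" "i \<le> j"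
    have "take j ts = take i ts @ take (j - i) (drop i ts)" using ij by (metis le_add_diff_inverse take_add)
    moreover have "0 \<le> sum_list (map fst (take (j - i) (drop i ts)))"
      using snoc.prems by (intro sum_list_nonneg) (auto dest!: in_set_takeD in_set_dropD)
    ultimately show "s i \<le> s j" by (simp add: s_def)
  qed
  have "0 \<le> d" using snoc.prems by (simp add: z)
  have sn: "s ?n = sum_list (map fst ts)" by (simp add: s_def)
  have xn: "x ?n = last (x0 # map snd ts)" by (cases ts rule: rev_cases) (auto simp: x_def nth_append)
  have "\<P>(Y in Q. Y 0 = x0 \<and> path_cyl (ts @ [z]) Y) = \<P>(Y in Q. (\<forall>i\<le>?n. Y (s i) = x i) \<and> Y (s ?n + d) = y)"
    unfolding ev z path_cyl_append sn by (simp add: conj_assoc)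
  also have "\<dots> = \<P>(Y in Q. \<forall>i\<le>?n. Y (s i) = x i) * pmf (T (s ?n + d - s ?n) (x ?n)) y"
    using \<open>0 \<le> d\<close> by (intro markov mono) (simp_all add: s_def[of 0])
  also have "\<dots> = chain_prob T (ts @ [z]) x0"
    unfolding ev using snoc by (simp add: z chain_prob_append xn)
  finally show ?case .
qed

text \<open>Restricted to nonnegative times because elements of the product space are
  \<open>undefined\<close> elsewhere.\<close>

definition walk_map :: "('d::finite site \<Rightarrow> ennreal) \<Rightarrow> ('d site \<times> real) stream \<Rightarrow> real \<Rightarrow> 'd site" where
  "walk_map W s = (\<lambda>t\<in>{0..}. walk_path W 0 s t)"

lemma measurable_walk_map:
  fixes q :: "'d::finite site pmf"
  assumes s [measurable]: "s \<in> M \<rightarrow>\<^sub>M source q" and W [measurable]: "\<And>z. (\<lambda>w. W w z) \<in> borel_measurable M"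
  shows "(\<lambda>w. walk_map (W w) (s w)) \<in> M \<rightarrow>\<^sub>M paths"
  unfolding walk_map_def paths_def
  by (rule measurable_restrict) (rule measurable_walk_path[OF s W], measurable)

lemma path_cyl_walk_map:
  "\<forall>z\<in>set ts. 0 \<le> fst z \<Longrightarrow> path_cyl ts (walk_map W s) \<longleftrightarrow> path_cyl ts (walk_path W 0 s)"
  by (rule path_cyl_cong) (auto simp: walk_map_def)

theorem law_eq_walk:
  fixes q :: "'d::finite site pmf" and Q :: "(real \<Rightarrow> 'd site) measure"
  assumes W: "\<And>z. 1 \<le> W z" and Q: "markov_chain_law (jump_generator q (rate W)) 0 Q"
  shows "distr Q paths (\<lambda>Y. Y) = distr (source q) paths (walk_map W)"
proof -
  obtain T where Q': "prob_space Q" "sets Q = sets path_space" "AE Y in Q. Y 0 = 0"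
    and T: "transition_semigroup T" "has_generator T (jump_generator q (rate W))"
    and markov: "\<And>(n::nat) (s :: nat \<Rightarrow> real) (x :: nat \<Rightarrow> 'd site) t y.
           0 \<le> s 0 \<and> mono_on {..n} s \<and> s n \<le> t \<longrightarrow>
           \<P>(Y in Q. (\<forall>i\<le>n. Y (s i) = x i) \<and> Y t = y) =
           \<P>(Y in Q. \<forall>i\<le>n. Y (s i) = x i) * pmf (T (t - s n) (x n)) y"
    using Q unfolding markov_chain_law_def by blast
  have id_meas [measurable]: "(\<lambda>Y. Y) \<in> Q \<rightarrow>\<^sub>M paths"
    using path_space_measurable measurable_cong_sets[OF Q'(2) refl] by blast
  have walk_meas [measurable]: "walk_map W \<in> source q \<rightarrow>\<^sub>M paths"
    using measurable_walk_map[of "\<lambda>s. s" "source q" q "\<lambda>_. W"] by simp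
  show ?thesis
  proof (rule paths_measure_eqI)
    show "prob_space (distr Q paths (\<lambda>Y. Y))" by (rule prob_space.prob_space_distr[OF Q'(1) id_meas])
    show "prob_space (distr (source q) paths (walk_map W))" by (rule prob_space.prob_space_distr[OF prob_space_source walk_meas])
    fix ts :: "(real \<times> 'd site) list" assume ts: "\<forall>z\<in>set ts. 0 \<le> fst z"
    have cyl [measurable]: "{Y \<in> space paths. path_cyl ts Y} \<in> sets paths"
    proof -
      have "{Y \<in> space paths. path_cyl ts Y} = {Y \<in> space paths. \<forall>i\<in>{..<length ts}. Y (sum_list (map fst (take (Suc i) ts))) = snd (ts ! i)}"
        by (auto simp: path_cyl_iff)
      also have "\<dots> \<in> sets paths"
      proof (intro sets.sets_Collect_finite_All)
        fix i
        have "0 \<le> sum_list (map fst (take (Suc i) ts))"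
          using ts by (intro sum_list_nonneg) (auto dest!: in_set_takeD)
        then have [measurable]: "(\<lambda>Y. Y (sum_list (map fst (take (Suc i) ts)))) \<in> paths \<rightarrow>\<^sub>M count_space (UNIV :: 'd site set)" by simp
        show "{Y \<in> space paths. Y (sum_list (map fst (take (Suc i) ts))) = snd (ts ! i)} \<in> sets paths" by measurable
      qed simp
      finally show ?thesis .
    qed
    have "measure (distr Q paths (\<lambda>Y. Y)) {Y \<in> space paths. path_cyl ts Y} = \<P>(Y in Q. path_cyl ts Y)"
      using measurable_space[OF id_meas] by (subst measure_distr) (auto intro!: arg_cong[where f="measure Q"])
    also have "\<dots> = \<P>(Y in Q. Y 0 = 0 \<and> path_cyl ts Y)"
    proof (rule prob_space.prob_eq_AE[OF Q'(1)])
      show "AE Y in Q. path_cyl ts Y = (Y 0 = 0 \<and> path_cyl ts Y)" using Q'(3) by eventually_elim simp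
      have P: "{Y \<in> space Q. path_cyl ts Y} = (\<lambda>Y. Y) -` {Y \<in> space paths. path_cyl ts Y} \<inter> space Q"
        using measurable_space[OF id_meas] by auto
      show "{Y \<in> space Q. path_cyl ts Y} \<in> sets Q" unfolding P by (rule measurable_sets[OF id_meas cyl])
      moreover have [measurable]: "(\<lambda>Y. Y 0) \<in> Q \<rightarrow>\<^sub>M count_space UNIV"
        using measurable_compose[OF id_meas measurable_paths_component[of 0]] by simp
      ultimately show "{Y \<in> space Q. Y 0 = 0 \<and> path_cyl ts Y} \<in> sets Q" by (intro sets.sets_Collect_conj) measurable
    qed
    also have "\<dots> = chain_prob T ts 0"
      by (rule markov_chain_law_chain_prob[OF Q' _ ts]) (use markov in blast)
    also have "\<dots> = walk_prob q W ts 0" by (rule walk_prob_eq_chain_prob[where W=W and T=T and q=q, OF W T ts, symmetric])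
    also have "\<dots> = measure (distr (source q) paths (walk_map W)) {Y \<in> space paths. path_cyl ts Y}"
      unfolding walk_prob_def using measurable_space[OF walk_meas]
      by (subst measure_distr) (auto intro!: arg_cong[where f="measure (source q)"] simp: path_cyl_walk_map[OF ts])
    finally show "measure (distr Q paths (\<lambda>Y. Y)) {Y \<in> space paths. path_cyl ts Y} =
        measure (distr (source q) paths (walk_map W)) {Y \<in> space paths. path_cyl ts Y}" .
  qed simp_all
qed

section \<open>The walk in the random environment\<close>

text \<open>The mean holding time at \<open>x\<close>. At an infinite cluster it is
  \<open>\<infinity>\<close> if \<beta> is positive and 1 if \<beta> is 0, which matches the
  conventions for the rate.\<close>

definition waiting :: "real \<Rightarrow> ('d::finite site \<Rightarrow> bool) \<Rightarrow> 'd site \<Rightarrow> ennreal" where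
  "waiting \<beta> \<omega> x = exp_ereal (ereal \<beta> * ereal_of_enat (cluster_size \<omega> x))"

lemma exp_ereal_infinity [simp]: "exp_ereal \<infinity> = \<infinity>" "exp_ereal (- \<infinity>) = 0"
  using exp_ereal.simps(2,3) by simp_all

lemma exponent_cases:
  assumes "0 \<le> \<beta>"
  obtains c where "ereal \<beta> * ereal_of_enat n = ereal c" "0 \<le> c" | "ereal \<beta> * ereal_of_enat n = \<infinity>"
proof (cases n)
  case (enat k)
  then show ?thesis using that(1)[of "\<beta> * real k"] assms by simp
next
  case infinity
  then show ?thesis using that(1)[of 0] that(2) assms by (cases "\<beta> = 0") (auto simp: zero_ereal_def)
qed

lemma waiting_ge_1: "0 \<le> \<beta> \<Longrightarrow> 1 \<le> waiting \<beta> \<omega> x"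
  unfolding waiting_def
proof (erule exponent_cases[of \<beta> "cluster_size \<omega> x"])
  fix c assume "ereal \<beta> * ereal_of_enat (cluster_size \<omega> x) = ereal c" "0 \<le> c"
  then show "1 \<le> exp_ereal (ereal \<beta> * ereal_of_enat (cluster_size \<omega> x))"
    using ennreal_leI[of 1 "exp c"] by simp
qed simp

text \<open>Separates the direction from the site in the extended exponent; when the waiting time is
  infinite both sides are 0.\<close>

lemma rate_waiting:
  assumes "0 \<le> \<beta>"
  shows "enn2real (exp_ereal (ereal a - ereal \<beta> * ereal_of_enat (cluster_size \<omega> x))) = exp a * rate (waiting \<beta> \<omega>) x"
  using assms
proof (cases rule: exponent_cases[of \<beta> "cluster_size \<omega> x"])
  case (1 c)
  then show ?thesis by (simp add: rate_def waiting_def inverse_ennreal exp_diff exp_minus divide_inverse)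
next
  case 2
  then show ?thesis by (simp add: rate_def waiting_def)
qed

lemma measurable_waiting [measurable]: "(\<lambda>\<omega>. waiting \<beta> \<omega> x) \<in> borel_measurable (env p)"
  unfolding waiting_def by (rule measurable_compose[OF cluster_size_measurable]) simp

lemma waiting_translate: "waiting \<beta> (translate z \<omega>) 0 = waiting \<beta> \<omega> z"
  by (simp add: waiting_def cluster_size_translate)

section \<open>Law of a single step and the generator in terms of it\<close>

definition step_weight :: "real ^ 'd::finite \<Rightarrow> real \<Rightarrow> 'd site \<Rightarrow> real" where
  "step_weight l lam e = (if adj e 0 then norm_const l lam * exp (lam * (l \<bullet> real_site e)) else 0)"

lemma adj_0_iff: "adj e 0 \<longleftrightarrow> (\<exists>i. e = axis i 1 \<or> e = axis i (-1))"
proof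
  assume "adj e 0"
  then have sum: "(\<Sum>i\<in>UNIV. \<bar>e $ i\<bar>) = 1" by (simp add: adj_def)
  then obtain i where i: "e $ i \<noteq> 0" by (metis (no_types, lifting) abs_zero sum.neutral zero_neq_one)
  have split: "(\<Sum>j\<in>UNIV. \<bar>e $ j\<bar>) = \<bar>e $ i\<bar> + (\<Sum>j\<in>UNIV - {i}. \<bar>e $ j\<bar>)"
    by (rule sum.remove) auto
  have nn: "0 \<le> (\<Sum>j\<in>UNIV - {i}. \<bar>e $ j\<bar>)" by (rule sum_nonneg) simp
  have ei: "\<bar>e $ i\<bar> = 1" and "(\<Sum>j\<in>UNIV - {i}. \<bar>e $ j\<bar>) = 0" using i nn sum split by linarith+
  then have "\<forall>j\<in>UNIV - {i}. \<bar>e $ j\<bar> = 0" by (subst (asm) sum_nonneg_eq_0_iff) auto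
  then have "e = axis i (e $ i)" by (auto simp: vec_eq_iff axis_def)
  then show "\<exists>i. e = axis i 1 \<or> e = axis i (-1)" using ei by (metis abs_eq_iff' zero_le_one)
next
  have "(\<Sum>j\<in>UNIV. \<bar>axis i c $ j\<bar>) = \<bar>c\<bar>" for i :: 'a and c :: int
    by (simp add: axis_def if_distrib[of abs] cong: if_cong)
  then show "\<exists>i. e = axis i 1 \<or> e = axis i (-1) \<Longrightarrow> adj e 0" by (auto simp: adj_def)
qed

text \<open>Pairing opposite neighbours is what turns the exponential weights into cosh in the
  normalisation and sinh in the drift.\<close>

lemma sum_adj:
  fixes h :: "'d::finite site \<Rightarrow> 'b::comm_monoid_add"
  shows "(\<Sum>e\<in>{e. adj e 0}. h e) = (\<Sum>i\<in>UNIV. h (axis i 1) + h (axis i (-1)))"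
proof -
  have inj: "inj (\<lambda>i. axis i c :: 'd site)" if "c \<noteq> 0" for c :: int
    using that by (auto simp: inj_on_def axis_eq_axis)
  have eq: "{e :: 'd site. adj e 0} = range (\<lambda>i. axis i 1) \<union> range (\<lambda>i. axis i (-1))" by (auto simp: adj_0_iff)
  have "(\<Sum>e\<in>{e. adj e 0}. h e) = (\<Sum>e\<in>range (\<lambda>i. axis i 1). h e) + (\<Sum>e\<in>range (\<lambda>i. axis i (-1)). h e)"
    unfolding eq by (rule sum.union_disjoint) (auto simp: axis_eq_axis)
  then show ?thesis by (simp add: sum.reindex[OF inj] sum.distrib)
qed

lemma finite_adj: "finite {e :: 'd::finite site. adj e 0}"
proof -
  have "{e :: 'd site. adj e 0} = range (\<lambda>i. axis i 1) \<union> range (\<lambda>i. axis i (-1))" by (auto simp: adj_0_iff)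
  then show ?thesis by simp
qed

lemma real_site_axis: "real_site (axis i c) = axis i (real_of_int c)"
  by (auto simp: real_site_def axis_def vec_eq_iff)

lemma norm_const_eq: "norm_const l lam = inverse (2 * (\<Sum>k\<in>UNIV. cosh (lam * l $ k)))"
proof -
  have "2 * cosh x = exp x + exp (- x)" for x :: real by (simp add: cosh_def)
  then show ?thesis unfolding norm_const_def sum_adj
    by (simp add: real_site_axis inner_axis sum_distrib_left)
qed

lemma sum_cosh_pos: "0 < (\<Sum>k\<in>UNIV. cosh (lam * (l :: real ^ 'd::finite) $ k))"
  by (intro sum_pos) (auto simp: cosh_real_pos)

definition step_pmf :: "real ^ 'd::finite \<Rightarrow> real \<Rightarrow> 'd site pmf" where
  "step_pmf l lam = embed_pmf (step_weight l lam)"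

lemma pmf_step_pmf: "pmf (step_pmf l lam) e = step_weight l lam e"
  unfolding step_pmf_def
proof (rule pmf_embed_pmf)
  have K: "0 < norm_const l lam" unfolding norm_const_eq using sum_cosh_pos[of lam l] by simp
  then show nn: "0 \<le> step_weight l lam e" for e by (simp add: step_weight_def)
  have "(\<Sum>e\<in>{e. adj e 0}. step_weight l lam e) = norm_const l lam * (\<Sum>e\<in>{e. adj e 0}. exp (lam * (l \<bullet> real_site e)))"
    by (simp add: step_weight_def sum_distrib_left)
  also have "\<dots> = 1" using K by (simp add: norm_const_def)
  finally have sum: "(\<Sum>e\<in>{e. adj e 0}. step_weight l lam e) = 1" .
  have "(\<integral>\<^sup>+e. ennreal (step_weight l lam e) \<partial>count_space UNIV) = (\<Sum>e\<in>{e. adj e 0}. ennreal (step_weight l lam e))"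
    by (rule nn_integral_count_space'[OF finite_adj]) (auto simp: step_weight_def)
  also have "\<dots> = 1" using sum nn by (subst sum_ennreal) auto
  finally show "(\<integral>\<^sup>+e. ennreal (step_weight l lam e) \<partial>count_space UNIV) = 1" .
qed

lemma expectation_step_pmf:
  fixes f :: "'d::finite site \<Rightarrow> 'b::{banach, second_countable_topology}"
  shows "measure_pmf.expectation (step_pmf l lam) f = (\<Sum>e\<in>{e. adj e 0}. step_weight l lam e *\<^sub>R f e)"
  using integral_measure_pmf[OF finite_adj, of "step_pmf l lam" f]
  by (simp add: pmf_step_pmf set_pmf_iff step_weight_def split: if_splits)

lemma norm_step_pmf: "e \<in> set_pmf (step_pmf l lam) \<Longrightarrow> norm (real_site e) \<le> 1"
proof -
  have "norm (axis i c :: real ^ 'a) \<le> \<bar>c\<bar>" for i c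
    using norm_le_l1_cart[of "axis i c :: real ^ 'a"] by (simp add: axis_def if_distrib[of abs] cong: if_cong)
  from this[of _ 1] this[of _ "-1"] show "e \<in> set_pmf (step_pmf l lam) \<Longrightarrow> norm (real_site e) \<le> 1"
    by (auto simp: set_pmf_iff pmf_step_pmf step_weight_def adj_0_iff real_site_axis split: if_splits)
qed

lemma expectation_step_site: "measure_pmf.expectation (step_pmf l lam) real_site = drift l lam"
proof (subst vec_eq_iff, rule allI)
  fix k
  have adj: "adj (axis i 1 :: 'a site) 0" "adj (axis i (-1) :: 'a site) 0" for i by (auto simp: adj_0_iff)
  have weight: "step_weight l lam (axis i 1) = norm_const l lam * exp (lam * l $ i)"
    "step_weight l lam (axis i (-1)) = norm_const l lam * exp (- (lam * l $ i))" for i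
    by (simp_all add: step_weight_def adj real_site_axis inner_axis)
  have "measure_pmf.expectation (step_pmf l lam) real_site $ k =
      (\<Sum>i\<in>UNIV. if i = k then norm_const l lam * exp (lam * l $ i) - norm_const l lam * exp (- (lam * l $ i)) else 0)"
    unfolding expectation_step_pmf sum_adj weight real_site_axis sum_component
    by (rule sum.cong) (auto simp: axis_def)
  also have "\<dots> = norm_const l lam * (exp (lam * l $ k) - exp (- (lam * l $ k)))"
    by (simp add: right_diff_distrib)
  also have "\<dots> = drift l lam $ k" using sum_cosh_pos[of lam l]
    by (simp add: norm_const_eq drift_def sinh_def field_simps)
  finally show "measure_pmf.expectation (step_pmf l lam) real_site $ k = drift l lam $ k" .
qed

lemma walk_generator_eq:
  assumes "0 \<le> \<beta>"
  shows "walk_generator l lam \<beta> \<omega> = jump_generator (step_pmf l lam) (rate (waiting \<beta> \<omega>))"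
proof (intro ext)
  fix f x
  have sum1: "(\<Sum>e\<in>{e. adj e 0}. step_weight l lam e) = 1"
    using expectation_step_pmf[of l lam "\<lambda>_. 1 :: real"] by (simp add: measure_pmf.prob_space[simplified])
  have "walk_generator l lam \<beta> \<omega> f x = (\<Sum>e\<in>{e. adj e 0}. rate (waiting \<beta> \<omega>) x * (step_weight l lam e * (f (x + e) - f x)))"
    unfolding walk_generator_def rate_waiting[OF assms] sum_distrib_left
    by (intro sum.cong) (auto simp: step_weight_def)
  also have "\<dots> = rate (waiting \<beta> \<omega>) x * ((\<Sum>e\<in>{e. adj e 0}. step_weight l lam e * f (x + e)) - (\<Sum>e\<in>{e. adj e 0}. step_weight l lam e) * f x)"
    by (simp add: sum_distrib_left[symmetric] right_diff_distrib sum_subtractf sum_distrib_right)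
  finally show "walk_generator l lam \<beta> \<omega> f x = jump_generator (step_pmf l lam) (rate (waiting \<beta> \<omega>)) f x"
    by (simp add: jump_generator_def expectation_step_pmf sum1)
qed

lemma quenched_law_eq_walk:
  assumes "0 \<le> \<beta>" and "quenched_law l lam \<beta> \<omega> Q"
  shows "distr Q paths (\<lambda>Y. Y) = distr (source (step_pmf l lam)) paths (walk_map (waiting \<beta> \<omega>))"
  using assms(2) unfolding quenched_law_def walk_generator_eq[OF assms(1)]
  by (rule law_eq_walk[where W="waiting \<beta> \<omega>", OF waiting_ge_1[OF assms(1)]])

lemma quenched_law_props:
  assumes "quenched_law l lam \<beta> \<omega> Q"
  shows "prob_space Q" "sets Q = sets path_space" "space Q = space path_space" "(\<lambda>Y. Y) \<in> Q \<rightarrow>\<^sub>M paths"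
proof -
  show Q: "prob_space Q" "sets Q = sets path_space"
    using assms by (auto simp: quenched_law_def markov_chain_law_def)
  then show "space Q = space path_space" by (auto dest: sets_eq_imp_space_eq)
  show "(\<lambda>Y. Y) \<in> Q \<rightarrow>\<^sub>M paths" using path_space_measurable measurable_cong_sets[OF Q(2) refl] by blast
qed

section \<open>Dependence of the quenched law on the environment\<close>

lemma measurable_walk_map_waiting [measurable]:
  "(\<lambda>z. walk_map (waiting \<beta> (fst z)) (snd z)) \<in> env p \<Otimes>\<^sub>M source q \<rightarrow>\<^sub>M paths"
  by (rule measurable_walk_map[of _ _ q]) measurable

text \<open>The family \<open>Q\<close> is chosen separately for each \<omega>; its measurability
  comes from the construction. An event of \<open>path_space\<close> is the trace of an event of
  \<open>paths\<close>, and the probability of the latter under the constructed walk is jointly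
  measurable before integration.\<close>

lemma measurable_quenched_law:
  fixes Q :: "('d::finite site \<Rightarrow> bool) \<Rightarrow> (real \<Rightarrow> 'd site) measure"
  assumes \<beta>: "0 \<le> \<beta>" and Q: "\<And>\<omega>. quenched_law l lam \<beta> \<omega> (Q \<omega>)"
  shows "Q \<in> env p \<rightarrow>\<^sub>M subprob_algebra path_space"
proof (rule measurable_subprob_algebra)
  note Q' = quenched_law_props[OF Q]
  let ?S = "source (step_pmf l lam)"
  show "subprob_space (Q \<omega>)" for \<omega> by (rule prob_space_imp_subprob_space[OF Q'(1)])
  show "sets (Q \<omega>) = sets path_space" for \<omega> by (rule Q'(2))
  fix A :: "(real \<Rightarrow> 'd site) set" assume "A \<in> sets path_space"
  then obtain A' where A': "A' \<in> sets paths" and A: "A = {Y. \<forall>t\<ge>0. continuous (at_right t) Y} \<inter> A'"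
    unfolding path_space_def sets_restrict_space paths_def by auto
  have "emeasure (Q \<omega>) A = emeasure ?S {s \<in> space ?S. walk_map (waiting \<beta> \<omega>) s \<in> A'}" for \<omega>
  proof -
    have "A = (\<lambda>Y. Y) -` A' \<inter> space (Q \<omega>)"
      using sets.sets_into_space[OF A'] unfolding A Q'(3) space_path_space by auto
    then have "emeasure (Q \<omega>) A = emeasure (distr (Q \<omega>) paths (\<lambda>Y. Y)) A'"
      using A' Q'(4) by (simp add: emeasure_distr)
    also have "\<dots> = emeasure (distr ?S paths (walk_map (waiting \<beta> \<omega>))) A'"
      by (simp only: quenched_law_eq_walk[OF \<beta> Q])
    also have "\<dots> = emeasure ?S (walk_map (waiting \<beta> \<omega>) -` A' \<inter> space ?S)"
      using measurable_walk_map[of "\<lambda>s. s" ?S "step_pmf l lam" "\<lambda>_. waiting \<beta> \<omega>"] A' by (intro emeasure_distr) auto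
    finally show ?thesis by (simp add: vimage_def)
  qed
  moreover have "(\<lambda>\<omega>. emeasure ?S {s \<in> space ?S. walk_map (waiting \<beta> \<omega>) s \<in> A'}) \<in> borel_measurable (env p)"
  proof (rule source.measurable_emeasure)
    have "{z \<in> space (env p \<Otimes>\<^sub>M ?S). walk_map (waiting \<beta> (fst z)) (snd z) \<in> A'} \<in> sets (env p \<Otimes>\<^sub>M ?S)"
      using A' by measurable
    then show "{z \<in> space (env p \<Otimes>\<^sub>M ?S). snd z \<in> {s \<in> space ?S. walk_map (waiting \<beta> (fst z)) s \<in> A'}} \<in> sets (env p \<Otimes>\<^sub>M ?S)"
      by simp
  qed simp
  ultimately show "(\<lambda>\<omega>. emeasure (Q \<omega>) A) \<in> borel_measurable (env p)" by simp
qed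

section \<open>Limits along rational times\<close>

text \<open>Convergence along rational times involves countably many coordinates only, so it is an
  event of the product space and passes from one law to another. The bound \<open>Suc N\<close>
  keeps the times positive.\<close>

definition rat_limit :: "real ^ 'd::finite \<Rightarrow> (real \<Rightarrow> 'd site) \<Rightarrow> bool" where
  "rat_limit v Y \<longleftrightarrow> (\<forall>k::nat. \<exists>N::nat. \<forall>r::rat. real (Suc N) \<le> of_rat r \<longrightarrow>
     dist ((1 / of_rat r) *\<^sub>R real_site (Y (of_rat r))) v \<le> 1 / real (Suc k))"

lemma measurable_rat_limit [measurable]: "Measurable.pred paths (rat_limit v)"
proof -
  have "Measurable.pred paths (\<lambda>Y. real (Suc N) \<le> of_rat r \<longrightarrow> dist ((1 / of_rat r) *\<^sub>R real_site (Y (of_rat r))) v \<le> 1 / real (Suc k))" for N r k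
  proof (cases "real (Suc N) \<le> of_rat r")
    case True
    have "0 \<le> real (Suc N)" by simp
    then have "0 \<le> (of_rat r :: real)" using True by linarith
    then have c: "(\<lambda>Y. Y (of_rat r)) \<in> paths \<rightarrow>\<^sub>M count_space (UNIV :: 'a site set)" by (rule measurable_paths_component)
    have "Measurable.pred (count_space UNIV) (\<lambda>y :: 'a site. dist ((1 / of_rat r) *\<^sub>R real_site y) v \<le> 1 / real (Suc k))" by simp
    from measurable_compose[OF c this] show ?thesis using True by simp
  qed simp
  then show ?thesis unfolding rat_limit_def[abs_def] by measurable
qed

lemma rat_limitI:
  assumes "((\<lambda>t. (1 / t) *\<^sub>R real_site (Y t)) \<longlongrightarrow> v) at_top"
  shows "rat_limit v Y"
  unfolding rat_limit_def
proof
  fix k :: nat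
  have "eventually (\<lambda>t. dist ((1 / t) *\<^sub>R real_site (Y t)) v < 1 / real (Suc k)) at_top"
    by (rule tendstoD[OF assms]) simp
  then obtain t0 where t0: "\<And>t. t \<ge> t0 \<Longrightarrow> dist ((1 / t) *\<^sub>R real_site (Y t)) v < 1 / real (Suc k)"
    by (auto simp: eventually_at_top_linorder)
  obtain N :: nat where "t0 \<le> real N" using real_arch_simple by blast
  then show "\<exists>N. \<forall>r::rat. real (Suc N) \<le> of_rat r \<longrightarrow> dist ((1 / of_rat r) *\<^sub>R real_site (Y (of_rat r))) v \<le> 1 / real (Suc k)"
    by (intro exI[of _ N] allI impI less_imp_le t0) simp
qed

text \<open>A right-continuous path in a discrete space is constant just after \<open>t\<close>, so
  a rational time slightly larger than \<open>t\<close> has the same site and nearly the same factor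
  \<open>1 / t\<close>.\<close>

lemma rat_limitD:
  fixes Y :: "real \<Rightarrow> 'd::finite site"
  assumes lim: "rat_limit v Y" and cont: "\<And>t. 0 \<le> t \<Longrightarrow> continuous (at_right t) Y"
  shows "((\<lambda>t. (1 / t) *\<^sub>R real_site (Y t)) \<longlongrightarrow> v) at_top"
proof (rule tendstoI)
  fix e :: real assume "0 < e"
  then obtain k where k: "1 / real (Suc k) < e" using nat_approx_posE by blast
  obtain N :: nat where N: "\<And>r::rat. real (Suc N) \<le> of_rat r \<Longrightarrow> dist ((1 / of_rat r) *\<^sub>R real_site (Y (of_rat r))) v \<le> 1 / real (Suc k)"
    using lim unfolding rat_limit_def by blast
  have "dist ((1 / t) *\<^sub>R real_site (Y t)) v < e" if t: "real (Suc N) \<le> t" for t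
  proof -
    have t0: "0 < t" using t by (auto intro: less_le_trans[of 0 "real (Suc N)"])
    have "(Y \<longlongrightarrow> Y t) (at_right t)" using cont[of t] t0 by (simp add: continuous_within)
    \<comment> \<open>Sites carry the product topology; eventual constancy is obtained for each
      integer coordinate and then for all of them.\<close>
    then have "((\<lambda>s. Y s $ i) \<longlongrightarrow> Y t $ i) (at_right t)" for i by (rule tendsto_vec_nth)
    then have "eventually (\<lambda>s. Y s $ i = Y t $ i) (at_right t)" for i by (simp add: tendsto_discrete)
    then have "eventually (\<lambda>s. \<forall>i. Y s $ i = Y t $ i) (at_right t)" by (simp add: eventually_all_finite)
    then have "eventually (\<lambda>s. Y s = Y t) (at_right t)" by (simp add: vec_eq_iff)
    then obtain b where b: "t < b" "\<And>s. t < s \<Longrightarrow> s < b \<Longrightarrow> Y s = Y t" by (auto simp: eventually_at_right_field)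
    show ?thesis
    proof (rule ccontr)
      assume "\<not> dist ((1 / t) *\<^sub>R real_site (Y t)) v < e"
      then have far: "1 / real (Suc k) < dist ((1 / t) *\<^sub>R real_site (Y t)) v" using k by simp
      have "((\<lambda>s. dist ((1 / s) *\<^sub>R real_site (Y t)) v) \<longlongrightarrow> dist ((1 / t) *\<^sub>R real_site (Y t)) v) (at_right t)"
        using t0 by (intro tendsto_intros) auto
      from order_tendstoD(1)[OF this far] obtain b' where b': "t < b'"
        "\<And>s. t < s \<Longrightarrow> s < b' \<Longrightarrow> 1 / real (Suc k) < dist ((1 / s) *\<^sub>R real_site (Y t)) v"
        by (auto simp: eventually_at_right_field)
      obtain r :: rat where r: "t < of_rat r" "of_rat r < min b b'"
        using of_rat_dense[of t "min b b'"] b b' by auto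
      have "dist ((1 / of_rat r) *\<^sub>R real_site (Y (of_rat r))) v \<le> 1 / real (Suc k)" using N[of r] r t by simp
      then show False using b(2)[of "of_rat r"] b'(2)[of "of_rat r"] r by simp
    qed
  qed
  then show "eventually (\<lambda>t. dist ((1 / t) *\<^sub>R real_site (Y t)) v < e) at_top"
    unfolding eventually_at_top_linorder by blast
qed

text \<open>The almost sure limit for the construction passes to almost every environment by Fubini,
  to \<open>Q \<omega>\<close> by equality of the laws on \<open>paths\<close>, and to the joint law
  through the kernel. Only the event \<open>rat_limit\<close> makes this journey.\<close>

theorem annealed_LLN:
  fixes Q :: "('d::finite site \<Rightarrow> bool) \<Rightarrow> (real \<Rightarrow> 'd site) measure"
  assumes \<beta>: "0 \<le> \<beta>" and Q: "\<And>\<omega>. quenched_law l lam \<beta> \<omega> (Q \<omega>)"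
  shows "AE (\<omega>, Y) in annealed_law p Q. ((\<lambda>t. (1 / t) *\<^sub>R real_site (Y t)) \<longlongrightarrow> speed p l lam \<beta>) at_top"
proof -
  let ?S = "source (step_pmf l lam)" and ?v = "speed p l lam \<beta>"
  note Q' = quenched_law_props[OF Q]
  have Q_meas [measurable]: "Q \<in> env p \<rightarrow>\<^sub>M subprob_algebra path_space" by (rule measurable_quenched_law[OF \<beta> Q])
  have speed: "?v = enn2real (inverse (\<integral>\<^sup>+\<omega>. waiting \<beta> \<omega> (0 :: 'd site) \<partial>env p)) *\<^sub>R measure_pmf.expectation (step_pmf l lam) real_site"
    by (simp add: speed_def waiting_def expectation_step_site)
  have "AE z in (env p :: ('d site \<Rightarrow> bool) measure) \<Otimes>\<^sub>M ?S. rat_limit ?v (walk_map (waiting \<beta> (fst z)) (snd z))"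
    using position_LLN[where W="\<lambda>\<omega>. waiting \<beta> \<omega> 0" and q="step_pmf l lam" and p=p, OF measurable_waiting waiting_ge_1[OF \<beta>] norm_step_pmf[of _ l lam], simplified]
  proof eventually_elim
    case (elim z)
    obtain \<omega> s where z: "z = (\<omega>, s)" by (cases z)
    have "((\<lambda>t. (1 / t) *\<^sub>R real_site (position (waiting \<beta> \<omega>) s t)) \<longlongrightarrow> ?v) at_top"
      using elim by (simp add: z speed waiting_translate)
    moreover have "eventually (\<lambda>t. (1 / t) *\<^sub>R real_site (position (waiting \<beta> \<omega>) s t) = (1 / t) *\<^sub>R real_site (walk_map (waiting \<beta> \<omega>) s t)) at_top"
      using eventually_ge_at_top[of 0] by eventually_elim (simp add: walk_map_def walk_path_def)
    ultimately have "((\<lambda>t. (1 / t) *\<^sub>R real_site (walk_map (waiting \<beta> \<omega>) s t)) \<longlongrightarrow> ?v) at_top"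
      by (rule Lim_transform_eventually)
    then show ?case by (simp add: z rat_limitI)
  qed
  from env_source.AE_pair[OF this]
  have "AE \<omega> in env p. AE s in ?S. rat_limit ?v (walk_map (waiting \<beta> \<omega>) s)" by simp
  then have "AE \<omega> in env p. AE Y in Q \<omega>. rat_limit ?v Y"
  proof eventually_elim
    case (elim \<omega>)
    have [measurable]: "walk_map (waiting \<beta> \<omega>) \<in> ?S \<rightarrow>\<^sub>M paths"
      using measurable_walk_map[of "\<lambda>s. s" ?S "step_pmf l lam" "\<lambda>_. waiting \<beta> \<omega>"] by simp
    have "AE Y in distr ?S paths (walk_map (waiting \<beta> \<omega>)). rat_limit ?v Y"
      using elim by (subst AE_distr_iff) (auto intro: measurable_rat_limit[unfolded pred_def])
    then have "AE Y in distr (Q \<omega>) paths (\<lambda>Y. Y). rat_limit ?v Y" by (simp only: quenched_law_eq_walk[OF \<beta> Q])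
    then show ?case using AE_distrD[OF Q'(4)] by blast
  qed
  then have ae: "AE \<omega> in env p. AE z in distr (Q \<omega>) (env p \<Otimes>\<^sub>M path_space) (\<lambda>Y. (\<omega>, Y)). rat_limit ?v (snd z)"
  proof eventually_elim
    case (elim \<omega>)
    have m: "(\<lambda>Y. (\<omega>, Y)) \<in> Q \<omega> \<rightarrow>\<^sub>M env p \<Otimes>\<^sub>M path_space"
      using measurable_cong_sets[OF Q'(2) refl] by (metis measurable_Pair1' UNIV_I space_env)
    show ?case by (subst AE_distr_iff[OF m]) (use elim measurable_compose[OF measurable_compose[OF measurable_snd path_space_measurable] measurable_rat_limit] in \<open>auto simp: pred_def\<close>)
  qed
  have kernel: "(\<lambda>\<omega>. distr (Q \<omega>) (env p \<Otimes>\<^sub>M path_space) (\<lambda>Y. (\<omega>, Y))) \<in> env p \<rightarrow>\<^sub>M subprob_algebra (env p \<Otimes>\<^sub>M path_space)"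
    by (rule measurable_distr2[OF _ Q_meas]) simp
  have "Measurable.pred (env p \<Otimes>\<^sub>M path_space) (\<lambda>z. rat_limit ?v (snd z))"
    using measurable_compose[OF measurable_compose[OF measurable_snd path_space_measurable] measurable_rat_limit] .
  from AE_bind[OF kernel this] ae
  have "AE z in annealed_law p Q. rat_limit ?v (snd z)" unfolding annealed_law_def by simp
  moreover have "space (annealed_law p Q) = space (env p \<Otimes>\<^sub>M path_space)"
    unfolding annealed_law_def by (rule space_bind) (auto)
  \<comment> \<open>Right-continuity is recovered from the sample space itself, on which the
    quenched laws live.\<close>
  ultimately have "AE z in annealed_law p Q. rat_limit ?v (snd z) \<and> snd z \<in> space path_space"
    using AE_space[of "annealed_law p Q"] by (auto simp: space_pair_measure elim!: eventually_elim2)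
  then show ?thesis
    by eventually_elim (auto simp: space_path_space split_beta' intro!: rat_limitD)
qed

section \<open>Exponential moments of the cluster size\<close>

lemma adj_commute: "adj x y \<longleftrightarrow> adj y x"
  by (simp add: adj_def abs_minus_commute)

lemma segment_subset_cluster:
  fixes \<omega> :: "'d::finite site \<Rightarrow> bool"
  assumes "\<And>k. k < n \<Longrightarrow> \<omega> (axis i (int k))"
  shows "(\<lambda>k. axis i (int k)) ` {..<n} \<subseteq> cluster \<omega> 0"
proof -
  have a0: "axis i 0 = (0 :: 'd site)" by (simp add: axis_def vec_eq_iff)
  have "(\<lambda>u v. adj u v \<and> \<omega> u \<and> \<omega> v)\<^sup>*\<^sup>* 0 (axis i (int k))" if "k < n" for k
    using that
  proof (induction k)
    case (Suc k)
    have "axis i (int (Suc k)) = axis i 1 + (axis i (int k) :: 'd site)" by (simp add: axis_def vec_eq_iff)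
    moreover have "adj (axis i 1 + (axis i (int k) :: 'd site)) (0 + axis i (int k))"
      unfolding adj_translate by (auto simp: adj_0_iff)
    ultimately have "adj (axis i (int k) :: 'd site) (axis i (int (Suc k)))" by (simp add: adj_commute)
    then show ?case using Suc assms[of k] assms[of "Suc k"] by (intro rtranclp.rtrancl_into_rtrancl[OF Suc.IH]) auto
  qed (simp add: a0)
  then show ?thesis using assms[of 0] by (auto simp: cluster_def a0)
qed

lemma measurable_cluster_size_ge [measurable]: "Measurable.pred (env p) (\<lambda>\<omega>. enat n \<le> cluster_size \<omega> x)"
  using measurable_compose[OF cluster_size_measurable, of "\<lambda>m. enat n \<le> m" "count_space UNIV"] by simp

text \<open>A straight segment of \<open>n\<close> open sites starting at the origin has positive
  probability. Positivity makes the logarithms in \<open>decay_rate\<close> meaningful.\<close>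

lemma prob_cluster_size_ge_pos:
  assumes "0 < p"
  shows "0 < \<P>(\<omega> in env p. enat n \<le> cluster_size \<omega> (0 :: 'd::finite site))"
proof -
  define i :: 'd where "i = undefined"
  define S where "S = (\<lambda>k. axis i (int k) :: 'd site) ` {..<n}"
  have card: "card S = n" unfolding S_def by (subst card_image) (auto simp: inj_on_def axis_eq_axis)
  have r: "0 < pmf (bernoulli_pmf p) True" using assms by (simp add: bernoulli_pmf.rep_eq)
  have "0 < (\<Prod>i\<in>S. measure_pmf.prob (bernoulli_pmf p) {True})" using r by (intro prod_pos) (simp add: measure_pmf_single)
  also have "\<dots> = measure (env p) (cylinder S (\<lambda>_. {True}))" by (rule measure_cylinder[symmetric]) (simp add: S_def)
  also have "\<dots> \<le> \<P>(\<omega> in env p. enat n \<le> cluster_size \<omega> (0 :: 'd site))"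
  proof (rule env_source.M1.finite_measure_mono)
    show "cylinder S (\<lambda>_. {True}) \<subseteq> {\<omega> \<in> space (env p). enat n \<le> cluster_size \<omega> 0}"
    proof
      fix \<omega> assume "\<omega> \<in> cylinder S (\<lambda>_. {True})"
      then have "S \<subseteq> cluster \<omega> 0" unfolding S_def by (intro segment_subset_cluster) (auto simp: cylinder_def)
      then show "\<omega> \<in> {\<omega> \<in> space (env p). enat n \<le> cluster_size \<omega> 0}"
        using card card_mono[of "cluster \<omega> 0" S] by (auto simp: cluster_size_def)
    qed
  qed measurable
  finally show ?thesis .
qed

text \<open>Markov's inequality bounds \<open>exp (\<beta> * n)\<close> times the tail by the
  moment. Were the moment finite, logarithms divided by \<open>n\<close> would give
  \<open>\<beta> \<le> \<xi>\<close>.\<close>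

lemma exp_moment_infinite:
  assumes p: "0 < p" and rate: "decay_rate TYPE('d::finite) p \<xi>" and \<beta>: "0 \<le> \<beta>" "\<xi> < \<beta>"
  shows "(\<integral>\<^sup>+\<omega>. waiting \<beta> \<omega> (0 :: 'd site) \<partial>env p) = \<infinity>"
proof (rule ccontr)
  assume fin: "(\<integral>\<^sup>+\<omega>. waiting \<beta> \<omega> (0 :: 'd site) \<partial>env p) \<noteq> \<infinity>"
  define Z where "Z n = \<P>(\<omega> in env p. enat n \<le> cluster_size \<omega> (0 :: 'd site))" for n
  have Z0: "0 < Z n" for n unfolding Z_def by (rule prob_cluster_size_ge_pos[OF p])
  obtain c where c: "(\<integral>\<^sup>+\<omega>. waiting \<beta> \<omega> (0 :: 'd site) \<partial>env p) = ennreal c" "0 \<le> c"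
    using fin by (cases "\<integral>\<^sup>+\<omega>. waiting \<beta> \<omega> (0 :: 'd site) \<partial>env p") auto
  have le: "exp (\<beta> * real n) * Z n \<le> c" for n
  proof -
    have "ennreal (exp (\<beta> * real n) * Z n) = (\<integral>\<^sup>+\<omega>. ennreal (exp (\<beta> * real n)) * indicator {\<omega> \<in> space (env p). enat n \<le> cluster_size \<omega> (0 :: 'd site)} \<omega> \<partial>env p)"
      by (subst nn_integral_cmult_indicator) (measurable, simp add: Z_def ennreal_mult env_source.M1.emeasure_eq_measure)
    also have "\<dots> \<le> (\<integral>\<^sup>+\<omega>. waiting \<beta> \<omega> (0 :: 'd site) \<partial>env p)"
    proof (rule nn_integral_mono)
      fix \<omega> :: "'d site \<Rightarrow> bool"
      show "ennreal (exp (\<beta> * real n)) * indicator {\<omega> \<in> space (env p). enat n \<le> cluster_size \<omega> (0 :: 'd site)} \<omega> \<le> waiting \<beta> \<omega> 0"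
      proof (cases "enat n \<le> cluster_size \<omega> 0")
        case True
        show ?thesis
        proof (cases "cluster_size \<omega> 0")
          case (enat k)
          then have "exp (\<beta> * real n) \<le> exp (\<beta> * real k)" using True \<beta> by (simp add: mult_left_mono)
          then show ?thesis using enat True by (auto simp: waiting_def indicator_def intro: ennreal_leI)
        next
          case infinity
          then show ?thesis using \<beta> waiting_ge_1[of \<beta> \<omega> 0] by (cases "\<beta> = 0") (auto simp: waiting_def indicator_def)
        qed
      qed simp
    qed
    finally show ?thesis using c Z0[of n] by simp
  qed
  have c0: "0 < c" using le[of 0] Z0[of 0] by simp
  have lim: "(\<lambda>n. ln (Z n) / real n) \<longlonglongrightarrow> - \<xi>" using rate by (simp add: decay_rate_def Z_def)
  have "\<beta> - \<xi> \<le> 0"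
  proof (rule LIMSEQ_le)
    show "(\<lambda>n. \<beta> + ln (Z n) / real n) \<longlonglongrightarrow> \<beta> - \<xi>" using tendsto_add[OF tendsto_const[of \<beta>] lim] by simp
    show "(\<lambda>n. ln c * inverse (real n)) \<longlonglongrightarrow> 0" by (rule tendsto_mult_right_zero[OF lim_inverse_n])
    show "\<exists>N. \<forall>n\<ge>N. \<beta> + ln (Z n) / real n \<le> ln c * inverse (real n)"
    proof (intro exI[of _ 1] allI impI)
      fix n :: nat assume n: "1 \<le> n"
      have "ln (exp (\<beta> * real n) * Z n) \<le> ln c" using le[of n] Z0[of n] c0 by (subst ln_le_cancel_iff) auto
      then have "\<beta> * real n + ln (Z n) \<le> ln c" using Z0[of n] by (simp add: ln_mult)
      then have "(\<beta> * real n + ln (Z n)) / real n \<le> ln c / real n" by (rule divide_right_mono) simp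
      moreover have "(\<beta> * real n + ln (Z n)) / real n = \<beta> + ln (Z n) / real n" using n by (simp add: add_divide_distrib)
      ultimately show "\<beta> + ln (Z n) / real n \<le> ln c * inverse (real n)" by (metis divide_inverse)
    qed
  qed
  then show False using \<beta> by simp
qed

text \<open>With an \<open>\<eta>\<close> strictly between \<beta> and \<xi>, the tail is eventually
  below \<open>exp (- \<eta> * n)\<close>, so the weighted tails are dominated by a geometric series
  of ratio \<open>exp (\<beta> - \<eta>)\<close>. The same decay shows that the cluster is almost
  surely finite.\<close>

lemma exp_moment_finite:
  assumes p: "0 < p" and rate: "decay_rate TYPE('d::finite) p \<xi>" and \<beta>: "0 \<le> \<beta>" "\<beta> < \<xi>"
  shows "(\<integral>\<^sup>+\<omega>. waiting \<beta> \<omega> (0 :: 'd site) \<partial>env p) < \<infinity>"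
proof -
  define A where "A n = {\<omega> \<in> space (env p). enat n \<le> cluster_size \<omega> (0 :: 'd site)}" for n
  define Z where "Z n = measure (env p) (A n)" for n
  have A [measurable]: "A n \<in> sets (env p)" for n unfolding A_def by measurable
  have Z0: "0 < Z n" for n unfolding Z_def A_def by (rule prob_cluster_size_ge_pos[OF p])
  have lim: "(\<lambda>n. ln (Z n) / real n) \<longlonglongrightarrow> - \<xi>" using rate by (simp add: decay_rate_def Z_def A_def)
  obtain \<eta> where \<eta>: "\<beta> < \<eta>" "\<eta> < \<xi>" using dense[OF \<beta>(2)] by auto
  have "eventually (\<lambda>n. ln (Z n) / real n < - \<eta>) sequentially" using order_tendstoD(2)[OF lim, of "- \<eta>"] \<eta> by simp
  then obtain N where N: "\<And>n. n \<ge> N \<Longrightarrow> ln (Z n) / real n < - \<eta>" by (auto simp: eventually_sequentially)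
  have Z_le: "Z n \<le> exp (- \<eta> * real n)" if "n \<ge> max N 1" for n
  proof -
    have "ln (Z n) < - \<eta> * real n" using N[of n] that by (simp add: field_simps)
    then have "exp (ln (Z n)) \<le> exp (- \<eta> * real n)" by simp
    then show ?thesis using Z0[of n] by simp
  qed
  define r where "r = exp (\<beta> - \<eta>)"
  have r: "0 < r" "r < 1" using \<eta> by (auto simp: r_def)
  have term_le: "exp (\<beta> * real n) * Z n \<le> r ^ n" if "n \<ge> max N 1" for n
  proof -
    have "exp (\<beta> * real n) * Z n \<le> exp (\<beta> * real n) * exp (- \<eta> * real n)" using Z_le[OF that] by (intro mult_left_mono) auto
    also have "\<dots> = r ^ n" by (simp add: r_def exp_of_nat_mult[symmetric] exp_add[symmetric] algebra_simps)
    finally show ?thesis .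
  qed
  have summ: "summable (\<lambda>n. exp (\<beta> * real n) * Z n)"
  proof (rule summable_comparison_test')
    show "summable (\<lambda>n. r ^ n)" using r by (intro summable_geometric) simp
    show "norm (exp (\<beta> * real n) * Z n) \<le> r ^ n" if "n \<ge> max N 1" for n using term_le[OF that] Z0[of n] by simp
  qed
  have fin: "AE \<omega> in env p. cluster_size \<omega> (0 :: 'd site) \<noteq> \<infinity>"
  proof -
    have "(\<lambda>n. r ^ n) \<longlonglongrightarrow> 0" using r by (intro LIMSEQ_realpow_zero) auto
    moreover have "measure (env p) (\<Inter>n. A n) \<le> r ^ n" if "n \<ge> max N 1" for n
    proof -
      have "measure (env p) (\<Inter>n. A n) \<le> Z n" unfolding Z_def by (intro env_source.M1.finite_measure_mono) auto
      also have "\<dots> \<le> exp (\<beta> * real n) * Z n" using Z0[of n] \<beta> by (simp add: mult_le_cancel_right1)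
      finally show ?thesis using term_le[OF that] by simp
    qed
    ultimately have "measure (env p) (\<Inter>n. A n) \<le> 0" by (intro LIMSEQ_le_const[where X="\<lambda>n. r ^ n"]) blast+
    then have "measure (env p) (\<Inter>n. A n) = 0" by (simp add: measure_le_0_iff)
    then have "AE \<omega> in env p. \<omega> \<notin> (\<Inter>n. A n)" by (subst (asm) env_source.M1.prob_eq_0) auto
    then show ?thesis
    proof eventually_elim
      case (elim \<omega>)
      then obtain n where "\<not> enat n \<le> cluster_size \<omega> (0 :: 'd site)" by (auto simp: A_def)
      then show ?case by (cases "cluster_size \<omega> (0 :: 'd site)") auto
    qed
  qed
  have "(\<integral>\<^sup>+\<omega>. waiting \<beta> \<omega> (0 :: 'd site) \<partial>env p) \<le> (\<integral>\<^sup>+\<omega>. (\<Sum>n. ennreal (exp (\<beta> * real n)) * indicator (A n) \<omega>) \<partial>env p)"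
  proof (rule nn_integral_mono_AE)
    \<comment> \<open>A cluster of finite size \<open>k\<close> contributes its own exponential as
      the term \<open>n = k\<close> of the series.\<close>
    show "AE \<omega> in env p. waiting \<beta> \<omega> (0 :: 'd site) \<le> (\<Sum>n. ennreal (exp (\<beta> * real n)) * indicator (A n) \<omega>)"
      using fin
    proof eventually_elim
      case (elim \<omega>)
      then obtain k where k: "cluster_size \<omega> (0 :: 'd site) = enat k" by auto
      have "waiting \<beta> \<omega> (0 :: 'd site) = (\<Sum>n\<in>{k}. ennreal (exp (\<beta> * real n)) * indicator (A n) \<omega>)"
        by (simp add: waiting_def k A_def)
      also have "\<dots> \<le> (\<Sum>n. ennreal (exp (\<beta> * real n)) * indicator (A n) \<omega>)" by (rule sum_le_suminf) auto
      finally show ?case .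
    qed
  qed
  also have "\<dots> = (\<Sum>n. ennreal (exp (\<beta> * real n) * Z n))"
    by (subst nn_integral_suminf) (auto simp: nn_integral_cmult_indicator Z_def ennreal_mult env_source.M1.emeasure_eq_measure)
  also have "\<dots> < \<infinity>"
    unfolding infinity_ennreal_def top.not_eq_extremum[symmetric]
    by (rule ennreal_suminf_neq_top[OF summ]) (intro mult_nonneg_nonneg exp_ge_zero less_imp_le[OF Z0])
  finally show ?thesis .
qed

text \<open>Each coordinate contributes \<open>sinh (lam * x) * x\<close>, a product of two numbers
  of the same sign, and a unit vector has a nonzero coordinate.\<close>

lemma drift_inner_pos:
  assumes "norm l = 1" and "0 < lam"
  shows "0 < drift l lam \<bullet> l"
proof -
  have "l \<noteq> 0" using assms by auto
  then obtain k where k: "l $ k \<noteq> 0" by (auto simp: vec_eq_iff)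
  have pos: "0 < sinh (lam * x) * x" if "x \<noteq> 0" for x :: real
  proof (cases "0 < x")
    case True
    then show ?thesis using assms(2) by simp
  next
    case False
    then have "x < 0" using that by simp
    then have "lam * x < 0" using assms(2) by (simp add: mult_pos_neg)
    then show ?thesis using \<open>x < 0\<close> by (simp add: mult_neg_neg)
  qed
  have "0 < (\<Sum>k\<in>UNIV. sinh (lam * l $ k) * l $ k)"
  proof (rule sum_pos2[of _ k])
    show "0 < sinh (lam * l $ k) * l $ k" using pos[OF k] .
    show "0 \<le> sinh (lam * l $ i) * l $ i" for i using pos[of "l $ i"] by (cases "l $ i = 0") auto
  qed auto
  then show ?thesis using sum_cosh_pos[of lam l] by (simp add: drift_def inner_vec_def sum_divide_distrib[symmetric])
qed

theorem theorem1:
  fixes p lam \<beta> :: real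
    and l :: "real ^ 'd::finite"
    and Q :: "('d site \<Rightarrow> bool) \<Rightarrow> (real \<Rightarrow> 'd site) measure"
  assumes "0 < p" and "p < critical_parameter TYPE('d)"
    and "norm l = 1"
    and "lam \<ge> 0" and "\<beta> \<ge> 0"
    and "\<And>\<omega>. quenched_law l lam \<beta> \<omega> (Q \<omega>)"
  shows "(AE (\<omega>, Y) in annealed_law p Q.
            ((\<lambda>t. (1 / t) *\<^sub>R real_site (Y t)) \<longlongrightarrow> speed p l lam \<beta>) at_top)
       \<and> (lam = 0 \<longrightarrow> speed p l lam \<beta> = 0)
       \<and> (\<forall>\<xi>. decay_rate TYPE('d) p \<xi> \<longrightarrow>
            (\<beta> > \<xi> \<longrightarrow> speed p l lam \<beta> = 0) \<and>
            (\<beta> < \<xi> \<and> lam \<noteq> 0 \<longrightarrow> speed p l lam \<beta> \<bullet> l > 0))"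
proof (intro conjI allI impI)
  define J where "J = (\<integral>\<^sup>+\<omega>. waiting \<beta> \<omega> (0 :: 'd site) \<partial>env p)"
  have speed: "speed p l lam \<beta> = enn2real (inverse J) *\<^sub>R drift l lam"
    by (simp add: speed_def J_def waiting_def)
  show "AE (\<omega>, Y) in annealed_law p Q. ((\<lambda>t. (1 / t) *\<^sub>R real_site (Y t)) \<longlongrightarrow> speed p l lam \<beta>) at_top"
    using assms(5,6) by (rule annealed_LLN)
  show "speed p l lam \<beta> = 0" if "lam = 0"
  proof -
    have "drift l lam = 0" using that by (simp add: drift_def vec_eq_iff)
    then show ?thesis by (simp add: speed)
  qed
  fix \<xi> assume \<xi>: "decay_rate TYPE('d) p \<xi>"
  show "speed p l lam \<beta> = 0" if "\<beta> > \<xi>"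
    using exp_moment_infinite[OF assms(1) \<xi> assms(5) that] by (simp add: speed J_def)
  show "speed p l lam \<beta> \<bullet> l > 0" if "\<beta> < \<xi> \<and> lam \<noteq> 0"
  proof -
    have fin: "J < \<infinity>" unfolding J_def using exp_moment_finite[OF assms(1) \<xi> assms(5)] that by simp
    have "(\<integral>\<^sup>+\<omega>. 1 \<partial>(env p :: ('d site \<Rightarrow> bool) measure)) \<le> J"
      unfolding J_def by (intro nn_integral_mono waiting_ge_1 assms(5))
    then have "1 \<le> J" by (simp add: prob_space.emeasure_space_1[OF prob_space_env, simplified])
    \<comment> \<open>Finiteness of \<open>J\<close> makes its inverse positive, and
      \<open>1 \<le> J\<close> keeps the inverse finite; \<open>enn2real\<close> would send an
      infinite inverse to 0.\<close>
    then have "0 < inverse J" "inverse J < top"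
      using fin by (auto simp: ennreal_inverse_positive less_top[symmetric])
    then have "0 < enn2real (inverse J)" by (simp add: enn2real_positive_iff)
    moreover have "0 < lam" using that assms(4) by simp
    ultimately show ?thesis using drift_inner_pos[OF assms(3)] by (simp add: speed)
  qed
qed

end
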